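(* The sufficient part of Treves' conjecture holds neither locally nor microlocally. That is: (local) It is not true that every sum of squares $P=\sum_{j=1}^N X_j(x,D)^2$ of real analytic vector fields satisfying Hörmander's bracket condition, for which every stratum of the Poisson–Treves stratification of $\mathrm{Char}(P)$ is symplectic, is analytic hypoelliptic. (microlocal) It is not true that for every such sum of squares $P$ (satisfying Hörmander's bracket condition) and every point $(x_0,\xi_0)\in\mathrm{Char}(P)$ having a conic neighborhood in which every stratum of the Poisson–Treves stratification is symplectic, $P$ is microlocally analytic hypoelliptic at $(x_0,\xi_0)$.
   Context: Let $X_1,\dots,X_N$ be vector fields with real analytic coefficients in an open set $\Omega\subset\mathbb{R}^n$, with symbols $X_j(x,\xi)$, and $P=\sum_{j=1}^N X_j(x,D)^2$. Hörmander's bracket condition: the Lie algebra generated by the vector fields and their commutators has dimension $n$ at every point of $\Omega$. $P$ is analytic hypoelliptic in $\Omega$ if $u\in\mathscr{D}'(\Omega)$ and $Pu\in C^\omega(\Omega)$ (real analytic functions) imply $u\in C^\omega(\Omega)$. $P$ is microlocally analytic hypoelliptic at $(x_0,\xi_0)$ if for every distribution $u$ defined near $x_0$, $(x_0,\xi_0)\notin WF_a(Pu)$ implies $(x_0,\xi_0)\notin WF_a(u)$, where $WF_a$ is the analytic wave front set. The characteristic variety is $\mathrm{Char}(P)=\{(x,\xi)\in T^*\Omega\setminus\{0\}: X_j(x,\xi)=0,\ j=1,\dots,N\}$. For $I=(i_1,\dots,i_m)$ with $i_j\in\{1,\dots,N\}$, let $X_I=\{X_{i_1},\{X_{i_2},\{\cdots\{X_{i_{m-1}},X_{i_m}\}\cdots\}\}\}$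 be the iterated Poisson bracket, of length $m$. The Poisson–Treves stratification of $\mathrm{Char}(P)$ is obtained in three steps. (1) The real analytic variety $\mathrm{Char}(P)$ is stratified into real analytic manifolds $\Sigma_i$ such that, for $i\ne i'$, either $\Sigma_i\cap\overline{\Sigma}_{i'}=\varnothing$ or $\Sigma_i\subset\partial\Sigma_{i'}$. (2) If the rank of the restriction of the canonical symplectic form changes on a stratum, one adds to the equations of the stratum those of the subvariety where the rank changes, and stratifies further, so as to obtain strata that are real analytic manifolds on which the symplectic form has constant rank. (3) These are refined further so that for each stratum $\Sigma$ there is an integer $\ell$ (the depth of the stratum) such that all brackets $X_I$ of length $<\ell$ vanish identically on $\Sigma$, while at each point of $\Sigma$ at least one bracket of length $\ell$ is nonzero. A stratum is symplectic if the restriction of the symplectic form to it is nondegenerate. Treves' conjecture: $P$ is analytic hypoelliptic if and only if every stratum of this stratification is symplectic. The "sufficient part" is the assertion that if every stratum is symplectic then $P$ is analytic hypoelliptic; its microlocal version asserts microlocal analytic hypoellipticity at points near which every stratum is symplectic. *)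

theory Defs
  imports "HOL-Analysis.Analysis"
begin

text \<open>
  The dimension is quantified inside the statement, so $R^n$ is the topological space of
  functions \<open>nat \<Rightarrow> real\<close> that are \<open>undefined\<close> outside \<open>{..<n}\<close>.  This is
  also the space underlying the product measure \<open>Pi\<^sub>M {..<n} (\<lambda>_. lborel)\<close>, the Lebesgue measure.
\<close>

type_synonym point = "nat \<Rightarrow> real"

abbreviation Rn :: "nat \<Rightarrow> point topology" where
  "Rn n \<equiv> product_topology (\<lambda>_. euclideanreal) {..<n}"


section \<open>Smooth and real analytic functions\<close>

definition pd :: "nat \<Rightarrow> (point \<Rightarrow> 'a::real_normed_vector) \<Rightarrow> point \<Rightarrow> 'a" where
  "pd i f x = vector_derivative (\<lambda>t. f (x(i := t))) (at (x i))"

primrec pds :: "nat list \<Rightarrow> (point \<Rightarrow> 'a::real_normed_vector) \<Rightarrow> point \<Rightarrow> 'a" where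
  "pds [] f = f"
| "pds (i # is) f = pd i (pds is f)"

definition smooth :: "nat \<Rightarrow> point set \<Rightarrow> (point \<Rightarrow> 'a::real_normed_vector) \<Rightarrow> bool" where
  "smooth n U f \<longleftrightarrow>
     (\<forall>is. set is \<subseteq> {..<n} \<longrightarrow>
        continuous_map (subtopology (Rn n) U) euclidean (pds is f) \<and>
        (\<forall>x\<in>U. \<forall>i<n. (\<lambda>t. pds is f (x(i := t))) differentiable (at (x i))))"

definition real_analytic :: "nat \<Rightarrow> point set \<Rightarrow> (point \<Rightarrow> 'a::real_normed_vector) \<Rightarrow> bool" where
  "real_analytic n U f \<longleftrightarrow>
     (\<forall>a\<in>U. \<exists>r>0. \<exists>c :: (nat \<Rightarrow> nat) \<Rightarrow> 'a. \<forall>x\<in>U. (\<forall>i<n. \<bar>x i - a i\<bar> < r) \<longrightarrow>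
        ((\<lambda>\<alpha>. (\<Prod>i<n. (x i - a i) ^ \<alpha> i) *\<^sub>R c \<alpha>) has_sum f x) ({..<n} \<rightarrow>\<^sub>E UNIV))"


section \<open>Distributions\<close>

definition test_functions :: "nat \<Rightarrow> point set \<Rightarrow> (point \<Rightarrow> complex) set" where
  "test_functions n U =
     {\<phi>. smooth n (topspace (Rn n)) \<phi> \<and>
         (\<exists>K. compactin (Rn n) K \<and> K \<subseteq> U \<and> (\<forall>x. x \<notin> K \<longrightarrow> \<phi> x = 0))}"

text \<open>Only the values on test functions are meaningful.\<close>
type_synonym functional = "(point \<Rightarrow> complex) \<Rightarrow> complex"

definition distribution :: "nat \<Rightarrow> point set \<Rightarrow> functional \<Rightarrow> bool" where
  "distribution n U u \<longleftrightarrow>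
     (\<forall>\<phi>\<in>test_functions n U. \<forall>\<psi>\<in>test_functions n U. \<forall>a b.
        u (\<lambda>x. a * \<phi> x + b * \<psi> x) = a * u \<phi> + b * u \<psi>) \<and>
     (\<forall>K. compactin (Rn n) K \<and> K \<subseteq> U \<longrightarrow>
        (\<exists>C k. \<forall>\<phi>\<in>test_functions n U. (\<forall>x. x \<notin> K \<longrightarrow> \<phi> x = 0) \<longrightarrow>
           norm (u \<phi>) \<le>
             C * (\<Sum>is\<in>{is. set is \<subseteq> {..<n} \<and> length is \<le> k}. SUP x\<in>K. norm (pds is \<phi> x))))"

definition analytic_distribution :: "nat \<Rightarrow> point set \<Rightarrow> functional \<Rightarrow> bool" where
  "analytic_distribution n U u \<longleftrightarrow>
     (\<exists>f. real_analytic n U f \<and>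
       (\<forall>\<phi>\<in>test_functions n U. u \<phi> = (LINT x|Pi\<^sub>M {..<n} (\<lambda>_. lborel). f x * \<phi> x)))"


section \<open>Sums of squares\<close>

text \<open>\<open>X j k\<close> is the \<open>k\<close>-th coefficient of the \<open>j\<close>-th vector field (\<open>j < N\<close>, \<open>k < n\<close>).\<close>
type_synonym vfield = "nat \<Rightarrow> point \<Rightarrow> real"

definition commutator :: "nat \<Rightarrow> vfield \<Rightarrow> vfield \<Rightarrow> vfield" where
  "commutator n V W = (\<lambda>k x. \<Sum>l<n. V l x * pd l (W k) x - W l x * pd l (V k) x)"

inductive_set lie_algebra :: "nat \<Rightarrow> nat \<Rightarrow> (nat \<Rightarrow> vfield) \<Rightarrow> vfield set"
  for n N :: nat and X :: "nat \<Rightarrow> vfield" where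
  generator: "j < N \<Longrightarrow> X j \<in> lie_algebra n N X"
| lincomb: "V \<in> lie_algebra n N X \<Longrightarrow> W \<in> lie_algebra n N X \<Longrightarrow>
    (\<lambda>k x. a * V k x + b * W k x) \<in> lie_algebra n N X"
| commutator: "V \<in> lie_algebra n N X \<Longrightarrow> W \<in> lie_algebra n N X \<Longrightarrow>
    commutator n V W \<in> lie_algebra n N X"

text \<open>
  The values at \<open>x\<close> of the fields in the Lie algebra form a linear subspace of $R^n$; it has
  dimension \<open>n\<close> iff it is the whole space.
\<close>
definition hormander_condition :: "nat \<Rightarrow> point set \<Rightarrow> nat \<Rightarrow> (nat \<Rightarrow> vfield) \<Rightarrow> bool" where
  "hormander_condition n \<Omega> N X \<longleftrightarrow>
     (\<forall>x\<in>\<Omega>. \<forall>w. \<exists>V\<in>lie_algebra n N X. \<forall>k<n. V k x = w k)"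

definition hormander_fields :: "nat \<Rightarrow> point set \<Rightarrow> nat \<Rightarrow> (nat \<Rightarrow> vfield) \<Rightarrow> bool" where
  "hormander_fields n \<Omega> N X \<longleftrightarrow>
     openin (Rn n) \<Omega> \<and> (\<forall>j<N. \<forall>k<n. real_analytic n \<Omega> (X j k)) \<and> hormander_condition n \<Omega> N X"

definition D :: "nat \<Rightarrow> (point \<Rightarrow> complex) \<Rightarrow> point \<Rightarrow> complex" where
  "D k f x = - \<i> * pd k f x"

text \<open>The formal transpose of \<open>X\<^sub>j(x,D)\<close>.\<close>
definition field_transpose :: "nat \<Rightarrow> vfield \<Rightarrow> (point \<Rightarrow> complex) \<Rightarrow> point \<Rightarrow> complex" where
  "field_transpose n V \<phi> x = - (\<Sum>k<n. D k (\<lambda>y. of_real (V k y) * \<phi> y) x)"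

definition sum_of_squares :: "nat \<Rightarrow> nat \<Rightarrow> (nat \<Rightarrow> vfield) \<Rightarrow> functional \<Rightarrow> functional" where
  "sum_of_squares n N X u =
     (\<lambda>\<phi>. u (\<lambda>x. \<Sum>j<N. field_transpose n (X j) (field_transpose n (X j) \<phi>) x))"

definition analytic_hypoelliptic :: "nat \<Rightarrow> point set \<Rightarrow> nat \<Rightarrow> (nat \<Rightarrow> vfield) \<Rightarrow> bool" where
  "analytic_hypoelliptic n \<Omega> N X \<longleftrightarrow>
     (\<forall>u. distribution n \<Omega> u \<and> analytic_distribution n \<Omega> (sum_of_squares n N X u) \<longrightarrow>
        analytic_distribution n \<Omega> u)"


section \<open>The analytic wave front set\<close>

text \<open>
  The cotangent bundle of $R^n$ is $R^{2n}$: the coordinates of \<open>p\<close> with index below \<open>n\<close> are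
  the position, and \<open>p (n + k)\<close> is the \<open>k\<close>-th covariable.
\<close>
definition base :: "nat \<Rightarrow> point \<Rightarrow> point" where
  "base n p = restrict p {..<n}"

definition cotangent :: "nat \<Rightarrow> point set \<Rightarrow> point set" where
  "cotangent n U = {p \<in> topspace (Rn (2 * n)). base n p \<in> U \<and> (\<exists>k<n. p (n + k) \<noteq> 0)}"

text \<open>
  Definition by the Fourier-Bros-Iagolnitzer transform
  $\int e^{-\tau (z-y)^2/2} \eta(y) u(y)\,dy$: with \<open>z = x - i \<xi>\<close>, multiplying it by the weight
  $e^{-\tau |\xi|^2/2}$ gives the pairing of \<open>u\<close> with \<open>\<eta>\<close> times the kernel below.
  The point is outside the wave front set iff this decays exponentially near it as \<open>\<tau> \<rightarrow> \<infinity>\<close>.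
\<close>
definition fbi_kernel :: "nat \<Rightarrow> point \<Rightarrow> real \<Rightarrow> point \<Rightarrow> complex" where
  "fbi_kernel n p \<tau> y =
     exp (of_real (- (\<tau> / 2) * (\<Sum>k<n. (p k - y k)\<^sup>2)) +
          \<i> * of_real (\<tau> * (\<Sum>k<n. (p k - y k) * p (n + k))))"

definition WF_a :: "nat \<Rightarrow> point set \<Rightarrow> functional \<Rightarrow> point set" where
  "WF_a n U u = {p \<in> cotangent n U. \<not>
     (\<exists>\<eta>\<in>test_functions n U. \<exists>V W C \<epsilon>.
        openin (Rn n) V \<and> base n p \<in> V \<and> (\<forall>y\<in>V. \<eta> y = 1) \<and>
        openin (Rn (2 * n)) W \<and> p \<in> W \<and> \<epsilon> > 0 \<and>
        (\<forall>q\<in>W. \<forall>\<tau>\<ge>1. norm (u (\<lambda>y. \<eta> y * fbi_kernel n q \<tau> y)) \<le> C * exp (- \<epsilon> * \<tau>)))}"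

definition microlocally_analytic_hypoelliptic_at ::
    "nat \<Rightarrow> point set \<Rightarrow> nat \<Rightarrow> (nat \<Rightarrow> vfield) \<Rightarrow> point \<Rightarrow> bool" where
  "microlocally_analytic_hypoelliptic_at n \<Omega> N X p \<longleftrightarrow>
     (\<forall>U u. openin (Rn n) U \<and> U \<subseteq> \<Omega> \<and> base n p \<in> U \<and> distribution n U u \<and>
        p \<notin> WF_a n U (sum_of_squares n N X u) \<longrightarrow> p \<notin> WF_a n U u)"


section \<open>Symbols, characteristic variety, symplectic form\<close>

definition field_symbol :: "nat \<Rightarrow> vfield \<Rightarrow> point \<Rightarrow> real" where
  "field_symbol n V p = (\<Sum>k<n. V k (base n p) * p (n + k))"

definition characteristic_variety :: "nat \<Rightarrow> point set \<Rightarrow> nat \<Rightarrow> (nat \<Rightarrow> vfield) \<Rightarrow> point set" where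
  "characteristic_variety n \<Omega> N X = {p \<in> cotangent n \<Omega>. \<forall>j<N. field_symbol n (X j) p = 0}"

definition poisson :: "nat \<Rightarrow> (point \<Rightarrow> real) \<Rightarrow> (point \<Rightarrow> real) \<Rightarrow> point \<Rightarrow> real" where
  "poisson n f g p = (\<Sum>k<n. pd (n + k) f p * pd k g p - pd k f p * pd (n + k) g p)"

fun bracket :: "nat \<Rightarrow> (nat \<Rightarrow> vfield) \<Rightarrow> nat list \<Rightarrow> point \<Rightarrow> real" where
  "bracket n X [] = (\<lambda>_. 0)"
| "bracket n X [i] = field_symbol n (X i)"
| "bracket n X (i # is) = poisson n (field_symbol n (X i)) (bracket n X is)"

definition symplectic_form :: "nat \<Rightarrow> point \<Rightarrow> point \<Rightarrow> real" where
  "symplectic_form n v w = (\<Sum>k<n. v (n + k) * w k - v k * w (n + k))"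

text \<open>The number \<open>d\<close> is the codimension.\<close>
definition analytic_submanifold :: "nat \<Rightarrow> point set \<Rightarrow> bool" where
  "analytic_submanifold m M \<longleftrightarrow>
     (\<exists>d::nat. \<forall>p\<in>M. \<exists>U f. openin (Rn m) U \<and> p \<in> U \<and> (\<forall>i<d. real_analytic m U (f i)) \<and>
        M \<inter> U = {x \<in> U. \<forall>i<d. f i x = (0::real)} \<and>
        (\<forall>c. (\<forall>k<m. (\<Sum>i<d. c i * pd k (f i) p) = 0) \<longrightarrow> (\<forall>i<d. c i = 0)))"

definition tangent :: "nat \<Rightarrow> point set \<Rightarrow> point \<Rightarrow> point set" where
  "tangent m M p =
     {v \<in> topspace (Rn m). \<exists>\<gamma>. \<gamma> 0 = p \<and> (\<exists>\<epsilon>>0. \<forall>t. \<bar>t\<bar> < \<epsilon> \<longrightarrow> \<gamma> t \<in> M) \<and>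
        (\<forall>i<m. ((\<lambda>t. \<gamma> t i) has_real_derivative v i) (at 0))}"

definition symplectic :: "nat \<Rightarrow> point set \<Rightarrow> bool" where
  "symplectic n M \<longleftrightarrow>
     (\<forall>p\<in>M. \<forall>v\<in>tangent (2 * n) M p.
        (\<forall>w\<in>tangent (2 * n) M p. symplectic_form n v w = 0) \<longrightarrow> (\<forall>i<2 * n. v i = 0))"

text \<open>
  A bilinear form on a finite-dimensional space \<open>T\<close> has rank at least \<open>r\<close> iff there are \<open>r\<close>
  vectors whose images in the dual of \<open>T\<close> are linearly independent, that is, admit a dual system
  in \<open>T\<close>.
\<close>
definition symplectic_rank :: "nat \<Rightarrow> point set \<Rightarrow> point \<Rightarrow> nat" where
  "symplectic_rank n M p =
     (GREATEST r. \<exists>v w. (\<forall>i<r. v i \<in> tangent (2 * n) M p \<and> w i \<in> tangent (2 * n) M p) \<and>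
        (\<forall>i<r. \<forall>j<r. symplectic_form n (v i) (w j) = of_bool (i = j)))"

definition constant_rank :: "nat \<Rightarrow> point set \<Rightarrow> bool" where
  "constant_rank n M \<longleftrightarrow> (\<exists>r. \<forall>p\<in>M. symplectic_rank n M p = r)"

definition constant_depth :: "nat \<Rightarrow> nat \<Rightarrow> (nat \<Rightarrow> vfield) \<Rightarrow> point set \<Rightarrow> bool" where
  "constant_depth n N X M \<longleftrightarrow>
     (\<exists>l. (\<forall>I. set I \<subseteq> {..<N} \<and> length I < l \<longrightarrow> (\<forall>p\<in>M. bracket n X I p = 0)) \<and>
          (\<forall>p\<in>M. \<exists>I. set I \<subseteq> {..<N} \<and> length I = l \<and> bracket n X I p \<noteq> 0))"


section \<open>The Poisson-Treves stratification\<close>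

text \<open>
  Points near which \<open>W\<close> is an analytic manifold having the property \<open>Q\<close>, and each set in \<open>\<C>\<close>
  contains either all or nothing of \<open>W\<close>.
\<close>
definition regular_part ::
    "nat \<Rightarrow> (point set \<Rightarrow> bool) \<Rightarrow> point set set \<Rightarrow> point set \<Rightarrow> point set" where
  "regular_part m Q \<C> W =
     {p \<in> W. \<exists>U. openin (Rn m) U \<and> p \<in> U \<and> analytic_submanifold m (W \<inter> U) \<and> Q (W \<inter> U) \<and>
        (\<forall>A\<in>\<C>. W \<inter> U \<subseteq> A \<or> W \<inter> U \<inter> A = {})}"

text \<open>
  The canonical stratification of \<open>V\<close> into connected manifolds with property \<open>Q\<close>, refining the
  sets in \<open>\<C>\<close>: split off the connected components of the regular part, and repeat this with the
  exceptional subvariety that is left.  \<open>strata_upto\<close> returns what is left after \<open>k\<close> rounds and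
  the strata found so far.  A new stratum is in addition compatible with the closures of the strata
  found before; being connected, it is contained in such a closure or disjoint from it, which is
  the frontier condition.  (The closure of a later stratum does not meet an earlier one, because the
  regular part is relatively open.)
\<close>
primrec strata_upto ::
    "nat \<Rightarrow> (point set \<Rightarrow> bool) \<Rightarrow> point set set \<Rightarrow> point set \<Rightarrow> nat \<Rightarrow>
     point set \<times> point set set" where
  "strata_upto m Q \<C> V 0 = (V, {})"
| "strata_upto m Q \<C> V (Suc k) =
     (let (W, S) = strata_upto m Q \<C> V k;
          G = regular_part m Q (\<C> \<union> (\<lambda>\<Sigma>. Rn m closure_of \<Sigma>) ` S) W
      in (W - G, S \<union> connected_components_of (subtopology (Rn m) G)))"

definition strata ::
    "nat \<Rightarrow> (point set \<Rightarrow> bool) \<Rightarrow> point set set \<Rightarrow> point set \<Rightarrow> point set set" where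
  "strata m Q \<C> V = (\<Union>k. snd (strata_upto m Q \<C> V k))"

text \<open>
  The three steps: manifolds, then constant rank of the symplectic form, then also constant depth.
  In the last two, \<open>regular_part\<close> also excludes the points where the rank (the depth) changes;
  each refinement keeps the earlier strata as unions of new ones.
\<close>
definition poisson_treves_strata ::
    "nat \<Rightarrow> point set \<Rightarrow> nat \<Rightarrow> (nat \<Rightarrow> vfield) \<Rightarrow> point set set" where
  "poisson_treves_strata n \<Omega> N X =
     (let V = characteristic_variety n \<Omega> N X;
          S1 = strata (2 * n) (\<lambda>_. True) {} V;
          S2 = strata (2 * n) (constant_rank n) S1 V
      in strata (2 * n) (\<lambda>M. constant_rank n M \<and> constant_depth n N X M) S2 V)"

definition conic_neighborhood :: "nat \<Rightarrow> point set \<Rightarrow> point \<Rightarrow> point set \<Rightarrow> bool" where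
  "conic_neighborhood n \<Omega> p \<Gamma> \<longleftrightarrow>
     openin (Rn (2 * n)) \<Gamma> \<and> \<Gamma> \<subseteq> cotangent n \<Omega> \<and> p \<in> \<Gamma> \<and>
     (\<forall>q\<in>\<Gamma>. \<forall>t>0. (\<lambda>i. if n \<le> i \<and> i < 2 * n then t * q i else q i) \<in> \<Gamma>)"

end

theory Submission
  imports Defs "HOL-Probability.Probability" "HOL-Real_Asymp.Real_Asymp"
begin

text \<open>
  The counterexample is the operator
  $P = D_0^2 + D_1^2 + x_0^2 (D_2^2 + D_3^2) + x_1^2 D_2^2 + x_1^6 D_3^2$ on $R^4$, a variant of the
  operator of Albano, Bove and Mughetti. Its characteristic variety is
  $x_0 = x_1 = \xi_0 = \xi_1 = 0$, a single symplectic stratum of depth 2.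

  It has the null solutions
  $u_\rho = \exp (i \rho x_3 - \kappa x_2 - \mu x_0^2 / 2)\, g (x_1)$ with $\mu^2 = \rho^2 - \kappa^2$
  as soon as $g'' = (\rho^2 x^6 - \kappa^2 x^2 + \mu) g$, that is, if a sextic double well has the energy
  $-\mu$. With $\kappa^2 = (4 J + 3) \rho$ the sextic oscillator is quasi-exactly solvable, and a
  solution is a polynomial with positive coefficients times a quartic exponential; here $\rho$ is at
  least of the order $J^3$, so that $\kappa = o(\rho)$, and $u_\rho$ grows at most like
  $\exp (\kappa (|x_1| + |x_2|))$. A lacunary sum of such solutions with weights
  $\exp (- o (\rho))$ converges to a solution of $P u = 0$. Its derivatives at 0 along the last
  axis are too large for an analytic function, and its FBI transform at $(0, d x_3)$ is dominated, for
  $\tau$ in the sequence of the $\rho$, by the corresponding term, so that it does not decay exponentially.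
\<close>

section \<open>The sextic oscillator\<close>

text \<open>The two fields with coefficient x_0 yield the brackets \<xi>_2 and \<xi>_3, so every
  point of the variety has depth 2. This hides the behaviour in x_1 where \<xi>_2 = 0: only x_1^3
  \<xi>_3 remains there, and the x_1 part degenerates to third order. The real exponent -\<kappa>
  x_2 amounts to an imaginary covariable \<xi>_2, which makes the term x_1^2 \<xi>_2^2 attractive.
  The well \<rho>^2 x^6 - \<kappa>^2 x^2 has depth of order \<kappa>^3 / \<rho>, and its energy must
  cancel the ground state energy \<mu>, close to \<rho>, of the x_0 oscillator; this predicts
  \<kappa> of order \<rho>^(2/3). The obstacle is to have an exact energy together with bounds on g
  that are uniform in \<rho>. Quasi-exact solvability replaces asymptotic analysis: since the
  polynomial has positive coefficients, the recurrence alone gives both the bounds on g and the size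
  of the energy. The price is that \<rho> cannot be prescribed. Only a sequence of frequencies is
  available, hence a lacunary sum and not an integral over frequencies.\<close>

text \<open>
  The coefficients of $y^{2 m}$ in an even power series $p$ with $p(0) = 1$ and
  $p'' - 2 y^3 p' + 4 J y^2 p = l p$, the equation satisfied by $p$ if $p \exp (- y^4 / 4)$ solves
  the sextic oscillator.  The series is a polynomial of degree $2 J$ when the coefficient of index
  $J + 1$ vanishes.
\<close>

fun qes_coeff :: "nat \<Rightarrow> real \<Rightarrow> nat \<Rightarrow> real" where
  "qes_coeff J l 0 = 1"
| "qes_coeff J l (Suc 0) = l / 2"
| "qes_coeff J l (Suc (Suc m)) =
     (l * qes_coeff J l (Suc m) - 4 * (real J - real m) * qes_coeff J l m) / ((2 * m + 4) * (2 * m + 3))"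

lemma continuous_qes_coeff: "isCont (\<lambda>l. qes_coeff J l m) l"
  by (induction J l m rule: qes_coeff.induct) (auto intro!: continuous_intros)

text \<open>The second inequality drives the induction: it keeps the subtracted term
  \<open>4 * (real J - real m) * qes_coeff J l m\<close> of the recurrence below half of
  \<open>l * qes_coeff J l (Suc m)\<close>, and the size of \<open>l\<close> then restores the
  inequality at the next index.\<close>

lemma qes_coeff_large:
  assumes l: "l \<ge> 8 * (real J + 2)\<^sup>2" and m: "m \<le> J"
  shows "qes_coeff J l m > 0 \<and> l * qes_coeff J l (Suc m) \<ge> 8 * (real J + 1) * qes_coeff J l m"
  using m
proof (induction m)
  case 0
  have "1 * (real J + 1) \<le> (real J + 2) * (real J + 2)" by (intro mult_mono) auto
  then have a: "l \<ge> 8 * (real J + 1)" using l by (simp add: power2_eq_square)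
  then have "l * l \<ge> (8 * (real J + 1)) * (8 * (real J + 1))" by (intro mult_mono) auto
  moreover have "(8 * (real J + 1)) * (8 * (real J + 1)) \<ge> (8 * (real J + 1)) * 2"
    by (intro mult_left_mono) auto
  ultimately show ?case by simp
next
  case (Suc m)
  let ?a = "qes_coeff J l"
  have lpos: "l > 0" using l by (smt (verit) zero_le_power2 zero_less_power2 of_nat_0_le_iff)
  from Suc have IH: "?a m > 0" "l * ?a (Suc m) \<ge> 8 * (real J + 1) * ?a m" by auto
  then have pos: "?a (Suc m) > 0"
    by (smt (verit) lpos mult_nonneg_nonpos mult_pos_pos of_nat_0_le_iff)
  have "4 * (real J - real m) * ?a m \<le> 4 * (real J + 1) * ?a m"
    using IH(1) by (intro mult_right_mono) auto
  with IH(2) have 1: "l * ?a (Suc m) / 2 \<le> l * ?a (Suc m) - 4 * (real J - real m) * ?a m"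
    by (simp add: field_simps)
  have d: "((2 * real m + 4) * (2 * real m + 3)) \<le> 4 * (real J + 2)\<^sup>2"
  proof -
    have "(2 * real m + 4) * (2 * real m + 3) \<le> (2 * (real J + 2)) * (2 * (real J + 2))"
      using Suc.prems by (intro mult_mono) auto
    then show ?thesis by (simp add: power2_eq_square algebra_simps)
  qed
  have "1 * (real J + 1) \<le> (real J + 2) * (real J + 2)" by (intro mult_mono) auto
  then have l8: "8 * (real J + 1) \<le> 8 * (real J + 2)\<^sup>2" by (simp add: power2_eq_square)
  have "8 * (real J + 1) * (2 * ((2 * real m + 4) * (2 * real m + 3))) \<le> 8 * (real J + 2)\<^sup>2 * (8 * (real J + 2)\<^sup>2)"
  proof -
    have "8 * (real J + 1) * (2 * ((2 * real m + 4) * (2 * real m + 3)))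
       \<le> (8 * (real J + 2)\<^sup>2) * (2 * (4 * (real J + 2)\<^sup>2))"
      using d by (intro mult_mono[OF l8]) (auto simp: mult.commute)
    then show ?thesis by simp
  qed
  also have "\<dots> \<le> l * l" using l lpos by (intro mult_mono) auto
  finally have 2: "8 * (real J + 1) * (2 * ((2 * real m + 4) * (2 * real m + 3))) \<le> l * l" .
  have D: "(2 * real m + 4) * (2 * real m + 3) > 0" by simp
  have "8 * (real J + 1) * ?a (Suc m) \<le> l * (l * ?a (Suc m) / 2) / ((2 * real m + 4) * (2 * real m + 3))"
  proof -
    have "8 * (real J + 1) * (2 * ((2 * real m + 4) * (2 * real m + 3))) * ?a (Suc m) \<le> l * l * ?a (Suc m)"
      using 2 pos by (intro mult_right_mono) auto
    then show ?thesis using D by (simp add: pos_le_divide_eq mult_ac)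
  qed
  also have "\<dots> \<le> l * (l * ?a (Suc m) - 4 * (real J - real m) * ?a m) / ((2 * real m + 4) * (2 * real m + 3))"
    using 1 lpos D by (intro divide_right_mono mult_left_mono) auto
  finally show ?case using pos by simp
qed

text \<open>
  At the largest \<open>l\<close> for which one of the coefficients up to the index \<open>J + 1\<close> vanishes, all of them
  are nonnegative; if one of index at most \<open>J\<close> were 0, the next one would be negative.
\<close>

lemma qes_eigenvalue_exists:
  assumes J: "J \<ge> 1"
  obtains l where "l > 0" "\<And>m. m \<le> J \<Longrightarrow> qes_coeff J l m > 0" "\<And>m. m > J \<Longrightarrow> qes_coeff J l m = 0"
proof -
  \<comment> \<open>By \<open>qes_coeff_large\<close> the cutoff
    \<open>8 * (real J + 2)\<^sup>2\<close> excludes no \<open>l \<ge> 0\<close> at which positivity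
    fails, so \<open>B\<close> is a compact set with a genuine maximum. It contains 0 because the
    coefficient of index 1 is \<open>l / 2\<close>.\<close>
  define B where "B = (\<Union>m\<le>Suc J. {l \<in> {0..8 * (real J + 2)\<^sup>2}. qes_coeff J l m \<le> 0})"
  have B: "l \<in> B" if "l \<ge> 0" "m \<le> Suc J" "qes_coeff J l m \<le> 0" for l m
  proof -
    have "l \<le> 8 * (real J + 2)\<^sup>2"
    proof (rule ccontr)
      assume *: "\<not> ?thesis"
      have "qes_coeff J l m > 0"
      proof (cases "m \<le> J")
        case True then show ?thesis using qes_coeff_large[of J l m] * by auto
      next
        case False
        with that have m: "m = Suc J" by simp
        have "l > 0" using * by (smt (verit) zero_le_power2)
        then show ?thesis unfolding m using qes_coeff_large[of J l J] *
          by (smt (verit) mult_nonneg_nonpos mult_pos_pos of_nat_0_le_iff order_refl)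
      qed
      with that show False by simp
    qed
    with that show ?thesis by (auto simp: B_def)
  qed
  have "compact B" unfolding B_def
  proof (intro compact_UN ballI)
    fix m
    have "closed {l \<in> {0..8 * (real J + 2)\<^sup>2}. qes_coeff J l m \<le> 0}"
      unfolding Collect_conj_eq Collect_mem_eq
      by (intro closed_Int closed_atLeastAtMost closed_Collect_le)
         (simp_all add: continuous_on_eq_continuous_at continuous_qes_coeff)
    then show "compact {l \<in> {0..8 * (real J + 2)\<^sup>2}. qes_coeff J l m \<le> 0}"
      unfolding compact_eq_bounded_closed
      by (intro conjI bounded_subset[OF bounded_closed_interval[of 0 "8 * (real J + 2)\<^sup>2"]]) auto
  qed auto
  moreover have "0 \<in> B" by (rule B[of 0 "Suc 0"]) auto
  ultimately obtain l where l: "l \<in> B" "\<And>t. t \<in> B \<Longrightarrow> t \<le> l"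
    using compact_attains_sup[of B] by blast
  have l0: "l \<ge> 0" using l(1) by (auto simp: B_def)
  \<comment> \<open>Beyond the maximum \<open>l\<close> of \<open>B\<close> all these coefficients
    are positive, so nonnegativity at \<open>l\<close> follows by a limit from the right.\<close>
  have nonneg: "qes_coeff J l m \<ge> 0" if "m \<le> Suc J" for m
  proof (rule tendsto_lowerbound)
    show "((\<lambda>t. qes_coeff J t m) \<longlongrightarrow> qes_coeff J l m) (at_right l)"
      using continuous_qes_coeff[of l J m] by (simp add: isCont_def filterlim_at_split)
    have "qes_coeff J t m \<ge> 0" if "t > l" for t
      using B[of t m] l(2)[of t] \<open>m \<le> Suc J\<close> that l0 by linarith
    then show "\<forall>\<^sub>F t in at_right l. 0 \<le> qes_coeff J t m"
      by (auto simp: eventually_at_filter)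
  qed auto
  have pos: "qes_coeff J l m > 0" if "m \<le> J" for m
    using that
  proof (induction m)
    case (Suc m)
    show ?case
    proof (rule ccontr)
      assume "\<not> ?case"
      with nonneg[of "Suc m"] Suc.prems have 0: "qes_coeff J l (Suc m) = 0" by auto
      have "qes_coeff J l (Suc (Suc m)) < 0"
        using Suc by (simp add: 0 divide_neg_pos)
      then show False using nonneg[of "Suc (Suc m)"] Suc.prems by simp
    qed
  qed auto
  have zero1: "qes_coeff J l (Suc J) = 0"
  proof -
    obtain m where m: "m \<le> Suc J" "qes_coeff J l m \<le> 0" using l(1) by (auto simp: B_def)
    moreover have "\<not> m \<le> J" using pos[of m] m(2) by linarith
    ultimately have "m = Suc J" by simp
    with m nonneg[of "Suc J"] show ?thesis by auto
  qed
  \<comment> \<open>The coefficient of index \<open>J + 2\<close> vanishes through the factor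
    \<open>real J - real J\<close>; two consecutive zeros then propagate.\<close>
  have "qes_coeff J l (Suc J + n) = 0 \<and> qes_coeff J l (Suc (Suc J + n)) = 0" for n
    by (induction n) (use zero1 in auto)
  then have zero: "qes_coeff J l (Suc J + n) = 0" for n by blast
  have "qes_coeff J l m = 0" if "m > J" for m
    using zero[of "m - Suc J"] that by (simp only: le_add_diff_inverse Suc_le_eq)
  moreover have "l > 0" using pos[of "Suc 0"] J by auto
  ultimately show ?thesis using that pos by blast
qed

lemma sum_even_powers_le_exp:
  fixes z :: real
  assumes "z \<ge> 0"
  shows "(\<Sum>m\<le>J. z ^ (2 * m) / fact (2 * m)) \<le> exp z"
proof -
  have "(\<Sum>m\<le>J. z ^ (2 * m) / fact (2 * m)) = (\<Sum>n\<in>(\<lambda>m. 2 * m) ` {..J}. z ^ n / fact n)"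
    by (subst sum.reindex) (auto simp: inj_on_def)
  also have "\<dots> \<le> (\<Sum>n. z ^ n / fact n)"
    using summable_exp_generic[of z] assms
    by (intro sum_le_suminf) (auto simp: scaleR_conv_of_real divide_inverse mult.commute)
  also have "\<dots> = exp z" by (simp add: exp_def scaleR_conv_of_real divide_inverse mult.commute)
  finally show ?thesis .
qed

text \<open>With the subtracted term moved across, all terms of the recurrence are nonnegative, and
  dropping one or the other gives \<open>up\<close> and \<open>low\<close>. Iterating
  \<open>up\<close> bounds the coefficients of p by those of cosh (sqrt l y). Multiplying
  \<open>up\<close> with \<open>low\<close> bounds l from below, by the order J^(3/2) for m near J /
  2. The lower bound of G comes from the constant term of p.\<close>

lemma sextic_solution:
  assumes J: "J \<ge> 1"
  obtains l :: real and G G' where "l > 0" "\<And>m. m < J \<Longrightarrow> 4 * (real J - real m) * ((2 * real m + 2) * (2 * real m + 1)) \<le> l\<^sup>2"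
    "\<And>y. (G has_real_derivative G' y) (at y)"
    "\<And>y. (G' has_real_derivative (y ^ 6 - (4 * real J + 3) * y\<^sup>2 + l) * G y) (at y)"
    "\<And>y. exp (- (y ^ 4) / 4) \<le> G y" "\<And>y. G y \<le> exp (sqrt l * \<bar>y\<bar>)"
proof -
  obtain l where l: "l > 0" "\<And>m. m \<le> J \<Longrightarrow> qes_coeff J l m > 0" "\<And>m. m > J \<Longrightarrow> qes_coeff J l m = 0"
    using qes_eigenvalue_exists[OF J] by blast
  define a where "a = qes_coeff J l"
  have a0: "a 0 = 1" and rec0: "2 * a (Suc 0) = l * a 0" by (auto simp: a_def)
  have rec: "(2 * m + 4) * (2 * m + 3) * a (Suc (Suc m)) + 4 * (real J - real m) * a m = l * a (Suc m)" for m
  proof -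
    have "(2 * real m + 4) * (2 * real m + 3) \<noteq> 0" by (simp add: add_eq_0_iff_both_eq_0)
    then show ?thesis by (simp add: a_def field_simps)
  qed
  have apos: "a m \<ge> 0" for m using l by (metis a_def less_imp_le linorder_not_le order_refl)
  have up: "(2 * real m + 2) * (2 * real m + 1) * a (Suc m) \<le> l * a m" for m
  proof (cases m)
    case 0 then show ?thesis using rec0 by simp
  next
    case (Suc k)
    show ?thesis
    proof (cases "k \<le> J")
      case True
      then have "4 * (real J - real k) * a k \<ge> 0" using apos by simp
      then show ?thesis using rec[of k] Suc by (simp add: algebra_simps)
    next
      case False
      then show ?thesis using Suc l(3) by (simp add: a_def)
    qed
  qed
  have low: "4 * (real J - real m) * a m \<le> l * a (Suc m)" for m
  proof -
    have "(2 * real m + 4) * (2 * real m + 3) * a (Suc (Suc m)) \<ge> 0" using apos by simp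
    then show ?thesis using rec[of m] by simp
  qed
  define P where "P = (\<Sum>m\<le>J. monom (a m) (2 * m))"
  have cP: "coeff P n = (if even n then a (n div 2) else 0)" for n
  proof -
    have "coeff P n = (\<Sum>m\<le>J. if m = n div 2 \<and> even n then a m else 0)"
      unfolding P_def coeff_sum by (rule sum.cong) auto
    also have "\<dots> = (if even n then (\<Sum>m\<le>J. if m = n div 2 then a m else 0) else 0)" by auto
    also have "\<dots> = (if even n then a (n div 2) else 0)"
      using l(3) by (auto simp: a_def not_le)
    finally show ?thesis .
  qed
  have ode: "pderiv (pderiv P) + smult (4 * real J) (monom 1 2 * P) =
      smult l P + smult 2 (monom 1 3 * pderiv P)"
  proof (rule poly_eqI)
    fix n
    show "coeff (pderiv (pderiv P) + smult (4 * real J) (monom 1 2 * P)) n =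
        coeff (smult l P + smult 2 (monom 1 3 * pderiv P)) n"
    proof (cases "even n")
      case False
      then have "n < 2 \<or> n \<ge> 3" by presburger
      with False show ?thesis by (auto simp: coeff_pderiv cP coeff_monom_mult)
    next
      case True
      then obtain k where k: "n = 2 * k" by blast
      show ?thesis
      proof (cases k)
        case 0
        then show ?thesis using k rec0 by (simp add: coeff_pderiv cP coeff_monom_mult)
      next
        case (Suc j)
        have *: "Suc (2 * Suc j - 3) = 2 * j" if "2 * Suc j \<ge> 3" using that by simp
        have "real (Suc (2 * Suc j)) * real (Suc (Suc (2 * Suc j))) * a (Suc (Suc j)) + 4 * real J * a j = l * a (Suc j) + 2 * real (2 * j) * a j"
          using rec[of j] by (simp add: algebra_simps)
        moreover have "coeff (pderiv (pderiv P)) n = real (Suc (2 * Suc j)) * real (Suc (Suc (2 * Suc j))) * a (Suc (Suc j))"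
          by (simp add: coeff_pderiv cP k Suc)
        moreover have "coeff (monom 1 2 * P) n = a j" by (simp add: coeff_monom_mult cP k Suc)
        moreover have "coeff (monom 1 3 * pderiv P) n = real (2 * j) * a j"
          using * by (cases j) (simp_all add: coeff_pderiv coeff_monom_mult cP k Suc)
        ultimately show ?thesis by (simp add: cP k Suc)
      qed
    qed
  qed
  define p p' p'' where "p = poly P" and "p' = poly (pderiv P)" and "p'' = poly (pderiv (pderiv P))"
  have p: "p'' y = l * p y + 2 * y ^ 3 * p' y - 4 * real J * y\<^sup>2 * p y" for y
    using arg_cong[OF ode, of "\<lambda>q. poly q y"]
    by (simp add: p_def p'_def p''_def poly_monom algebra_simps)
  have dp: "(p has_real_derivative p' y) (at y)" "(p' has_real_derivative p'' y) (at y)" for y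
    by (simp_all add: p_def p'_def p''_def)
  define G G' where "G y = p y * exp (- (y ^ 4) / 4)" and "G' y = (p' y - y ^ 3 * p y) * exp (- (y ^ 4) / 4)" for y
  have pe: "p y = (\<Sum>m\<le>J. a m * y ^ (2 * m))" for y
    by (simp add: p_def P_def poly_sum poly_monom)
  have "p y \<ge> a 0 * y ^ (2 * 0)" for y
    unfolding pe by (rule member_le_sum) (use apos in auto)
  then have p1: "p y \<ge> 1" for y by (simp add: a0)
  have abound: "a m \<le> l ^ m / fact (2 * m)" for m
  proof (induction m)
    case (Suc m)
    have D: "(2 * real m + 2) * (2 * real m + 1) > 0" by simp
    have "a (Suc m) \<le> l * a m / ((2 * real m + 2) * (2 * real m + 1))"
      using up[of m] D by (simp add: pos_le_divide_eq mult_ac)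
    also have "\<dots> \<le> l * (l ^ m / fact (2 * m)) / ((2 * real m + 2) * (2 * real m + 1))"
      using Suc l D by (intro divide_right_mono mult_left_mono) auto
    also have "\<dots> = l ^ Suc m / fact (2 * Suc m)" by (simp add: fact_reduce algebra_simps)
    finally show ?case .
  qed (simp add: a0)
  have p2: "p y \<le> exp (sqrt l * \<bar>y\<bar>)" for y
  proof -
    have "p y \<le> (\<Sum>m\<le>J. (sqrt l * \<bar>y\<bar>) ^ (2 * m) / fact (2 * m))"
      unfolding pe
    proof (rule sum_mono)
      fix m
      have "a m * y ^ (2 * m) \<le> l ^ m / fact (2 * m) * y ^ (2 * m)"
        using abound by (intro mult_right_mono) (auto simp: power_mult)
      also have "\<dots> = (sqrt l * \<bar>y\<bar>) ^ (2 * m) / fact (2 * m)"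
        using l by (simp add: power_mult power_mult_distrib)
      finally show "a m * y ^ (2 * m) \<le> (sqrt l * \<bar>y\<bar>) ^ (2 * m) / fact (2 * m)" .
    qed
    also have "\<dots> \<le> exp (sqrt l * \<bar>y\<bar>)" by (rule sum_even_powers_le_exp) (use l in auto)
    finally show ?thesis .
  qed
  show ?thesis
  proof
    show "l > 0" by fact
    fix m assume m: "m < J"
    then have am: "a m > 0" using l by (simp add: a_def)
    have "4 * (real J - real m) * ((2 * real m + 2) * (2 * real m + 1)) * a m
       = ((2 * real m + 2) * (2 * real m + 1)) * (4 * (real J - real m) * a m)" by simp
    also have "\<dots> \<le> ((2 * real m + 2) * (2 * real m + 1)) * (l * a (Suc m))"
      using low[of m] by (intro mult_left_mono) auto
    also have "\<dots> = l * ((2 * real m + 2) * (2 * real m + 1) * a (Suc m))" by (simp add: algebra_simps)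
    also have "\<dots> \<le> l * (l * a m)" using up l by (intro mult_left_mono) auto
    finally show "4 * (real J - real m) * ((2 * real m + 2) * (2 * real m + 1)) \<le> l\<^sup>2"
      using am by (simp add: power2_eq_square flip: mult.assoc)
  next
    fix y :: real
    have "(G has_real_derivative p' y * exp (- (y ^ 4) / 4) + p y * (exp (- (y ^ 4) / 4) * (- (4 * y ^ 3) / 4))) (at y)"
      unfolding G_def by (rule derivative_eq_intros dp refl | simp)+
    then show "(G has_real_derivative G' y) (at y)" by (simp add: G'_def algebra_simps)
    have "(G' has_real_derivative (p'' y - (3 * y ^ 2 * p y + y ^ 3 * p' y)) * exp (- (y ^ 4) / 4)
       + (p' y - y ^ 3 * p y) * (exp (- (y ^ 4) / 4) * (- (4 * y ^ 3) / 4))) (at y)"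
      unfolding G'_def by (rule derivative_eq_intros dp refl | simp)+
    moreover have "(p'' y - (3 * y ^ 2 * p y + y ^ 3 * p' y)) * exp (- (y ^ 4) / 4)
       + (p' y - y ^ 3 * p y) * (exp (- (y ^ 4) / 4) * (- (4 * y ^ 3) / 4))
       = (y ^ 6 - (4 * real J + 3) * y\<^sup>2 + l) * G y"
      unfolding p G_def by (simp add: algebra_simps power2_eq_square power3_eq_cube eval_nat_numeral)
    ultimately show "(G' has_real_derivative (y ^ 6 - (4 * real J + 3) * y\<^sup>2 + l) * G y) (at y)" by simp
    show "exp (- (y ^ 4) / 4) \<le> G y" using p1[of y] by (simp add: G_def)
    have "G y \<le> p y * 1" unfolding G_def using p1[of y] by (intro mult_left_mono) auto
    with p2[of y] show "G y \<le> exp (sqrt l * \<bar>y\<bar>)" by simp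
  qed
qed

section \<open>Rescaling of the oscillator to the frequency \<rho>\<close>

definition mode_data :: "real \<Rightarrow> real \<Rightarrow> real \<Rightarrow> (real \<Rightarrow> real) \<Rightarrow> (real \<Rightarrow> real) \<Rightarrow> bool" where
  "mode_data \<rho> \<kappa> \<mu> g g' \<longleftrightarrow>
     \<rho> \<ge> 1 \<and> sqrt \<rho> \<le> \<kappa> \<and> \<mu> \<ge> 0 \<and> \<mu>\<^sup>2 = \<rho>\<^sup>2 - \<kappa>\<^sup>2 \<and>
     (\<forall>x. (g has_real_derivative g' x) (at x)) \<and>
     (\<forall>x. (g' has_real_derivative (\<rho>\<^sup>2 * x ^ 6 - \<kappa>\<^sup>2 * x\<^sup>2 + \<mu>) * g x) (at x)) \<and>
     (\<forall>x. exp (- \<rho> * x ^ 4 / 4) \<le> g x \<and> g x \<le> exp (sqrt \<rho> * \<bar>x\<bar>))"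

text \<open>Putting y = s x with s^4 = \<rho> in the sextic oscillator gives \<kappa>^2 = (4 J + 3)
  \<rho> and \<mu> = l sqrt \<rho>. The relation \<mu>^2 = \<rho>^2 - \<kappa>^2 then forces \<rho>
  = l^2 + 4 J + 3. Since l^2 grows at least like J^3, the ratio \<kappa>^2 / \<rho>^2 = (4 J + 3) /
  \<rho> is at most of order J^-2.\<close>

lemma mode_data_exists:
  assumes "\<epsilon> > 0"
  obtains \<rho> \<kappa> \<mu> g g' where "mode_data \<rho> \<kappa> \<mu> g g'" "\<rho> \<ge> R" "\<kappa> \<le> \<epsilon> * \<rho>"
proof -
  obtain m :: nat where m: "real m > max (\<bar>R\<bar> + 1) (1 / \<epsilon>\<^sup>2)" using reals_Archimedean2 by blast
  then have m1: "m \<ge> 1" and mR: "m \<ge> R" and me: "m > 1 / \<epsilon>\<^sup>2" by auto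
  \<comment> \<open>The lower bound on \<open>l\<^sup>2\<close> is used at the middle index
    \<open>m\<close>, where it is cubic in \<open>J\<close>.\<close>
  define J where "J = 2 * m"
  have J: "J \<ge> 1" "m < J" using m1 by (auto simp: J_def)
  obtain l :: real and G G' where l: "l > 0"
    and ll: "\<And>m. m < J \<Longrightarrow> 4 * (real J - real m) * ((2 * real m + 2) * (2 * real m + 1)) \<le> l\<^sup>2"
    and G: "\<And>y. (G has_real_derivative G' y) (at y)"
    "\<And>y. (G' has_real_derivative (y ^ 6 - (4 * real J + 3) * y\<^sup>2 + l) * G y) (at y)"
    "\<And>y. exp (- (y ^ 4) / 4) \<le> G y" "\<And>y. G y \<le> exp (sqrt l * \<bar>y\<bar>)"
    by (rule sextic_solution[OF J(1)]) (rule that)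
  have l2: "16 * real m ^ 3 \<le> l\<^sup>2"
  proof -
    have "16 * real m ^ 3 \<le> 4 * (real J - real m) * ((2 * real m + 2) * (2 * real m + 1))"
      by (simp add: J_def power3_eq_cube algebra_simps)
    with ll[OF J(2)] show ?thesis by simp
  qed
  define \<rho> where "\<rho> = l\<^sup>2 + (4 * real J + 3)"
  define \<kappa> where "\<kappa> = sqrt ((4 * real J + 3) * \<rho>)"
  define \<mu> where "\<mu> = l * sqrt \<rho>"
  define s where "s = sqrt (sqrt \<rho>)"
  have rho: "\<rho> \<ge> 1" by (simp add: \<rho>_def)
  have s2: "s\<^sup>2 = sqrt \<rho>" and s0: "s \<ge> 0" using rho by (auto simp: s_def)
  have "s ^ 4 = (s\<^sup>2)\<^sup>2" by (simp flip: power_mult)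
  then have s4: "s ^ 4 = \<rho>" using rho s2 by simp
  have k2: "\<kappa>\<^sup>2 = (4 * real J + 3) * \<rho>" using rho by (simp add: \<kappa>_def)
  have "mode_data \<rho> \<kappa> \<mu> (\<lambda>x. G (s * x)) (\<lambda>x. s * G' (s * x))"
    unfolding mode_data_def
  proof (intro conjI allI)
    have "1 * \<rho> \<le> (4 * real J + 3) * \<rho>" using rho by (intro mult_right_mono) auto
    then show "sqrt \<rho> \<le> \<kappa>" unfolding \<kappa>_def by (intro real_sqrt_le_mono) simp
    show "\<mu> \<ge> 0" using l rho by (simp add: \<mu>_def)
    have "\<mu>\<^sup>2 = (\<rho> - (4 * real J + 3)) * \<rho>"
      using rho by (simp add: \<mu>_def power_mult_distrib) (simp add: \<rho>_def)
    then show "\<mu>\<^sup>2 = \<rho>\<^sup>2 - \<kappa>\<^sup>2" unfolding k2 by (simp add: power2_eq_square left_diff_distrib)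
    fix x :: real
    have lin: "((\<lambda>x. s * x) has_real_derivative s) (at x)" by (auto intro!: derivative_eq_intros)
    show "((\<lambda>x. G (s * x)) has_real_derivative s * G' (s * x)) (at x)"
      using DERIV_chain2[OF G(1) lin] by (simp add: mult.commute)
    have "((\<lambda>x. s * G' (s * x)) has_real_derivative s * (((s*x) ^ 6 - (4 * real J + 3) * (s*x)\<^sup>2 + l) * G (s*x) * s)) (at x)"
      by (intro DERIV_cmult DERIV_chain2[OF G(2) lin])
    moreover have "s * (((s*x) ^ 6 - (4 * real J + 3) * (s*x)\<^sup>2 + l) * G (s*x) * s) =
       ((s^4)^2 * x ^ 6 - (4 * real J + 3) * s^4 * x\<^sup>2 + l * s\<^sup>2) * G (s * x)"
      by (simp add: algebra_simps power2_eq_square eval_nat_numeral)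
    ultimately show "((\<lambda>x. s * G' (s * x)) has_real_derivative (\<rho>\<^sup>2 * x ^ 6 - \<kappa>\<^sup>2 * x\<^sup>2 + \<mu>) * G (s * x)) (at x)"
      unfolding s4 s2 k2 \<mu>_def by simp
    show "exp (- \<rho> * x ^ 4 / 4) \<le> G (s * x)"
      using G(3)[of "s * x"] by (simp add: power_mult_distrib s4)
    \<comment> \<open>This turns the growth rate \<open>sqrt l * s\<close> of the rescaled solution
      into \<open>s * s = sqrt \<rho>\<close>.\<close>
    have "l \<le> sqrt \<rho>" by (rule real_le_rsqrt) (simp add: \<rho>_def)
    then have "sqrt l \<le> s" unfolding s_def by (rule real_sqrt_le_mono)
    then have "sqrt l * \<bar>s * x\<bar> \<le> s * (s * \<bar>x\<bar>)"
      using s0 by (simp add: abs_mult mult_right_mono)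
    also have "s * (s * \<bar>x\<bar>) = sqrt \<rho> * \<bar>x\<bar>"
      unfolding s2[symmetric] by (simp only: power2_eq_square mult.assoc)
    finally show "G (s * x) \<le> exp (sqrt \<rho> * \<bar>x\<bar>)"
      using order_trans[OF G(4)[of "s * x"]] by simp
  qed (rule rho)
  moreover have "\<rho> \<ge> R"
  proof -
    have "real m \<le> 4 * real J" by (simp add: J_def)
    with mR have "R \<le> 4 * real J" by linarith
    then show ?thesis unfolding \<rho>_def using zero_le_power2[of l] by linarith
  qed
  moreover have "\<kappa> \<le> \<epsilon> * \<rho>"
  proof -
    have me': "m * \<epsilon>\<^sup>2 \<ge> 1" using me assms by (simp add: pos_divide_less_eq)
    have "4 * real J + 3 \<le> 16 * m" using m1 by (simp add: J_def)
    also have "\<dots> \<le> \<epsilon>\<^sup>2 * \<rho>"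
    proof -
      have "1 * 1 \<le> real m * (m * \<epsilon>\<^sup>2)" using m1 me' by (intro mult_mono) simp_all
      then have "16 * real m * 1 \<le> 16 * real m * (m * (m * \<epsilon>\<^sup>2))" by (intro mult_left_mono) simp_all
      also have "\<dots> = \<epsilon>\<^sup>2 * (16 * real m ^ 3)" by (simp add: power3_eq_cube)
      also have "\<dots> \<le> \<epsilon>\<^sup>2 * \<rho>" using l2 by (intro mult_left_mono) (simp_all add: \<rho>_def)
      finally show ?thesis by simp
    qed
    finally have "(4 * real J + 3) * \<rho> \<le> \<epsilon>\<^sup>2 * \<rho> * \<rho>" using rho by (intro mult_right_mono) simp_all
    then have "\<kappa>\<^sup>2 \<le> (\<epsilon> * \<rho>)\<^sup>2"
      unfolding k2 by (simp only: power2_eq_square mult.assoc mult.left_commute mult.commute)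
    then show ?thesis using assms rho by (intro power2_le_imp_le[of \<kappa>]) simp_all
  qed
  ultimately show ?thesis by (rule that)
qed

section \<open>Smooth functions of one variable\<close>

definition smooth_fun :: "(real \<Rightarrow> 'a::real_normed_vector) \<Rightarrow> bool" where
  "smooth_fun f \<longleftrightarrow> (\<exists>D. D 0 = f \<and> (\<forall>n t. (D n has_vector_derivative D (Suc n) t) (at t)))"

text \<open>Iterating a derivative chosen inside \<open>S\<close> supplies the whole sequence.
  Smoothness of a product, an exponential or a flat function thus reduces to finding a family that
  is closed under differentiation.\<close>

lemma smooth_fun_coinduct:
  assumes "f \<in> S" and S: "\<And>f. f \<in> S \<Longrightarrow> \<exists>f'\<in>S. \<forall>t. (f has_vector_derivative f' t) (at t)"
  shows "smooth_fun f"
proof -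
  obtain d where d: "\<And>f. f \<in> S \<Longrightarrow> d f \<in> S \<and> (\<forall>t. (f has_vector_derivative d f t) (at t))"
    using S by metis
  have "(d ^^ n) f \<in> S" for n by (induction n) (use \<open>f \<in> S\<close> d in auto)
  then have "\<forall>n t. ((d ^^ n) f has_vector_derivative (d ^^ Suc n) f t) (at t)" using d by simp
  then show ?thesis unfolding smooth_fun_def by (intro exI[of _ "\<lambda>n. (d ^^ n) f"]) simp
qed

lemma smooth_fun_antiderivative:
  assumes "smooth_fun f'" "\<And>t. (f has_vector_derivative f' t) (at t)"
  shows "smooth_fun f"
proof -
  obtain D where "D 0 = f'" "\<And>n t. (D n has_vector_derivative D (Suc n) t) (at t)"
    using assms(1) by (auto simp: smooth_fun_def)
  with assms(2) show ?thesis unfolding smooth_fun_def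
    by (intro exI[of _ "case_nat f D"]) (auto split: nat.splits)
qed

lemma smooth_fun_derivative:
  assumes "smooth_fun f"
  shows "\<exists>f'. smooth_fun f' \<and> (\<forall>t. (f has_vector_derivative f' t) (at t))"
proof -
  obtain D where D: "D 0 = f" "\<And>n t. (D n has_vector_derivative D (Suc n) t) (at t)"
    using assms by (auto simp: smooth_fun_def)
  have "smooth_fun (D 1)"
    unfolding smooth_fun_def by (intro exI[of _ "\<lambda>n. D (Suc n)"]) (use D(2) in auto)
  with D show ?thesis by (intro exI[of _ "D 1"]) auto
qed

lemma smooth_fun_add:
  assumes "smooth_fun f" "smooth_fun g"
  shows "smooth_fun (\<lambda>t. f t + g t)"
proof -
  obtain D E where "D 0 = f" "\<And>n t. (D n has_vector_derivative D (Suc n) t) (at t)"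
    "E 0 = g" "\<And>n t. (E n has_vector_derivative E (Suc n) t) (at t)"
    using assms by (auto simp: smooth_fun_def)
  then show ?thesis unfolding smooth_fun_def
    by (intro exI[of _ "\<lambda>n t. D n t + E n t"]) (auto intro: has_vector_derivative_add)
qed

text \<open>The invariant family consists of finite sums of products, encoded as lists of pairs of
  factors. The product rule replaces an entry \<open>(f, g)\<close> by \<open>(f, g')\<close> and
  \<open>(f', g)\<close>, which avoids the binomial formula for higher derivatives.\<close>

lemma smooth_fun_mult:
  fixes f g :: "real \<Rightarrow> 'a::real_normed_algebra"
  assumes "smooth_fun f" "smooth_fun g"
  shows "smooth_fun (\<lambda>t. f t * g t)"
proof (rule smooth_fun_coinduct)
  let ?F = "\<lambda>(xs :: ((real \<Rightarrow> 'a) \<times> (real \<Rightarrow> 'a)) list) t. \<Sum>(f, g)\<leftarrow>xs. f t * g t"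
  let ?S = "{?F xs | xs. \<forall>(f, g)\<in>set xs. smooth_fun f \<and> smooth_fun g}"
  show "(\<lambda>t. f t * g t) \<in> ?S" using assms by (auto intro!: exI[of _ "[(f, g)]"])
  fix h assume "h \<in> ?S"
  then obtain xs where xs: "h = ?F xs" "\<forall>(f, g)\<in>set xs. smooth_fun f \<and> smooth_fun g" by blast
  have "\<exists>h'\<in>?S. \<forall>t. (?F xs has_vector_derivative h' t) (at t)" using xs(2)
  proof (induction xs)
    case Nil
    show ?case by (intro bexI[of _ "?F []"]) (auto intro!: exI[of _ "[]"])
  next
    case (Cons fg xs)
    obtain f g where fg: "fg = (f, g)" by fastforce
    then have sm: "smooth_fun f" "smooth_fun g" using Cons.prems by auto
    obtain f' where f': "smooth_fun f'" "\<And>t. (f has_vector_derivative f' t) (at t)"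
      using smooth_fun_derivative[OF sm(1)] by blast
    obtain g' where g': "smooth_fun g'" "\<And>t. (g has_vector_derivative g' t) (at t)"
      using smooth_fun_derivative[OF sm(2)] by blast
    obtain ys where ys: "\<forall>(f, g)\<in>set ys. smooth_fun f \<and> smooth_fun g"
      "\<And>t. (?F xs has_vector_derivative ?F ys t) (at t)" using Cons by auto
    have "(?F (fg # xs) has_vector_derivative ?F ((f, g') # (f', g) # ys) t) (at t)" for t
      using has_vector_derivative_add[OF has_vector_derivative_mult[OF f'(2) g'(2)] ys(2), of t]
      by (simp add: fg algebra_simps)
    then show ?case using ys(1) sm f'(1) g'(1)
      by (intro bexI[of _ "?F ((f, g') # (f', g) # ys)"]) (auto intro!: exI[of _ "(f, g') # (f', g) # ys"])
  qed
  then show "\<exists>h'\<in>?S. \<forall>t. (h has_vector_derivative h' t) (at t)" by (simp add: xs(1))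
qed

lemma smooth_fun_affine:
  assumes "smooth_fun f"
  shows "smooth_fun (\<lambda>t. c *\<^sub>R f (a * t + b))"
proof (rule smooth_fun_coinduct)
  let ?S = "{(\<lambda>t. c *\<^sub>R f (a * t + b)) | c f. smooth_fun f}"
  show "(\<lambda>t. c *\<^sub>R f (a * t + b)) \<in> ?S" using assms by blast
  fix h assume "h \<in> ?S"
  then obtain c f where h: "h = (\<lambda>t. c *\<^sub>R f (a * t + b))" "smooth_fun f" by blast
  obtain f' where f': "smooth_fun f'" "\<And>t. (f has_vector_derivative f' t) (at t)"
    using smooth_fun_derivative[OF h(2)] by blast
  have "(h has_vector_derivative (c * a) *\<^sub>R f' (a * t + b)) (at t)" for t
  proof -
    have "((\<lambda>t. a * t + b) has_real_derivative a) (at t)" by (auto intro!: derivative_eq_intros)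
    then have "((\<lambda>t. f (a * t + b)) has_vector_derivative a *\<^sub>R f' (a * t + b)) (at t)"
      using vector_diff_chain_at[OF _ f'(2), of "\<lambda>t. a * t + b" a t]
      by (simp add: o_def has_real_derivative_iff_has_vector_derivative)
    from has_vector_derivative_scaleR[OF DERIV_const this, of c] show ?thesis by (simp add: h(1))
  qed
  then show "\<exists>h'\<in>?S. \<forall>t. (h has_vector_derivative h' t) (at t)"
    using f'(1) by (intro bexI[of _ "\<lambda>t. (c * a) *\<^sub>R f' (a * t + b)"]) auto
qed

lemma smooth_fun_of_real:
  assumes "smooth_fun f"
  shows "smooth_fun (\<lambda>t. complex_of_real (f t))"
proof -
  obtain D where "D 0 = f" "\<And>n t. (D n has_vector_derivative D (Suc n) t) (at t)"
    using assms by (auto simp: smooth_fun_def)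
  then show ?thesis unfolding smooth_fun_def
    by (intro exI[of _ "\<lambda>n t. complex_of_real (D n t)"]) (auto intro: bounded_linear.has_vector_derivative[OF bounded_linear_of_real])
qed

lemma smooth_fun_exp_poly: "smooth_fun (\<lambda>t. exp (poly q (complex_of_real t)))"
proof (rule smooth_fun_coinduct)
  let ?h = "\<lambda>p t. poly p (complex_of_real t) * exp (poly q (complex_of_real t))"
  show "(\<lambda>t. exp (poly q (complex_of_real t))) \<in> range ?h"
    by (rule image_eqI[of _ _ 1]) auto
  fix f assume "f \<in> range ?h"
  then obtain p where p: "f = ?h p" by blast
  have "((\<lambda>z. poly p z * exp (poly q z)) has_field_derivative poly (pderiv p + p * pderiv q) z * exp (poly q z)) (at z)" for z
    by (rule derivative_eq_intros poly_DERIV refl | simp add: algebra_simps)+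
  from has_vector_derivative_real_field[OF this]
  have "\<forall>t. (f has_vector_derivative ?h (pderiv p + p * pderiv q) t) (at t)"
    unfolding p by simp
  then show "\<exists>f'\<in>range ?h. \<forall>t. (f has_vector_derivative f' t) (at t)"
    by (intro bexI[of _ "?h (pderiv p + p * pderiv q)"] rangeI)
qed

text \<open>The family of all p(1/t) exp (-1/t), extended by 0, is closed under differentiation: the
  derivative replaces the polynomial p(X) by X^2 (p - p')(X).\<close>

lemma smooth_fun_exp_inverse: "smooth_fun (\<lambda>t::real. if t > 0 then exp (- (1 / t)) else 0)"
proof (rule smooth_fun_coinduct)
  let ?h = "\<lambda>(p :: real poly) t. if t > 0 then poly p (1 / t) * exp (- (1 / t)) else 0"
  show "(\<lambda>t. if t > 0 then exp (- (1 / t)) else 0) \<in> range ?h"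
    by (rule image_eqI[of _ _ 1]) auto
  fix f assume "f \<in> range ?h"
  then obtain p where p: "f = ?h p" by blast
  have lim: "((\<lambda>x. poly p x * exp (- x)) \<longlongrightarrow> 0) at_top" for p :: "real poly"
  proof -
    have "((\<lambda>x. \<Sum>i\<le>degree p. coeff p i * (x ^ i / exp x)) \<longlongrightarrow> (\<Sum>i\<le>degree p. coeff p i * 0)) at_top"
      by (intro tendsto_intros tendsto_power_div_exp_0)
    then show ?thesis by (simp add: poly_altdef exp_minus sum_divide_distrib divide_inverse sum_distrib_right mult.assoc)
  qed
  let ?q = "monom 1 2 * (p - pderiv p)"
  have "(f has_real_derivative ?h ?q t) (at t)" for t
  proof (cases t "0 :: real" rule: linorder_cases)
    case less
    have "((\<lambda>t. 0 :: real) has_real_derivative 0) (at t)" by simp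
    moreover have "\<forall>\<^sub>F t in nhds t. f t = 0"
      using less by (intro eventually_nhds_in_open[of "{..<0}", THEN eventually_mono]) (auto simp: p)
    ultimately have "(f has_real_derivative 0) (at t)" using less
      by (subst DERIV_cong_ev) (auto simp: p)
    then show ?thesis using less by simp
  next
    case greater
    have "((\<lambda>t. poly p (1 / t) * exp (- (1 / t))) has_real_derivative
        poly (pderiv p) (1 / t) * (- (1 / t\<^sup>2)) * exp (- (1 / t)) + poly p (1 / t) * (exp (- (1 / t)) * (1 / t\<^sup>2))) (at t)"
      using greater
      by (auto intro!: derivative_eq_intros DERIV_chain2[OF poly_DERIV] simp: power2_eq_square)
    moreover have "\<forall>\<^sub>F t in nhds t. f t = poly p (1 / t) * exp (- (1 / t))"
      using greater by (intro eventually_nhds_in_open[of "{0<..}", THEN eventually_mono]) (auto simp: p)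
    ultimately have "(f has_real_derivative poly (pderiv p) (1 / t) * (- (1 / t\<^sup>2)) * exp (- (1 / t)) + poly p (1 / t) * (exp (- (1 / t)) * (1 / t\<^sup>2))) (at t)"
      using greater by (subst DERIV_cong_ev) (auto simp: p)
    then show ?thesis using greater by (simp add: poly_monom power_divide algebra_simps)
  next
    case equal
    have "((\<lambda>h. (f (0 + h) - f 0) / h) \<longlongrightarrow> 0) (at_right 0)"
    proof -
      \<comment> \<open>The division by \<open>h\<close> in the difference quotient is one more
        power of \<open>1 / h\<close>, hence the shifted polynomial
        \<open>pCons 0 p\<close>.\<close>
      have "((\<lambda>h. poly (pCons 0 p) (inverse h) * exp (- inverse h)) \<longlongrightarrow> 0) (at_right 0)"
        by (rule filterlim_compose[OF lim filterlim_inverse_at_top_right])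
      moreover have "\<forall>\<^sub>F h in at_right 0. poly (pCons 0 p) (inverse h) * exp (- inverse h) = (f (0 + h) - f 0) / h"
        by (auto simp: eventually_at_filter p field_simps)
      ultimately show ?thesis by (rule Lim_transform_eventually)
    qed
    moreover have "((\<lambda>h. (f (0 + h) - f 0) / h) \<longlongrightarrow> 0) (at_left 0)"
      by (rule tendsto_eventually) (auto simp: eventually_at_filter p)
    ultimately have "(f has_real_derivative 0) (at 0)"
      by (simp add: DERIV_def filterlim_at_split)
    then show ?thesis using equal by simp
  qed
  then show "\<exists>f'\<in>range ?h. \<forall>t. (f has_vector_derivative f' t) (at t)"
    by (intro bexI[of _ "?h ?q"] rangeI allI) (simp only: has_real_derivative_iff_has_vector_derivative)
qed

text \<open>A primitive \<Psi> of a bump supported in [-1, 1] rises from 0 to the constant \<Psi>(1)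
  across that interval. The plateau is the normalized difference of its translates by 2 to either
  side.\<close>

lemma smooth_plateau:
  obtains b :: "real \<Rightarrow> real" where "smooth_fun b" "\<And>t. b t \<ge> 0"
    "\<And>t. \<bar>t\<bar> \<le> 1 \<Longrightarrow> b t = 1" "\<And>t. \<bar>t\<bar> \<ge> 3 \<Longrightarrow> b t = 0"
proof -
  define e :: "real \<Rightarrow> real" where "e t = (if t > 0 then exp (- (1 / t)) else 0)" for t
  define \<psi> where "\<psi> t = e (t + 1) * e (1 - t)" for t
  have "smooth_fun e" unfolding e_def by (rule smooth_fun_exp_inverse)
  then have sm: "smooth_fun \<psi>"
    using smooth_fun_mult[OF smooth_fun_affine[of e 1 1 1] smooth_fun_affine[of e 1 "-1" 1]]
    by (simp add: \<psi>_def[abs_def])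
  have pos: "\<psi> t \<ge> 0" for t by (simp add: \<psi>_def e_def)
  have pos1: "\<psi> t > 0" if "\<bar>t\<bar> < 1" for t using that by (auto simp: \<psi>_def e_def)
  have zero: "\<psi> t = 0" if "\<bar>t\<bar> \<ge> 1" for t using that by (auto simp: \<psi>_def e_def)
  have cont: "continuous_on A \<psi>" for A
  proof -
    obtain \<psi>' where d: "\<And>t. (\<psi> has_vector_derivative \<psi>' t) (at t)"
      using smooth_fun_derivative[OF sm] by blast
    show ?thesis by (rule continuous_on_vector_derivative, rule has_vector_derivative_at_within, rule d)
  qed
  \<comment> \<open>For \<open>t < -2\<close> the interval is empty and the integral is 0 by
    convention, which is the right value since \<open>\<psi>\<close> vanishes there.\<close>
  define \<Psi> where "\<Psi> t = integral {-2..t} \<psi>" for t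
  have d: "(\<Psi> has_real_derivative \<psi> t) (at t)" for t
  proof (cases "t > -2")
    case True
    have "((\<lambda>x. integral {-2..x} \<psi>) has_real_derivative \<psi> t) (at t within {-2..t + 1})"
      using True by (intro integral_has_real_derivative cont) auto
    moreover have "at t within {-2..t + 1} = at t" using True by (simp add: at_within_Icc_at)
    ultimately show ?thesis by (simp add: \<Psi>_def[abs_def])
  next
    case False
    have z: "\<Psi> s = 0" if "s < -1" for s
    proof -
      have "\<Psi> s = integral {-2..s} (\<lambda>_. 0)"
        unfolding \<Psi>_def using that by (intro integral_cong) (auto simp: zero)
      then show ?thesis by simp
    qed
    have "\<forall>\<^sub>F s in nhds t. \<Psi> s = 0"
      using False by (intro eventually_nhds_in_open[of "{..<-1}", THEN eventually_mono]) (auto simp: z)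
    then have "(\<Psi> has_real_derivative 0) (at t) \<longleftrightarrow> ((\<lambda>_. 0 :: real) has_real_derivative 0) (at t)"
      by (intro DERIV_cong_ev) auto
    then show ?thesis using False by (simp add: zero)
  qed
  have const: "\<Psi> s = \<Psi> t" if "s \<le> t" "\<And>x. s \<le> x \<Longrightarrow> x \<le> t \<Longrightarrow> \<psi> x = 0" for s t
  proof (rule antisym)
    show "\<Psi> s \<le> \<Psi> t"
    proof (rule DERIV_nonneg_imp_nondecreasing[where f = \<Psi>, OF that(1)])
      show "\<exists>y. (\<Psi> has_real_derivative y) (at x) \<and> 0 \<le> y" if "s \<le> x" "x \<le> t" for x
        using d[of x] pos[of x] by (intro exI[of _ "\<psi> x"]) simp
    qed
    show "\<Psi> t \<le> \<Psi> s"
    proof (rule DERIV_nonpos_imp_nonincreasing[where f = \<Psi>, OF that(1)])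
      show "\<exists>y. (\<Psi> has_real_derivative y) (at x) \<and> y \<le> 0" if "s \<le> x" "x \<le> t" for x
        using d[of x] \<open>\<And>x. s \<le> x \<Longrightarrow> x \<le> t \<Longrightarrow> \<psi> x = 0\<close>[OF that] by (intro exI[of _ "\<psi> x"]) simp
    qed
  qed
  have mono: "\<Psi> s \<le> \<Psi> t" if "s \<le> t" for s t
  proof (rule DERIV_nonneg_imp_nondecreasing[where f = \<Psi>, OF that])
    show "\<exists>y. (\<Psi> has_real_derivative y) (at x) \<and> 0 \<le> y" for x
      using d[of x] pos[of x] by (intro exI[of _ "\<psi> x"]) simp
  qed
  have low: "\<Psi> t = 0" if "t \<le> -1" for t
  proof -
    have "\<Psi> (min t (-3)) = \<Psi> t" using that by (intro const zero) auto
    then show ?thesis by (simp add: \<Psi>_def)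
  qed
  have high: "\<Psi> t = \<Psi> 1" if "t \<ge> 1" for t
    using that by (intro const[symmetric] zero) auto
  have "\<Psi> (-1) < \<Psi> 1"
  proof (rule DERIV_pos_imp_increasing_open[where f = \<Psi>])
    show "\<exists>y. (\<Psi> has_real_derivative y) (at x) \<and> 0 < y" if "-1 < x" "x < 1" for x
    proof (intro exI[of _ "\<psi> x"] conjI d)
      show "0 < \<psi> x" by (rule pos1) (use that in linarith)
    qed
    show "continuous_on {-1..1} \<Psi>"
      by (rule DERIV_continuous_on[of _ _ \<psi>]) (rule has_field_derivative_at_within[OF d])
  qed simp
  moreover have "\<Psi> (-1) = 0" by (rule low) simp
  ultimately have P1: "\<Psi> 1 > 0" by simp
  define b where "b t = (1 / \<Psi> 1) *\<^sub>R (\<Psi> (t + 2) - \<Psi> (t - 2))" for t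
  have smPsi: "smooth_fun \<Psi>" 
    by (rule smooth_fun_antiderivative[OF sm]) (simp only: d flip: has_real_derivative_iff_has_vector_derivative)
  have "smooth_fun b"
  proof -
    have "smooth_fun (\<lambda>t. (1 / \<Psi> 1) *\<^sub>R \<Psi> (1 * t + 2) + (- (1 / \<Psi> 1)) *\<^sub>R \<Psi> (1 * t + - 2))"
      by (rule smooth_fun_add[OF smooth_fun_affine[OF smPsi] smooth_fun_affine[OF smPsi]])
    then show ?thesis unfolding b_def[abs_def] by (simp add: algebra_simps)
  qed
  moreover have "b t \<ge> 0" for t using mono[of "t - 2" "t + 2"] P1 by (simp add: b_def)
  moreover have "b t = 1" if "\<bar>t\<bar> \<le> 1" for t
    using that low[of "t - 2"] high[of "t + 2"] P1 by (simp add: b_def)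
  moreover have "b t = 0" if "\<bar>t\<bar> \<ge> 3" for t
  proof (cases "t \<ge> 3")
    case True then show ?thesis using high[of "t - 2"] high[of "t + 2"] by (simp add: b_def)
  next
    case False then show ?thesis using that low[of "t - 2"] low[of "t + 2"] by (simp add: b_def)
  qed
  ultimately show ?thesis by (rule that)
qed

section \<open>Integration over $R^n$\<close>

lemma topspace_Rn [simp]: "topspace (Rn n) = extensional {..<n}"
  by (auto simp: PiE_def)

lemma fun_upd_extensional_iff: "i < n \<Longrightarrow> x(i := t) \<in> extensional {..<n} \<longleftrightarrow> x \<in> extensional {..<n}"
  by (auto simp: extensional_def)

abbreviation lebesgue_Rn :: "nat \<Rightarrow> point measure" where
  "lebesgue_Rn n \<equiv> Pi\<^sub>M {..<n} (\<lambda>_. lborel)"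

interpretation lborel_Rn: product_sigma_finite "\<lambda>_ :: nat. lborel :: real measure"
  by standard

lemma space_lebesgue_Rn [simp]: "space (lebesgue_Rn n) = extensional {..<n}"
  by (auto simp: space_PiM PiE_def)

lemma continuous_map_euclidean_iff:
  "continuous_map X euclidean f \<longleftrightarrow> (\<forall>x\<in>topspace X. (f \<longlongrightarrow> f x) (atin X x))"
  by (simp add: continuous_map_atin)

lemma continuous_map_component:
  assumes "i < n" "continuous_on UNIV h"
  shows "continuous_map (Rn n) euclidean (\<lambda>x. h (x i))"
  using continuous_map_compose[OF continuous_map_product_projection[of i "{..<n}" "\<lambda>_. euclideanreal"], of euclidean h] assms
  by (simp add: o_def)

lemma continuous_map_mult:
  fixes f g :: "'a \<Rightarrow> 'b::real_normed_algebra"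
  assumes "continuous_map X euclidean f" "continuous_map X euclidean g"
  shows "continuous_map X euclidean (\<lambda>x. f x * g x)"
  using assms by (auto simp: continuous_map_euclidean_iff intro: tendsto_mult)

lemma continuous_map_tensor:
  fixes h :: "nat \<Rightarrow> real \<Rightarrow> 'b::{real_normed_algebra, comm_ring_1}"
  assumes "\<And>i. i < n \<Longrightarrow> continuous_on UNIV (h i)"
  shows "continuous_map (Rn n) euclidean (\<lambda>x. \<Prod>i<n. h i (x i))"
proof -
  have "continuous_map (Rn n) euclidean (\<lambda>x. \<Prod>i\<in>I. h i (x i))" if "finite I" "I \<subseteq> {..<n}" for I
    using that by (induction I) (auto intro!: continuous_map_mult continuous_map_component assms)
  then show ?thesis by simp
qed

lemma measurable_lebesgue_Rn_component [measurable]: "i < n \<Longrightarrow> (\<lambda>x. x i) \<in> borel_measurable (lebesgue_Rn n)"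
  using measurable_component_singleton[of i "{..<n}" "\<lambda>_. lborel :: real measure"] by simp

text \<open>A continuous function is the limit of functions that are constant on the cells of ever finer grids.\<close>
lemma borel_measurable_continuous_Rn:
  fixes f :: "point \<Rightarrow> 'b::{real_normed_vector, second_countable_topology}"
  assumes "continuous_map (Rn n) euclidean f"
  shows "f \<in> borel_measurable (lebesgue_Rn n)"
proof (rule borel_measurable_LIMSEQ_metric)
  define e where "e m x = (\<lambda>i\<in>{..<n}. \<lfloor>x i * real (Suc m)\<rfloor>)" for m and x :: point
  define F where "F m z = f (\<lambda>i\<in>{..<n}. of_int (z i) / real (Suc m))" for m and z :: "nat \<Rightarrow> int"
  fix m
  have "e m \<in> measurable (lebesgue_Rn n) (count_space (PiE {..<n} (\<lambda>_. UNIV)))"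
  proof (subst measurable_count_space_eq_countable)
    show "countable (PiE {..<n} (\<lambda>_. UNIV :: int set))" by (intro countable_PiE) auto
    have "e m -` {z} \<inter> space (lebesgue_Rn n) = {x \<in> space (lebesgue_Rn n). \<forall>i\<in>{..<n}. \<lfloor>x i * real (Suc m)\<rfloor> = z i}"
      if "z \<in> PiE {..<n} (\<lambda>_. UNIV)" for z
      using that by (auto simp: e_def fun_eq_iff PiE_def extensional_def)
    moreover have "{x \<in> space (lebesgue_Rn n). \<forall>i\<in>{..<n}. \<lfloor>x i * real (Suc m)\<rfloor> = z i} \<in> sets (lebesgue_Rn n)" for z
      by measurable
    ultimately show "e m \<in> space (lebesgue_Rn n) \<rightarrow> PiE {..<n} (\<lambda>_. UNIV) \<and>
      (\<forall>z\<in>PiE {..<n} (\<lambda>_. UNIV). e m -` {z} \<inter> space (lebesgue_Rn n) \<in> sets (lebesgue_Rn n))"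
      by (auto simp: e_def)
  qed
  then show "(\<lambda>x. F m (e m x)) \<in> borel_measurable (lebesgue_Rn n)"
    by (rule measurable_compose) simp
next
  fix x assume x: "x \<in> space (lebesgue_Rn n)"
  define d where "d m = (\<lambda>i\<in>{..<n}. of_int \<lfloor>x i * real (Suc m)\<rfloor> / real (Suc m))" for m
  have "(\<lambda>m. of_int \<lfloor>y * real (Suc m)\<rfloor> / real (Suc m)) \<longlonglongrightarrow> y" for y :: real
  proof (rule tendsto_sandwich)
    show "\<forall>\<^sub>F m in sequentially. of_int \<lfloor>y * real (Suc m)\<rfloor> / real (Suc m) \<le> y"
      by (intro always_eventually allI) (simp add: pos_divide_le_eq)
    have "y - 1 / real (Suc m) \<le> of_int \<lfloor>y * real (Suc m)\<rfloor> / real (Suc m)" for m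
    proof -
      have "(y - 1 / real (Suc m)) * real (Suc m) = y * real (Suc m) - 1" by (simp add: left_diff_distrib)
      also have "\<dots> \<le> of_int \<lfloor>y * real (Suc m)\<rfloor>" by linarith
      finally show ?thesis by (simp only: pos_le_divide_eq of_nat_0_less_iff zero_less_Suc)
    qed
    then show "\<forall>\<^sub>F m in sequentially. y - 1 / real (Suc m) \<le> of_int \<lfloor>y * real (Suc m)\<rfloor> / real (Suc m)" by simp
    show "(\<lambda>m. y - 1 / real (Suc m)) \<longlonglongrightarrow> y"
      using tendsto_diff[OF tendsto_const LIMSEQ_Suc[OF lim_1_over_n], of y] by simp
  qed simp
  then have "limitin (Rn n) d x sequentially"
    using x by (auto simp: limitin_componentwise d_def)
  then have "limitin euclidean (f \<circ> d) (f x) sequentially"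
    by (rule continuous_map_limit[OF assms])
  moreover have "(\<lambda>i\<in>{..<n}. of_int ((\<lambda>i\<in>{..<n}. \<lfloor>x i * real (Suc m)\<rfloor>) i) / real (Suc m)) = d m" for m
    by (auto simp: d_def)
  ultimately show "(\<lambda>m. f (\<lambda>i\<in>{..<n}. of_int ((\<lambda>i\<in>{..<n}. \<lfloor>x i * real (Suc m)\<rfloor>) i) / real (Suc m))) \<longlonglongrightarrow> f x"
    by (simp only: o_def limitin_canonical_iff)
qed

section \<open>Cubes and integrals of functions supported in them\<close>

definition cube :: "nat \<Rightarrow> real \<Rightarrow> point set" where
  "cube n R = {x \<in> extensional {..<n}. \<forall>i<n. \<bar>x i\<bar> \<le> R}"

lemma cube_eq_PiE: "cube n R = PiE {..<n} (\<lambda>_. {-R..R})"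
  by (auto simp: cube_def PiE_def Pi_def abs_le_iff)

lemma compactin_cube: "compactin (Rn n) (cube n R)"
  unfolding cube_eq_PiE by (subst compactin_PiE) auto

lemma cube_sets [measurable]: "cube n R \<in> sets (lebesgue_Rn n)"
  unfolding cube_eq_PiE by (intro sets_PiM_I_finite) auto

lemma emeasure_cube: "R \<ge> 0 \<Longrightarrow> emeasure (lebesgue_Rn n) (cube n R) = ennreal ((2 * R) ^ n)"
  unfolding cube_eq_PiE by (subst lborel_Rn.emeasure_PiM) (auto simp: ennreal_power)

lemma measure_cube: "R \<ge> 0 \<Longrightarrow> measure (lebesgue_Rn n) (cube n R) = (2 * R) ^ n"
  by (simp add: measure_def emeasure_cube)

lemma compactin_subset_cube:
  assumes "compactin (Rn n) K"
  obtains R where "R > 0" "K \<subseteq> cube n R"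
proof -
  have "\<exists>r. \<forall>x\<in>K. \<bar>x i\<bar> \<le> r" if "i < n" for i
  proof -
    have "compactin euclideanreal ((\<lambda>x. x i) ` K)"
      using image_compactin[OF assms continuous_map_product_projection] that by auto
    then show ?thesis by (auto simp: bounded_iff dest!: compact_imp_bounded)
  qed
  then obtain r where r: "\<And>i x. i < n \<Longrightarrow> x \<in> K \<Longrightarrow> \<bar>x i\<bar> \<le> r i" by metis
  have "r i \<le> 1 + (\<Sum>i<n. \<bar>r i\<bar>)" if "i < n" for i
    using member_le_sum[of i "{..<n}" "\<lambda>i. \<bar>r i\<bar>"] that by force
  moreover have K: "K \<subseteq> extensional {..<n}"
    using compactin_subset_topspace[OF assms] unfolding topspace_Rn .
  ultimately have "K \<subseteq> cube n (1 + (\<Sum>i<n. \<bar>r i\<bar>))"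
    using order_trans[OF r] K by (auto simp: cube_def)
  moreover have "1 + (\<Sum>i<n. \<bar>r i\<bar>) > 0" by (intro add_pos_nonneg sum_nonneg) auto
  ultimately show ?thesis by (intro that)
qed

lemma integral_bounded_on_cube:
  fixes f :: "point \<Rightarrow> complex"
  assumes f: "f \<in> borel_measurable (lebesgue_Rn n)" and R: "R \<ge> 0"
    and B: "\<And>x. x \<in> cube n R \<Longrightarrow> norm (f x) \<le> B"
    and zero: "\<And>x. x \<in> extensional {..<n} \<Longrightarrow> x \<notin> cube n R \<Longrightarrow> f x = 0"
  shows "integrable (lebesgue_Rn n) f" "norm (LINT x|lebesgue_Rn n. f x) \<le> B * (2 * R) ^ n"
    "(LINT x|lebesgue_Rn n. norm (f x)) \<le> B * (2 * R) ^ n"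
proof -
  show int: "integrable (lebesgue_Rn n) f"
    by (rule integrableI_bounded_set[of "cube n R" _ _ B]) (use assms emeasure_cube[OF R, of n] in auto)
  have fin: "integrable (lebesgue_Rn n) (\<lambda>x. B * indicator (cube n R) x)"
    using emeasure_cube[OF R, of n] by (intro integrable_mult_right integrable_real_indicator) auto
  have "(LINT x|lebesgue_Rn n. norm (f x)) \<le> (LINT x|lebesgue_Rn n. B * indicator (cube n R) x)"
    using int fin B zero by (intro integral_mono) (auto simp: indicator_def)
  also have "\<dots> = B * (2 * R) ^ n" using measure_cube[OF R, of n]
    by (simp add: cube_def Int_def conj_commute conj_left_commute)
  finally show le: "(LINT x|lebesgue_Rn n. norm (f x)) \<le> B * (2 * R) ^ n" .
  show "norm (LINT x|lebesgue_Rn n. f x) \<le> B * (2 * R) ^ n"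
    by (rule order_trans[OF integral_norm_bound le])
qed

lemma continuous_map_bounded_on_cube:
  fixes f :: "point \<Rightarrow> complex"
  assumes "continuous_map (Rn n) euclidean f"
  obtains B where "B \<ge> 0" "\<And>x. x \<in> cube n R \<Longrightarrow> norm (f x) \<le> B"
proof -
  have "compactin euclidean (f ` cube n R)" by (rule image_compactin[OF compactin_cube assms])
  then have "bounded (f ` cube n R)" by (auto dest!: compact_imp_bounded)
  then obtain b where b: "\<forall>x\<in>cube n R. norm (f x) \<le> b" by (auto simp: bounded_iff)
  show ?thesis
  proof (rule that)
    show "norm (f x) \<le> max b 0" if "x \<in> cube n R" for x using b that by (simp add: le_max_iff_disj)
  qed simp
qed

lemma integrable_continuous_on_cube:
  fixes f :: "point \<Rightarrow> complex"
  assumes "continuous_map (Rn n) euclidean f" "R \<ge> 0"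
    and "\<And>x. x \<in> extensional {..<n} \<Longrightarrow> x \<notin> cube n R \<Longrightarrow> f x = 0"
  shows "integrable (lebesgue_Rn n) f"
  by (rule continuous_map_bounded_on_cube[OF assms(1)])
     (rule integral_bounded_on_cube(1)[OF borel_measurable_continuous_Rn[OF assms(1)] assms(2) _ assms(3)])

section \<open>Integration by parts\<close>

lemma integral_partial_derivative_eq_0:
  fixes F F' :: "point \<Rightarrow> complex"
  assumes m: "m < n" and int: "integrable (lebesgue_Rn n) F'"
    and d: "\<And>x t. x \<in> extensional {..<n} \<Longrightarrow> ((\<lambda>t. F (x(m := t))) has_vector_derivative F' (x(m := t))) (at t)"
    and supp: "\<And>x. x \<in> extensional {..<n} \<Longrightarrow> \<bar>x m\<bar> > R \<Longrightarrow> F x = 0"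
  shows "(LINT x|lebesgue_Rn n. F' x) = 0"
proof -
  have I: "insert m {..<n} = {..<n}" using m by auto
  \<comment> \<open>A slice on which \<open>F'\<close> is not integrable has Bochner integral 0 by
    convention, so the claim holds for every slice and not only for almost every one.\<close>
  have inner: "(LINT t|lborel. F' (x(m := t))) = 0" if x: "x \<in> extensional ({..<n} - {m})" for x
  proof (cases "integrable lborel (\<lambda>t. F' (x(m := t)))")
    case True
    define R' where "R' = \<bar>R\<bar> + 1"
    let ?y = "\<lambda>t. x(m := t)"
    have ext: "?y t \<in> extensional {..<n}" for t using x m by (auto simp: extensional_def)
    have d': "((\<lambda>t. F (?y t)) has_vector_derivative F' (?y t)) (at t)" for t
      using d[OF ext[of t], of t] by simp
    have F0: "F (?y t) = 0" if "\<bar>t\<bar> > R" for t using supp[OF ext[of t]] that by simp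
    have F'0: "F' (?y t) = 0" if "\<bar>t\<bar> > R" for t
    proof (rule vector_derivative_unique_at[OF d'])
      have "open {t :: real. \<bar>t\<bar> > R}" by (intro open_Collect_less continuous_intros)
      then show "((\<lambda>t. F (?y t)) has_vector_derivative 0) (at t)"
        by (rule has_vector_derivative_transform_within_open[OF has_vector_derivative_const])
          (use that F0 in simp_all)
    qed
    have "((\<lambda>t. F' (?y t)) has_integral (F (?y R') - F (?y (- R')))) {-R'..R'}"
      by (rule fundamental_theorem_of_calculus, simp add: R'_def, rule has_vector_derivative_at_within[OF d'])
    then have "((\<lambda>t. F' (?y t)) has_integral 0) {-R'..R'}" using F0 by (simp add: R'_def)
    then have "((\<lambda>t. F' (?y t)) has_integral 0) UNIV"
      by (rule has_integral_on_superset) (auto intro!: F'0 simp: R'_def)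
    with has_integral_integral_lborel[OF True] show ?thesis by (rule has_integral_unique)
  qed (simp add: not_integrable_integral_eq)
  have "(LINT x|lebesgue_Rn n. F' x) =
      (LINT x|Pi\<^sub>M ({..<n} - {m}) (\<lambda>_. lborel). LINT t|lborel. F' (x(m := t)))"
    using lborel_Rn.product_integral_insert[of "{..<n} - {m}" m F'] int by (simp add: I)
  also have "\<dots> = (LINT x|Pi\<^sub>M ({..<n} - {m}) (\<lambda>_. lborel :: real measure). 0)"
    by (rule Bochner_Integration.integral_cong[OF refl]) (simp add: inner space_PiM PiE_def)
  finally show ?thesis by simp
qed

text \<open>\<open>w * \<phi>'' - w'' * \<phi>\<close> is the derivative of
  \<open>w * \<phi>' - w' * \<phi>\<close>, so both integrations by parts are one application of
  \<open>integral_partial_derivative_eq_0\<close>. The support condition falls on \<phi> alone;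
  \<open>w\<close> may grow.\<close>

lemma integral_by_parts_twice:
  fixes w w' w'' \<phi> \<phi>' \<phi>'' :: "point \<Rightarrow> complex"
  assumes m: "m < n"
    and int: "integrable (lebesgue_Rn n) (\<lambda>x. w x * \<phi>'' x)" "integrable (lebesgue_Rn n) (\<lambda>x. w'' x * \<phi> x)"
    and w: "\<And>x t. x \<in> extensional {..<n} \<Longrightarrow> ((\<lambda>t. w (x(m := t))) has_vector_derivative w' (x(m := t))) (at t)"
      "\<And>x t. x \<in> extensional {..<n} \<Longrightarrow> ((\<lambda>t. w' (x(m := t))) has_vector_derivative w'' (x(m := t))) (at t)"
    and \<phi>: "\<And>x t. x \<in> extensional {..<n} \<Longrightarrow> ((\<lambda>t. \<phi> (x(m := t))) has_vector_derivative \<phi>' (x(m := t))) (at t)"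
      "\<And>x t. x \<in> extensional {..<n} \<Longrightarrow> ((\<lambda>t. \<phi>' (x(m := t))) has_vector_derivative \<phi>'' (x(m := t))) (at t)"
    and supp: "\<And>x. x \<in> extensional {..<n} \<Longrightarrow> \<bar>x m\<bar> > R \<Longrightarrow> \<phi> x = 0 \<and> \<phi>' x = 0"
  shows "(LINT x|lebesgue_Rn n. w x * \<phi>'' x) = (LINT x|lebesgue_Rn n. w'' x * \<phi> x)"
proof -
  have "(LINT x|lebesgue_Rn n. w x * \<phi>'' x - w'' x * \<phi> x) = 0"
  proof (rule integral_partial_derivative_eq_0[where m = m and R = R])
    show "((\<lambda>t. (\<lambda>x. w x * \<phi>' x - w' x * \<phi> x) (x(m := t))) has_vector_derivative
        w (x(m := t)) * \<phi>'' (x(m := t)) - w'' (x(m := t)) * \<phi> (x(m := t))) (at t)"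
      if "x \<in> extensional {..<n}" for x t
      using has_vector_derivative_diff[OF has_vector_derivative_mult[OF w(1) \<phi>(2)] has_vector_derivative_mult[OF w(2) \<phi>(1)], OF that that that that, of t]
      by (simp add: algebra_simps)
  qed (use m int supp in auto)
  then show ?thesis using int by simp
qed

section \<open>Test functions\<close>

declare topspace_product_topology [simp del]

lemma test_functionsD:
  assumes "\<phi> \<in> test_functions n U" "set is \<subseteq> {..<n}"
  shows "continuous_map (Rn n) euclidean (pds is \<phi>)"
    and "\<And>x i t. x \<in> extensional {..<n} \<Longrightarrow> i < n \<Longrightarrow>
      ((\<lambda>t. pds is \<phi> (x(i := t))) has_vector_derivative pds (i # is) \<phi> (x(i := t))) (at t)"
proof -
  have sm: "smooth n (extensional {..<n}) \<phi>" using assms(1) by (simp add: test_functions_def)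
  then show "continuous_map (Rn n) euclidean (pds is \<phi>)"
    using assms(2) subtopology_topspace[of "Rn n"] by (simp add: smooth_def)
  fix x :: point and i t assume x: "x \<in> extensional {..<n}" and i: "i < n"
  then have "x(i := t) \<in> extensional {..<n}" by (simp add: fun_upd_extensional_iff)
  with sm assms(2) i have "(\<lambda>s. pds is \<phi> ((x(i := t))(i := s))) differentiable (at ((x(i := t)) i))"
    unfolding smooth_def by blast
  then have "(\<lambda>s. pds is \<phi> (x(i := s))) differentiable (at t)" by simp
  then show "((\<lambda>t. pds is \<phi> (x(i := t))) has_vector_derivative pds (i # is) \<phi> (x(i := t))) (at t)"
    by (simp add: pd_def vector_derivative_works)
qed

lemma test_function_support:
  assumes "\<phi> \<in> test_functions n U"
  obtains R where "R > 0" "\<And>is x. set is \<subseteq> {..<n} \<Longrightarrow> x \<in> extensional {..<n} \<Longrightarrow> x \<notin> cube n R \<Longrightarrow> pds is \<phi> x = 0"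
proof -
  obtain K where K: "compactin (Rn n) K" "\<And>x. x \<notin> K \<Longrightarrow> \<phi> x = 0"
    using assms by (auto simp: test_functions_def)
  obtain R where R: "R > 0" "K \<subseteq> cube n R" using compactin_subset_cube[OF K(1)] by metis
  have "pds is \<phi> x = 0" if "set is \<subseteq> {..<n}" "x \<in> extensional {..<n}" "x \<notin> cube n R" for "is" x
    using that
  proof (induction "is" arbitrary: x)
    case Nil
    then show ?case using K(2) R(2) by auto
  next
    case (Cons i "is")
    then have i: "i < n" by simp
    obtain j where j: "j < n" "\<bar>x j\<bar> > R" using Cons.prems by (auto simp: cube_def not_le)
    \<comment> \<open>The coordinate \<open>j\<close> keeps the moved point outside the cube: every
      \<open>t\<close> is allowed if \<open>i\<close> differs from \<open>j\<close>, and otherwise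
      those with \<open>\<bar>t\<bar> > R\<close>. In both cases \<open>S\<close> is a neighborhood
      of \<open>x i\<close> on which the induction hypothesis applies.\<close>
    define S where "S = (if i = j then {t. \<bar>t\<bar> > R} else UNIV)"
    have S: "open S" "x i \<in> S" unfolding S_def using j by (auto intro!: open_Collect_less continuous_intros)
    have "pds is \<phi> (x(i := t)) = 0" if "t \<in> S" for t
    proof (rule Cons.IH)
      show "x(i := t) \<notin> cube n R" using that j by (auto simp: cube_def S_def not_le split: if_splits)
    qed (use Cons.prems i in \<open>simp_all add: fun_upd_extensional_iff del: fun_upd_apply\<close>)
    then have "((\<lambda>t. pds is \<phi> (x(i := t))) has_vector_derivative 0) (at (x i))"
      by (intro has_vector_derivative_transform_within_open[OF has_vector_derivative_const S]) simp
    then show ?case by (simp add: pd_def vector_derivative_at)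
  qed
  with R(1) show ?thesis by (rule that)
qed

lemma has_vector_derivative_tensor:
  fixes G :: "nat \<Rightarrow> real \<Rightarrow> complex"
  assumes "j < n" "(G j has_vector_derivative d) (at s)"
  shows "((\<lambda>t. \<Prod>i<n. G i ((x(j := t)) i)) has_vector_derivative d * (\<Prod>i\<in>{..<n} - {j}. G i (x i))) (at s)"
proof -
  have "(\<Prod>i<n. G i ((x(j := t)) i)) = G j t * (\<Prod>i\<in>{..<n} - {j}. G i (x i))" for t
  proof -
    have "(\<Prod>i<n. G i ((x(j := t)) i)) = G j t * (\<Prod>i\<in>{..<n} - {j}. G i ((x(j := t)) i))"
      using assms(1) by (subst prod.remove[of _ j]) auto
    also have "(\<Prod>i\<in>{..<n} - {j}. G i ((x(j := t)) i)) = (\<Prod>i\<in>{..<n} - {j}. G i (x i))"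
      by (rule prod.cong) auto
    finally show ?thesis .
  qed
  then show ?thesis using assms(2) by (simp add: has_vector_derivative_mult_left)
qed

text \<open>A test function has to vanish at every argument outside its compact set, including the
  arguments that are not extensional; hence the case distinction.\<close>

definition tensor :: "nat \<Rightarrow> (nat \<Rightarrow> real \<Rightarrow> complex) \<Rightarrow> point \<Rightarrow> complex" where
  "tensor n h x = (if x \<in> extensional {..<n} then \<Prod>i<n. h i (x i) else 0)"

lemma tensor_partial:
  assumes "j < n" "\<And>t. (G j has_vector_derivative G' t) (at t)"
  shows "((\<lambda>t. tensor n G (x(j := t))) has_vector_derivative tensor n (G(j := G')) (x(j := t))) (at t)"
proof (cases "x \<in> extensional {..<n}")
  case True
  have "(\<Prod>i<n. (G(j := G')) i ((x(j := t)) i)) = G' t * (\<Prod>i\<in>{..<n} - {j}. (G(j := G')) i ((x(j := t)) i))"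
    using assms(1) by (subst prod.remove[of _ j]) auto
  also have "(\<Prod>i\<in>{..<n} - {j}. (G(j := G')) i ((x(j := t)) i)) = (\<Prod>i\<in>{..<n} - {j}. G i (x i))"
    by (rule prod.cong) auto
  finally show ?thesis
    using has_vector_derivative_tensor[of j n G "G' t" t x] True assms
    by (simp only: tensor_def fun_upd_extensional_iff if_True)
next
  case False
  then show ?thesis using assms(1) by (simp add: tensor_def fun_upd_extensional_iff)
qed

lemma continuous_map_tensor_Rn:
  assumes "\<And>i. i < n \<Longrightarrow> continuous_on UNIV (h i)"
  shows "continuous_map (Rn n) euclidean (tensor n h)"
  using continuous_map_tensor[OF assms]
  by (rule continuous_map_eq) (auto simp: tensor_def)

lemma tensor_test_function:
  assumes sm: "\<And>i. i < n \<Longrightarrow> smooth_fun (h i)"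
    and supp: "\<And>x i. x \<in> extensional {..<n} \<Longrightarrow> i < n \<Longrightarrow> \<bar>x i\<bar> > R \<Longrightarrow> h i (x i) = 0" and R: "cube n R \<subseteq> U"
  shows "tensor n h \<in> test_functions n U"
proof -
  obtain D where D: "\<And>i. i < n \<Longrightarrow> D i 0 = h i"
    "\<And>i k t. i < n \<Longrightarrow> (D i k has_vector_derivative D i (Suc k) t) (at t)"
    using sm unfolding smooth_fun_def by metis
  \<comment> \<open>Partial derivatives act on separate factors, so only the number of occurrences
    of each index in the list matters.\<close>
  have pds: "pds is (tensor n h) = tensor n (\<lambda>i. D i (count_list is i))" if "set is \<subseteq> {..<n}" for "is"
    using that
  proof (induction "is")
    case Nil
    then show ?case using D(1) by (auto simp: tensor_def fun_eq_iff)
  next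
    case (Cons j "is")
    have "pd j (tensor n (\<lambda>i. D i (count_list is i))) x = tensor n (\<lambda>i. D i (count_list (j # is) i)) x" for x
    proof -
      have "(\<lambda>i. D i (count_list is i))(j := D j (Suc (count_list is j))) = (\<lambda>i. D i (count_list (j # is) i))"
        by auto
      then show ?thesis
        using tensor_partial[of j n "\<lambda>i. D i (count_list is i)" "D j (Suc (count_list is j))" x "x j"] D(2) Cons.prems
        by (simp add: pd_def vector_derivative_at del: count_list.simps)
    qed
    with Cons show ?case by auto
  qed
  have "continuous_map (Rn n) euclidean (pds is (tensor n h))" if "set is \<subseteq> {..<n}" for "is"
    unfolding pds[OF that]
    by (intro continuous_map_tensor_Rn continuous_at_imp_continuous_on ballI)
       (rule has_vector_derivative_continuous, rule D(2))
  moreover have "(\<lambda>t. pds is (tensor n h) (x(i := t))) differentiable (at (x i))"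
    if "set is \<subseteq> {..<n}" "i < n" for "is" x i
    unfolding pds[OF that(1)]
    using tensor_partial[of i n "\<lambda>i. D i (count_list is i)" "D i (Suc (count_list is i))" x "x i"] D(2) that(2)
    by (auto intro: differentiableI_vector)
  ultimately have "smooth n (topspace (Rn n)) (tensor n h)"
    unfolding smooth_def subtopology_topspace by blast
  moreover have "tensor n h x = 0" if "x \<notin> cube n R" for x
    using that supp by (force simp: tensor_def cube_def not_le)
  ultimately show ?thesis
    unfolding test_functions_def using compactin_cube[of n R] R by blast
qed

lemma test_function_box:
  assumes "\<delta> > 0" "a \<in> extensional {..<n}"
  obtains h :: "nat \<Rightarrow> real \<Rightarrow> real" where "tensor n (\<lambda>i t. of_real (h i t)) \<in> test_functions n (topspace (Rn n))"
    "\<And>i t. h i t \<ge> 0" "\<And>i t. \<bar>t - a i\<bar> \<le> \<delta> \<Longrightarrow> h i t = 1" "\<And>i t. \<bar>t - a i\<bar> \<ge> 3 * \<delta> \<Longrightarrow> h i t = 0"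
    "\<And>i. continuous_on UNIV (h i)" "\<And>i. smooth_fun (h i)"
proof -
  obtain b :: "real \<Rightarrow> real" where b: "smooth_fun b" "\<And>t. b t \<ge> 0"
    "\<And>t. \<bar>t\<bar> \<le> 1 \<Longrightarrow> b t = 1" "\<And>t. \<bar>t\<bar> \<ge> 3 \<Longrightarrow> b t = 0"
    using smooth_plateau by metis
  define h where "h i t = 1 *\<^sub>R b ((1 / \<delta>) * t + (- a i / \<delta>))" for i :: nat and t
  have e: "\<bar>(1 / \<delta>) * t + (- a i / \<delta>)\<bar> = \<bar>t - a i\<bar> / \<delta>" for i t
  proof -
    have "(1 / \<delta>) * t + (- a i / \<delta>) = (t - a i) / \<delta>" by (simp add: diff_divide_distrib)
    then show ?thesis using assms(1) by simp
  qed
  have sm: "smooth_fun (h i)" for i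
    unfolding h_def[abs_def] by (rule smooth_fun_affine[OF b(1)])
  have one: "h i t = 1" if "\<bar>t - a i\<bar> \<le> \<delta>" for i t
  proof -
    have "\<bar>(1 / \<delta>) * t + (- a i / \<delta>)\<bar> \<le> 1" unfolding e using that assms(1) by simp
    then show ?thesis unfolding h_def by (simp only: b(3) scaleR_one)
  qed
  have zero: "h i t = 0" if "\<bar>t - a i\<bar> \<ge> 3 * \<delta>" for i t
  proof -
    have "\<bar>(1 / \<delta>) * t + (- a i / \<delta>)\<bar> \<ge> 3" unfolding e using that assms(1) by (simp add: pos_le_divide_eq)
    then show ?thesis unfolding h_def by (simp only: b(4) scaleR_one)
  qed
  define R where "R = 3 * \<delta> + (\<Sum>i<n. \<bar>a i\<bar>)"
  have "tensor n (\<lambda>i t. of_real (h i t)) \<in> test_functions n (topspace (Rn n))"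
  proof (rule tensor_test_function[where R = R])
    show "smooth_fun (\<lambda>t. complex_of_real (h i t))" for i by (rule smooth_fun_of_real[OF sm])
    fix x i assume "i < n" "\<bar>x i\<bar> > R"
    moreover have "\<bar>a i\<bar> \<le> (\<Sum>i<n. \<bar>a i\<bar>)" using \<open>i < n\<close> by (intro member_le_sum) auto
    ultimately have "\<bar>x i - a i\<bar> \<ge> 3 * \<delta>" by (simp add: R_def)
    then show "complex_of_real (h i (x i)) = 0" by (simp add: zero)
  qed (auto simp: cube_def)
  moreover have "h i t \<ge> 0" for i t by (simp add: h_def b)
  moreover have "continuous_on UNIV (h i)" for i
  proof -
    obtain h' where "smooth_fun h'" "\<And>t. (h i has_vector_derivative h' t) (at t)"
      using smooth_fun_derivative[OF sm] by blast
    then show ?thesis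
      by (intro continuous_at_imp_continuous_on ballI) (rule has_vector_derivative_continuous)
  qed
  ultimately show ?thesis using one zero sm by (intro that)
qed

lemma openin_Rn_box:
  assumes "openin (Rn n) S" "a \<in> S"
  obtains \<delta> where "\<delta> > 0" "\<And>x. x \<in> extensional {..<n} \<Longrightarrow> (\<And>i. i < n \<Longrightarrow> \<bar>x i - a i\<bar> \<le> \<delta>) \<Longrightarrow> x \<in> S"
proof -
  obtain U where U': "\<forall>i\<in>{..<n}. openin euclideanreal (U i)" "a \<in> PiE {..<n} U" "PiE {..<n} U \<subseteq> S"
    using assms(1)[unfolded openin_product_topology_alt] assms(2) by blast
  then have U: "\<And>i. i < n \<Longrightarrow> open (U i)" "a \<in> PiE {..<n} U" "PiE {..<n} U \<subseteq> S"
    by simp_all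
  have "\<exists>e>0. cball (a i) e \<subseteq> U i" if "i < n" for i
    using U(1)[OF that] U(2) that by (auto simp: open_contains_cball PiE_def Pi_def)
  then obtain e where e: "\<And>i. i < n \<Longrightarrow> e i > 0 \<and> cball (a i) (e i) \<subseteq> U i" by metis
  \<comment> \<open>The element 1 keeps the minimum defined when \<open>n = 0\<close>.\<close>
  define \<delta> where "\<delta> = Min (insert 1 (e ` {..<n}))"
  have d: "\<delta> > 0" "\<And>i. i < n \<Longrightarrow> \<delta> \<le> e i" unfolding \<delta>_def using e by auto
  have "x \<in> S" if x: "x \<in> extensional {..<n}" "\<And>i. i < n \<Longrightarrow> \<bar>x i - a i\<bar> \<le> \<delta>" for x
  proof -
    have "x i \<in> cball (a i) (e i)" if "i < n" for i
      using x(2)[OF that] d(2)[OF that] by (simp add: dist_real_def abs_minus_commute)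
    then have "x i \<in> U i" if "i < n" for i using e that by blast
    then have "x \<in> PiE {..<n} U" using x(1) by (auto simp: PiE_def)
    then show ?thesis using U(3) by blast
  qed
  with d(1) show ?thesis by (rule that)
qed

text \<open>If \<open>f a\<close> were nonzero, the real part of \<open>cnj (f a) * f\<close> would
  stay above half its value at \<open>a\<close> in a small box, and its integral against a
  nonnegative box function supported there would be positive. This is what makes a continuous
  density of a distribution unique.\<close>

lemma continuous_eq_0_if_orthogonal:
  fixes f :: "point \<Rightarrow> complex"
  assumes f: "continuous_map (Rn n) euclidean f" and a: "a \<in> extensional {..<n}"
    and orth: "\<And>\<phi>. \<phi> \<in> test_functions n (topspace (Rn n)) \<Longrightarrow> (LINT x|lebesgue_Rn n. f x * \<phi> x) = 0"
  shows "f a = 0"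
proof (rule ccontr)
  assume nz: "f a \<noteq> 0"
  define g where "g x = Re (cnj (f a) * f x)" for x
  define c where "c = (norm (f a))\<^sup>2 / 2"
  have c: "c > 0" using nz by (simp add: c_def)
  have ga: "g a = 2 * c" by (simp add: g_def c_def cmod_power2 flip: power2_eq_square)
  have "continuous_map (Rn n) euclideanreal g"
    using f unfolding continuous_map_euclidean_iff g_def by (auto intro!: tendsto_intros)
  then have "openin (Rn n) {x \<in> topspace (Rn n). g x \<in> {c<..}}"
    by (rule openin_continuous_map_preimage) simp
  moreover have "a \<in> {x \<in> topspace (Rn n). g x \<in> {c<..}}" using a c ga by simp
  ultimately obtain \<delta>' where d': "\<delta>' > 0"
    "\<And>x. x \<in> extensional {..<n} \<Longrightarrow> (\<And>i. i < n \<Longrightarrow> \<bar>x i - a i\<bar> \<le> \<delta>') \<Longrightarrow> x \<in> {x \<in> topspace (Rn n). g x \<in> {c<..}}"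
    using openin_Rn_box by (metis (no_types, lifting))
  define \<delta> where "\<delta> = \<delta>' / 3"
  have d: "\<delta> > 0" "\<And>x. x \<in> extensional {..<n} \<Longrightarrow> (\<And>i. i < n \<Longrightarrow> \<bar>x i - a i\<bar> \<le> 3 * \<delta>) \<Longrightarrow> g x > c"
    using d' by (auto simp: \<delta>_def)
  obtain h :: "nat \<Rightarrow> real \<Rightarrow> real" where test: "tensor n (\<lambda>i t. of_real (h i t)) \<in> test_functions n (topspace (Rn n))"
    and h0: "\<And>i t. h i t \<ge> 0" and h1: "\<And>i t. \<bar>t - a i\<bar> \<le> \<delta> \<Longrightarrow> h i t = 1"
    and h2: "\<And>i t. \<bar>t - a i\<bar> \<ge> 3 * \<delta> \<Longrightarrow> h i t = 0"
    and hc: "\<And>i. continuous_on UNIV (h i)" "\<And>i. smooth_fun (h i)"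
    by (rule test_function_box[OF d(1) a]) (rule that)
  let ?\<phi> = "tensor n (\<lambda>i t. of_real (h i t))"
  obtain R where R: "R > 0" "\<And>is x. set is \<subseteq> {..<n} \<Longrightarrow> x \<in> extensional {..<n} \<Longrightarrow> x \<notin> cube n R \<Longrightarrow> pds is ?\<phi> x = 0"
    by (rule test_function_support[OF test]) (rule that)
  have phi: "?\<phi> x = of_real (\<Prod>i<n. h i (x i))" if "x \<in> extensional {..<n}" for x
    using that by (simp add: tensor_def)
  have int: "integrable (lebesgue_Rn n) (\<lambda>x. f x * ?\<phi> x)"
  proof (rule integrable_continuous_on_cube[where R = R])
    show "continuous_map (Rn n) euclidean (\<lambda>x. f x * ?\<phi> x)"
      using test_functionsD(1)[OF test, of "[]"] by (intro continuous_map_mult f) simp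
  qed (use R(1) R(2)[of "[]"] in auto)
  have hint: "integrable lborel (h i)" for i
  proof -
    have "integrable lborel (\<lambda>t. indicator {a i - 3 * \<delta>..a i + 3 * \<delta>} t *\<^sub>R h i t)"
      by (intro borel_integrable_compact continuous_on_subset[OF hc(1)]) auto
    moreover have "(\<lambda>t. indicator {a i - 3 * \<delta>..a i + 3 * \<delta>} t *\<^sub>R h i t) = h i"
    proof
      show "indicator {a i - 3 * \<delta>..a i + 3 * \<delta>} t *\<^sub>R h i t = h i t" for t
        using h2[of t i] by (cases "3 * \<delta> \<le> \<bar>t - a i\<bar>") (auto simp: indicator_def)
    qed
    ultimately show ?thesis by simp
  qed
  have pint: "integrable (lebesgue_Rn n) (\<lambda>x. \<Prod>i<n. h i (x i))"
    by (rule lborel_Rn.product_integrable_prod) (auto intro: hint)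
  have "(LINT t|lborel. h i t) \<ge> 2 * \<delta>" for i
  proof -
    have "(LINT t|lborel. indicator {a i - \<delta>..a i + \<delta>} t) \<le> (LINT t|lborel. h i t)"
      using h0 h1 by (intro integral_mono hint integrable_real_indicator)
        (auto simp: indicator_def abs_le_iff emeasure_lborel_Icc_eq)
    then show ?thesis using d(1) by simp
  qed
  then have "(\<Prod>i<n. integral\<^sup>L lborel (h i)) > 0" using d(1) by (intro prod_pos) (smt (verit))
  then have "c * (LINT x|lebesgue_Rn n. (\<Prod>i<n. h i (x i))) > 0"
    using c lborel_Rn.product_integral_prod[of "{..<n}" h] hint by simp
  also have "c * (LINT x|lebesgue_Rn n. (\<Prod>i<n. h i (x i))) = (LINT x|lebesgue_Rn n. c * (\<Prod>i<n. h i (x i)))" by simp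
  also have "\<dots> \<le> (LINT x|lebesgue_Rn n. Re (cnj (f a) * (f x * ?\<phi> x)))"
  proof (rule integral_mono)
    show "integrable (lebesgue_Rn n) (\<lambda>x. c * (\<Prod>i<n. h i (x i)))" using pint by simp
    show "integrable (lebesgue_Rn n) (\<lambda>x. Re (cnj (f a) * (f x * ?\<phi> x)))"
      using int by (intro integrable_Re integrable_mult_right) simp
    fix x assume "x \<in> space (lebesgue_Rn n)"
    then have x: "x \<in> extensional {..<n}" by simp
    have "Re (cnj (f a) * (f x * ?\<phi> x)) = g x * (\<Prod>i<n. h i (x i))"
      unfolding phi[OF x] g_def mult.assoc[symmetric] by (simp add: times_complex.sel del: of_real_prod)
    moreover have "c * (\<Prod>i<n. h i (x i)) \<le> g x * (\<Prod>i<n. h i (x i))"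
    proof (cases "\<forall>i<n. \<bar>x i - a i\<bar> \<le> 3 * \<delta>")
      case True
      then show ?thesis using d(2)[OF x] h0 by (intro mult_right_mono prod_nonneg) auto
    next
      case False
      then obtain i where "i < n" "h i (x i) = 0" using h2 by force
      then have "(\<Prod>i<n. h i (x i)) = 0" by (intro prod_zero) auto
      then show ?thesis by (simp only: mult_zero_right order_refl)
    qed
    ultimately show "c * (\<Prod>i<n. h i (x i)) \<le> Re (cnj (f a) * (f x * ?\<phi> x))" by simp
  qed
  also have "\<dots> = Re (cnj (f a) * (LINT x|lebesgue_Rn n. f x * ?\<phi> x))"
    using int by (subst integral_Re) simp_all
  also have "\<dots> = 0" using orth[OF test] by simp
  finally show False by simp
qed

section \<open>The null solution of the sum of squares\<close>

text \<open>\<open>double\<close> separates the frequencies for the FBI transform. The square in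
  \<open>kappa_small\<close> leaves room for weights exp (- k \<kappa>) that make the sum of the
  modes converge and still are exp (- o(\<rho>)).\<close>

locale mode_family =
  fixes \<rho> \<kappa> \<mu> :: "nat \<Rightarrow> real" and g g' :: "nat \<Rightarrow> real \<Rightarrow> real"
  assumes data: "\<And>k. mode_data (\<rho> k) (\<kappa> k) (\<mu> k) (g k) (g' k)"
    and double: "\<And>k. 2 * \<rho> k \<le> \<rho> (Suc k)"
    and kappa_small: "\<And>k. (real k + 1)\<^sup>2 * \<kappa> k \<le> \<rho> k"

lemma mode_family_exists: "\<exists>\<rho> \<kappa> \<mu> g g'. mode_family \<rho> \<kappa> \<mu> g g'"
proof -
  let ?P = "\<lambda>(n :: nat) (\<rho>, \<kappa>, \<mu>, g, g'). mode_data \<rho> \<kappa> \<mu> g g' \<and> (real n + 1)\<^sup>2 * \<kappa> \<le> \<rho>"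
  have ex: "\<exists>s. ?P n s \<and> fst s \<ge> R" for n :: nat and R
  proof -
    have pos: "(real n + 1)\<^sup>2 > 0" by (intro zero_less_power) simp
    obtain \<rho> \<kappa> \<mu> g g' where "mode_data \<rho> \<kappa> \<mu> g g'" "\<rho> \<ge> R" "\<kappa> \<le> 1 / (real n + 1)\<^sup>2 * \<rho>"
      by (rule mode_data_exists[of "1 / (real n + 1)\<^sup>2" R]) (use pos in simp_all)
    then show ?thesis using pos
      by (intro exI[of _ "(\<rho>, \<kappa>, \<mu>, g, g')"]) (simp add: pos_le_divide_eq mult.commute)
  qed
  have "\<exists>s. \<forall>n. ?P n (s n) \<and> 2 * fst (s n) \<le> fst (s (Suc n))"
  proof (rule dependent_nat_choice)
    show "\<exists>s. ?P 0 s" using ex[of 0 0] by blast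
    show "\<exists>t. ?P (Suc n) t \<and> 2 * fst s \<le> fst t" for s n by (rule ex)
  qed
  then obtain s where s: "\<forall>n. ?P n (s n) \<and> 2 * fst (s n) \<le> fst (s (Suc n))" by (rule exE)
  have "mode_family (\<lambda>n. fst (s n)) (\<lambda>n. fst (snd (s n))) (\<lambda>n. fst (snd (snd (s n))))
      (\<lambda>n. fst (snd (snd (snd (s n))))) (\<lambda>n. snd (snd (snd (snd (s n)))))"
    using s by unfold_locales (auto simp: case_prod_unfold)
  then show ?thesis by blast
qed

text \<open>The vector fields $\partial_0, \partial_1, x_0\partial_2, x_0\partial_3, x_1\partial_2, x_1^3\partial_3$.\<close>

definition field_dir :: "nat \<Rightarrow> nat" where "field_dir j = (if j < 4 then j else j - 2)"
definition field_src :: "nat \<Rightarrow> nat" where "field_src j = (if j < 4 then 0 else 1)"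
definition field_exp :: "nat \<Rightarrow> nat" where "field_exp j = (if j < 2 then 0 else if j < 5 then 1 else 3)"

definition treves_field :: "nat \<Rightarrow> vfield" where
  "treves_field j k x = (if k = field_dir j then x (field_src j) ^ field_exp j else 0)"

lemma field_dir_less: "j < 6 \<Longrightarrow> field_dir j < 4"
  and field_src_less: "field_src j < 4"
  and field_dir_src: "field_dir j \<noteq> field_src j \<or> field_exp j = 0"
  by (auto simp: field_dir_def field_src_def field_exp_def)

text \<open>By \<open>field_dir_src\<close> a coefficient is constant or depends on another variable
  than the one being differentiated. It therefore commutes with its derivative, and the square of
  each field is, up to sign, the squared coefficient times a pure second derivative.\<close>

lemma field_coeff_upd: "(x(field_dir j := t)) (field_src j) ^ field_exp j = x (field_src j) ^ field_exp j"
  using field_dir_src[of j] by auto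

lemma of_real_field_coeff_upd:
  "complex_of_real ((x(field_dir j := t)) (field_src j)) ^ field_exp j = of_real (x (field_src j)) ^ field_exp j"
  by (simp only: field_coeff_upd flip: of_real_power)

lemma field_transpose_treves:
  assumes j: "j < 6"
    and d: "((\<lambda>t. \<phi> (x(field_dir j := t))) has_vector_derivative d) (at (x (field_dir j)))"
  shows "field_transpose 4 (treves_field j) \<phi> x = \<i> * of_real (x (field_src j) ^ field_exp j) * d"
proof -
  have "D k (\<lambda>y. of_real (treves_field j k y) * \<phi> y) x =
      (if k = field_dir j then - \<i> * (of_real (x (field_src j) ^ field_exp j) * d) else 0)" for k
  proof (cases "k = field_dir j")
    case True
    have "((\<lambda>t. of_real (x (field_src j) ^ field_exp j) * \<phi> (x(field_dir j := t))) has_vector_derivative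
        of_real (x (field_src j) ^ field_exp j) * d) (at (x (field_dir j)))"
      by (rule has_vector_derivative_mult_right[OF d])
    then show ?thesis using True
      by (simp add: D_def pd_def treves_field_def of_real_field_coeff_upd vector_derivative_at del: fun_upd_apply)
  qed (simp add: D_def pd_def treves_field_def)
  then have "(\<Sum>k<4. D k (\<lambda>y. of_real (treves_field j k y) * \<phi> y) x) = - \<i> * (of_real (x (field_src j) ^ field_exp j) * d)"
    using field_dir_less[OF j] by simp
  then show ?thesis by (simp add: field_transpose_def)
qed

lemma field_transpose_treves_twice:
  assumes j: "j < 6" and \<phi>: "\<phi> \<in> test_functions 4 U" and x: "x \<in> extensional {..<4}"
  shows "field_transpose 4 (treves_field j) (field_transpose 4 (treves_field j) \<phi>) x =
    - of_real ((x (field_src j) ^ field_exp j)\<^sup>2) * pds [field_dir j, field_dir j] \<phi> x"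
proof -
  let ?m = "field_dir j" and ?a = "of_real (x (field_src j) ^ field_exp j) :: complex"
  note m = field_dir_less[OF j]
  have 1: "field_transpose 4 (treves_field j) \<phi> (x(?m := t)) = \<i> * ?a * pds [?m] \<phi> (x(?m := t))" for t
    using field_transpose_treves[OF j, of \<phi> "x(?m := t)"] test_functionsD(2)[OF \<phi>, of "[]" x ?m t] x m
    by (simp add: of_real_field_coeff_upd fun_upd_same del: fun_upd_apply)
  have "((\<lambda>t. \<i> * ?a * pds [?m] \<phi> (x(?m := t))) has_vector_derivative
      \<i> * ?a * pds [?m, ?m] \<phi> (x(?m := x ?m))) (at (x ?m))"
    using test_functionsD(2)[OF \<phi>, of "[?m]" x ?m "x ?m"] x m
    by (intro has_vector_derivative_mult_right) auto
  then have "((\<lambda>t. field_transpose 4 (treves_field j) \<phi> (x(?m := t))) has_vector_derivative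
      \<i> * ?a * pds [?m, ?m] \<phi> x) (at (x ?m))"
    unfolding 1 by simp
  then have "field_transpose 4 (treves_field j) (field_transpose 4 (treves_field j) \<phi>) x =
      \<i> * ?a * (\<i> * ?a * pds [?m, ?m] \<phi> x)" by (rule field_transpose_treves[OF j])
  also have "\<dots> = (\<i> * \<i>) * ((?a * ?a) * pds [?m, ?m] \<phi> x)" by (simp only: mult_ac)
  finally show ?thesis by (simp add: power2_eq_square)
qed

lemma has_vector_derivative_of_real_real:
  "(f has_real_derivative d) (at t) \<Longrightarrow> ((\<lambda>t. complex_of_real (f t)) has_vector_derivative of_real d) (at t)"
  unfolding has_real_derivative_iff_has_vector_derivative
  by (rule bounded_linear.has_vector_derivative[OF bounded_linear_of_real])

lemma has_vector_derivative_cis: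
  "((\<lambda>t. cis (a * t)) has_vector_derivative \<i> * of_real a * cis (a * t)) (at t)"
proof -
  have "((\<lambda>z. exp (\<i> * of_real a * z)) has_field_derivative exp (\<i> * of_real a * of_real t) * (\<i> * of_real a)) (at (of_real t))"
    by (auto intro!: derivative_eq_intros)
  from has_vector_derivative_real_field[OF this] show ?thesis
    by (simp add: cis_conv_exp mult_ac)
qed

section \<open>Separated null solutions and their weighted sum\<close>

context mode_family
begin

lemma rho_ge_1: "\<rho> k \<ge> 1" and sqrt_rho_le: "sqrt (\<rho> k) \<le> \<kappa> k" and mu_nonneg: "\<mu> k \<ge> 0"
  and mu_eq: "(\<mu> k)\<^sup>2 = (\<rho> k)\<^sup>2 - (\<kappa> k)\<^sup>2"
  and g_deriv: "(g k has_real_derivative g' k t) (at t)"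
    "(g' k has_real_derivative ((\<rho> k)\<^sup>2 * t ^ 6 - (\<kappa> k)\<^sup>2 * t\<^sup>2 + \<mu> k) * g k t) (at t)"
  and g_lower: "exp (- \<rho> k * t ^ 4 / 4) \<le> g k t"
  and g_upper: "g k t \<le> exp (sqrt (\<rho> k) * \<bar>t\<bar>)"
  using data[of k] by (auto simp: mode_data_def)

text \<open>The growth is built into the locale: \<kappa> \<ge> 1 turns \<open>kappa_small\<close>
  into \<rho> \<ge> (k + 1)^2, and \<kappa> dominates the square root of \<rho>.\<close>

lemma kappa_ge: "\<kappa> k \<ge> real k + 1"
proof -
  have "\<kappa> k \<ge> 1" using rho_ge_1[of k] sqrt_rho_le[of k] by (smt (verit) real_sqrt_ge_one)
  then have "(real k + 1)\<^sup>2 * 1 \<le> (real k + 1)\<^sup>2 * \<kappa> k" by (intro mult_left_mono) auto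
  from order_trans[OF this kappa_small] have "(real k + 1)\<^sup>2 \<le> \<rho> k" by simp
  then have "real k + 1 \<le> sqrt (\<rho> k)" by (rule real_le_rsqrt)
  then show ?thesis using sqrt_rho_le[of k] by simp
qed

lemma kappa_pos: "\<kappa> k > 0" using kappa_ge[of k] by linarith

lemma rho_pos: "\<rho> k > 0" using rho_ge_1[of k] by linarith

lemma mu_le_rho: "\<mu> k \<le> \<rho> k"
proof (rule power2_le_imp_le)
  show "(\<mu> k)\<^sup>2 \<le> (\<rho> k)\<^sup>2" by (simp add: mu_eq)
qed (use rho_pos[of k] in simp)

lemma g_pos: "g k t > 0"
  using g_lower[of k t] exp_gt_zero[of "- \<rho> k * t ^ 4 / 4"] by linarith

definition fac :: "nat \<Rightarrow> nat \<Rightarrow> real \<Rightarrow> complex" where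
  "fac k i t =
    (if i = 0 then of_real (exp (- \<mu> k * t\<^sup>2 / 2)) else if i = 1 then of_real (g k t)
     else if i = 2 then of_real (exp (- \<kappa> k * t)) else cis (\<rho> k * t))"

definition fac' :: "nat \<Rightarrow> nat \<Rightarrow> real \<Rightarrow> complex" where
  "fac' k i t =
    (if i = 0 then of_real (- \<mu> k * t * exp (- \<mu> k * t\<^sup>2 / 2)) else if i = 1 then of_real (g' k t)
     else if i = 2 then of_real (- \<kappa> k * exp (- \<kappa> k * t)) else \<i> * of_real (\<rho> k) * cis (\<rho> k * t))"

text \<open>The second derivative of \<open>fac k i\<close> divided by \<open>fac k i\<close>: the
  two oscillator potentials shifted by their energies, and the constants produced by the
  exponentials in x_2 and x_3.\<close>

definition pot :: "nat \<Rightarrow> nat \<Rightarrow> real \<Rightarrow> real" where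
  "pot k i t =
    (if i = 0 then (\<mu> k)\<^sup>2 * t\<^sup>2 - \<mu> k else if i = 1 then (\<rho> k)\<^sup>2 * t ^ 6 - (\<kappa> k)\<^sup>2 * t\<^sup>2 + \<mu> k
     else if i = 2 then (\<kappa> k)\<^sup>2 else - (\<rho> k)\<^sup>2)"

lemma fac_deriv: "(fac k i has_vector_derivative fac' k i t) (at t)"
proof -
  have "((\<lambda>t. exp (- \<mu> k * t\<^sup>2 / 2)) has_real_derivative - \<mu> k * t * exp (- \<mu> k * t\<^sup>2 / 2)) (at t)"
    by (auto intro!: derivative_eq_intros)
  moreover have "((\<lambda>t. exp (- \<kappa> k * t)) has_real_derivative - \<kappa> k * exp (- \<kappa> k * t)) (at t)"
    by (auto intro!: derivative_eq_intros)
  ultimately show ?thesis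
    using has_vector_derivative_of_real_real[OF g_deriv(1)] has_vector_derivative_cis[of "\<rho> k" t]
    by (auto simp: fac_def[abs_def] fac'_def intro!: has_vector_derivative_of_real_real
        simp del: of_real_mult of_real_minus of_real_exp mult_minus_left)
qed

lemma fac'_deriv: "(fac' k i has_vector_derivative of_real (pot k i t) * fac k i t) (at t)"
proof -
  have 0: "((\<lambda>t. - \<mu> k * t * exp (- \<mu> k * t\<^sup>2 / 2)) has_real_derivative
      ((\<mu> k)\<^sup>2 * t\<^sup>2 - \<mu> k) * exp (- \<mu> k * t\<^sup>2 / 2)) (at t)"
    by (auto intro!: derivative_eq_intros simp: algebra_simps power2_eq_square)
  have 2: "((\<lambda>t. - \<kappa> k * exp (- \<kappa> k * t)) has_real_derivative (\<kappa> k)\<^sup>2 * exp (- \<kappa> k * t)) (at t)"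
    by (auto intro!: derivative_eq_intros simp: power2_eq_square)
  have 3: "((\<lambda>t. \<i> * of_real (\<rho> k) * cis (\<rho> k * t)) has_vector_derivative of_real (- (\<rho> k)\<^sup>2) * cis (\<rho> k * t)) (at t)"
    using has_vector_derivative_mult_right[OF has_vector_derivative_cis[of "\<rho> k" t], of "\<i> * of_real (\<rho> k)"]
    by (simp add: power2_eq_square algebra_simps)
  consider "i = 0" | "i = 1" | "i = 2" | "i \<noteq> 0" "i \<noteq> 1" "i \<noteq> 2" by blast
  then show ?thesis
  proof cases
    case 1
    then have "fac' k i = (\<lambda>t. of_real (- \<mu> k * t * exp (- \<mu> k * t\<^sup>2 / 2)))"
      "of_real (pot k i t) * fac k i t = of_real (((\<mu> k)\<^sup>2 * t\<^sup>2 - \<mu> k) * exp (- \<mu> k * t\<^sup>2 / 2))"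
      by (simp_all add: fac'_def fac_def pot_def fun_eq_iff)
    then show ?thesis using has_vector_derivative_of_real_real[OF 0] by simp
  next
    case 2
    then have "fac' k i = (\<lambda>t. of_real (g' k t))"
      "of_real (pot k i t) * fac k i t = of_real (((\<rho> k)\<^sup>2 * t ^ 6 - (\<kappa> k)\<^sup>2 * t\<^sup>2 + \<mu> k) * g k t)"
      by (simp_all add: fac'_def fac_def pot_def fun_eq_iff)
    then show ?thesis using has_vector_derivative_of_real_real[OF g_deriv(2)[of k t]] by simp
  next
    case 3
    then have "fac' k i = (\<lambda>t. of_real (- \<kappa> k * exp (- \<kappa> k * t)))"
      "of_real (pot k i t) * fac k i t = of_real ((\<kappa> k)\<^sup>2 * exp (- \<kappa> k * t))"
      by (simp_all add: fac'_def fac_def pot_def fun_eq_iff)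
    then show ?thesis using has_vector_derivative_of_real_real[OF 2] by simp
  next
    case 4
    then have "fac' k i = (\<lambda>t. \<i> * of_real (\<rho> k) * cis (\<rho> k * t))"
      "of_real (pot k i t) * fac k i t = of_real (- (\<rho> k)\<^sup>2) * cis (\<rho> k * t)"
      by (simp_all add: fac'_def fac_def pot_def fun_eq_iff)
    then show ?thesis using 3 by simp
  qed
qed

lemma fac_cont: "continuous_on UNIV (fac k i)"
  by (intro continuous_at_imp_continuous_on ballI) (rule has_vector_derivative_continuous[OF fac_deriv])

definition mode :: "nat \<Rightarrow> point \<Rightarrow> complex" where "mode k = tensor 4 (fac k)"

text \<open>The factor \<open>k\<close> eventually beats the rate at which the modes grow on any
  fixed cube, so the weighted sum converges everywhere; yet \<open>k * \<kappa> k\<close> is small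
  compared with \<open>\<rho> k\<close>, see \<open>weight_ge\<close>.\<close>

definition weight :: "nat \<Rightarrow> real" where "weight k = exp (- real k * \<kappa> k)"

text \<open>On the cube of radius \<open>R\<close> the factors in x_1 and x_2 are each at most exp
  (\<kappa> R) and the other two at most 1, hence the rate \<open>2 * R\<close>.\<close>

definition majorant :: "real \<Rightarrow> nat \<Rightarrow> real" where "majorant R k = exp ((2 * R - real k) * \<kappa> k)"

lemma weight_pos: "weight k > 0" by (simp add: weight_def)

lemma mode_cont: "continuous_map (Rn 4) euclidean (mode k)"
  unfolding mode_def by (rule continuous_map_tensor_Rn[OF fac_cont])

lemma summable_majorant: "summable (majorant R)"
proof (rule summable_comparison_test_ev)
  show "summable (\<lambda>k. exp (-1 :: real) ^ k)" by (rule summable_geometric) simp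
  have "norm (majorant R k) \<le> exp (-1) ^ k" if "k \<ge> nat \<lceil>2 * R + 1\<rceil>" for k
  proof -
    have "2 * R - real k \<le> -1" using that by linarith
    then have "(2 * R - real k) * \<kappa> k \<le> -1 * \<kappa> k" using kappa_pos[of k] by (intro mult_right_mono) auto
    also have "\<dots> \<le> - real k" using kappa_ge[of k] by simp
    finally have "majorant R k \<le> exp (- real k)" by (simp add: majorant_def)
    then show ?thesis by (simp add: majorant_def flip: exp_of_nat_mult)
  qed
  then show "\<forall>\<^sub>F k in sequentially. norm (majorant R k) \<le> exp (-1) ^ k"
    unfolding eventually_sequentially by blast
qed

lemma norm_mode_le:
  assumes "x \<in> cube 4 R"
  shows "norm (weight k * mode k x) \<le> majorant R k"
proof -
  have R: "\<bar>x i\<bar> \<le> R" if "i < 4" for i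
    using assms that by (auto simp: cube_def)
  have x: "x \<in> extensional {..<4}" using assms by (auto simp: cube_def)
  have R0: "R \<ge> 0" using R[of 0] by simp
  have "norm (fac k 0 (x 0)) \<le> 1" using mu_nonneg[of k] by (simp add: fac_def)
  moreover have "norm (fac k 1 (x 1)) \<le> exp (\<kappa> k * R)"
  proof -
    have "g k (x 1) \<le> exp (sqrt (\<rho> k) * \<bar>x 1\<bar>)" by (rule g_upper)
    also have "sqrt (\<rho> k) * \<bar>x 1\<bar> \<le> \<kappa> k * R"
      using R[of 1] sqrt_rho_le[of k] kappa_pos[of k] by (intro mult_mono) auto
    finally show ?thesis using g_pos[of k "x 1"] by (simp add: fac_def)
  qed
  moreover have "norm (fac k 2 (x 2)) \<le> exp (\<kappa> k * R)"
  proof -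
    have "\<kappa> k * (- x 2) \<le> \<kappa> k * R" using R[of 2] kappa_pos[of k] by (intro mult_left_mono) auto
    then show ?thesis by (simp add: fac_def)
  qed
  moreover have "norm (fac k 3 (x 3)) \<le> 1" by (simp add: fac_def)
  ultimately have "norm (fac k 0 (x 0)) * norm (fac k 1 (x 1)) * norm (fac k 2 (x 2)) * norm (fac k 3 (x 3))
      \<le> 1 * exp (\<kappa> k * R) * exp (\<kappa> k * R) * 1"
    by (intro mult_mono) auto
  then have "norm (mode k x) \<le> exp (2 * R * \<kappa> k)"
    using x by (simp add: mode_def tensor_def eval_nat_numeral norm_mult mult_ac flip: exp_add)
  then have "weight k * norm (mode k x) \<le> weight k * exp (2 * R * \<kappa> k)"
    using weight_pos[of k] by (intro mult_left_mono) auto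
  also have "\<dots> = majorant R k" by (simp add: weight_def majorant_def algebra_simps flip: exp_add)
  finally show ?thesis using weight_pos[of k] by (simp add: norm_mult)
qed

lemma mode_integral:
  assumes \<phi>: "\<phi> \<in> borel_measurable (lebesgue_Rn 4)" and R: "R \<ge> 0"
    and B: "\<And>x. x \<in> cube 4 R \<Longrightarrow> norm (\<phi> x) \<le> B"
    and zero: "\<And>x. x \<in> extensional {..<4} \<Longrightarrow> x \<notin> cube 4 R \<Longrightarrow> \<phi> x = 0"
  shows "integrable (lebesgue_Rn 4) (\<lambda>x. weight k * mode k x * \<phi> x)"
    "norm (LINT x|lebesgue_Rn 4. weight k * mode k x * \<phi> x) \<le> majorant R k * B * (2 * R) ^ 4"
    "(LINT x|lebesgue_Rn 4. norm (weight k * mode k x * \<phi> x)) \<le> majorant R k * B * (2 * R) ^ 4"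
    "\<And>x. x \<in> extensional {..<4} \<Longrightarrow> norm (weight k * mode k x * \<phi> x) \<le> majorant R k * \<bar>B\<bar>"
proof -
  have meas: "(\<lambda>x. weight k * mode k x * \<phi> x) \<in> borel_measurable (lebesgue_Rn 4)"
    using borel_measurable_continuous_Rn[OF mode_cont] \<phi> by measurable
  have le: "norm (weight k * mode k x * \<phi> x) \<le> majorant R k * B" if "x \<in> cube 4 R" for x
    using norm_mode_le[OF that, of k] B[OF that] unfolding norm_mult[of _ "\<phi> x"]
    by (intro mult_mono) (auto simp: majorant_def)
  then show "integrable (lebesgue_Rn 4) (\<lambda>x. weight k * mode k x * \<phi> x)"
    "norm (LINT x|lebesgue_Rn 4. weight k * mode k x * \<phi> x) \<le> majorant R k * B * (2 * R) ^ 4"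
    "(LINT x|lebesgue_Rn 4. norm (weight k * mode k x * \<phi> x)) \<le> majorant R k * B * (2 * R) ^ 4"
    using integral_bounded_on_cube[OF meas R, of "majorant R k * B"] zero by auto
  have mono: "majorant R k * B \<le> majorant R k * \<bar>B\<bar>" by (simp add: majorant_def)
  show "norm (weight k * mode k x * \<phi> x) \<le> majorant R k * \<bar>B\<bar>" if "x \<in> extensional {..<4}" for x
  proof (cases "x \<in> cube 4 R")
    case True
    show ?thesis by (rule order_trans[OF le[OF True] mono])
  next
    case False
    then show ?thesis using zero[OF that] by (simp add: majorant_def)
  qed
qed

text \<open>Summing the pairings and not the functions allows the equation to be checked mode by
  mode. The series is identified with a continuous density later, in
  \<open>solution_eq_integral\<close>.\<close>

definition solution :: functional where
  "solution \<phi> = (\<Sum>k. LINT x|lebesgue_Rn 4. weight k * mode k x * \<phi> x)"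

lemma test_function_bounds:
  assumes "\<phi> \<in> test_functions 4 U"
  obtains R B where "R > 0" "\<phi> \<in> borel_measurable (lebesgue_Rn 4)" "B \<ge> 0" "\<And>x. x \<in> cube 4 R \<Longrightarrow> norm (\<phi> x) \<le> B"
    "\<And>x. x \<in> extensional {..<4} \<Longrightarrow> x \<notin> cube 4 R \<Longrightarrow> \<phi> x = 0"
proof -
  obtain R where R: "R > 0" "\<And>is x. set is \<subseteq> {..<4} \<Longrightarrow> x \<in> extensional {..<4} \<Longrightarrow> x \<notin> cube 4 R \<Longrightarrow> pds is \<phi> x = 0"
    by (rule test_function_support[OF assms]) (rule that)
  have c: "continuous_map (Rn 4) euclidean \<phi>" using test_functionsD(1)[OF assms, of "[]"] by simp
  obtain B where B: "B \<ge> 0" "\<And>x. x \<in> cube 4 R \<Longrightarrow> norm (\<phi> x) \<le> B"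
    by (rule continuous_map_bounded_on_cube[OF c]) (rule that)
  show ?thesis
    using R(1) borel_measurable_continuous_Rn[OF c] B R(2)[of "[]"] by (intro that) auto
qed

lemma solution_summable:
  assumes "\<phi> \<in> test_functions 4 U"
  shows "integrable (lebesgue_Rn 4) (\<lambda>x. weight k * mode k x * \<phi> x)"
    "summable (\<lambda>k. LINT x|lebesgue_Rn 4. weight k * mode k x * \<phi> x)"
proof -
  obtain R B where b: "R > 0" "\<phi> \<in> borel_measurable (lebesgue_Rn 4)" "B \<ge> 0"
    "\<And>x. x \<in> cube 4 R \<Longrightarrow> norm (\<phi> x) \<le> B"
    "\<And>x. x \<in> extensional {..<4} \<Longrightarrow> x \<notin> cube 4 R \<Longrightarrow> \<phi> x = 0"
    by (rule test_function_bounds[OF assms]) (rule that)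
  note mi = mode_integral[OF b(2) less_imp_le[OF b(1)] b(4,5)]
  show "integrable (lebesgue_Rn 4) (\<lambda>x. weight k * mode k x * \<phi> x)" by (rule mi(1))
  have "summable (\<lambda>k. majorant R k * B * (2 * R) ^ 4)"
    by (intro summable_mult2 summable_majorant)
  then show "summable (\<lambda>k. LINT x|lebesgue_Rn 4. weight k * mode k x * \<phi> x)"
    by (rule summable_comparison_test') (rule mi(2))
qed

lemma solution_distribution: "distribution 4 (topspace (Rn 4)) solution"
  unfolding distribution_def
proof (intro conjI ballI allI impI)
  fix \<phi> \<psi> :: "point \<Rightarrow> complex" and a b
  assume \<phi>: "\<phi> \<in> test_functions 4 (topspace (Rn 4))" and \<psi>: "\<psi> \<in> test_functions 4 (topspace (Rn 4))"
  note s = solution_summable[OF \<phi>] solution_summable[OF \<psi>]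
  have "(LINT x|lebesgue_Rn 4. weight k * mode k x * (a * \<phi> x + b * \<psi> x)) =
      a * (LINT x|lebesgue_Rn 4. weight k * mode k x * \<phi> x) + b * (LINT x|lebesgue_Rn 4. weight k * mode k x * \<psi> x)" for k
  proof -
    have "(LINT x|lebesgue_Rn 4. weight k * mode k x * (a * \<phi> x + b * \<psi> x)) =
      (LINT x|lebesgue_Rn 4. a * (weight k * mode k x * \<phi> x) + b * (weight k * mode k x * \<psi> x))"
      by (simp add: algebra_simps)
    also have "\<dots> = a * (LINT x|lebesgue_Rn 4. weight k * mode k x * \<phi> x) + b * (LINT x|lebesgue_Rn 4. weight k * mode k x * \<psi> x)"
      using s(1,3)[of k]
      by (subst Bochner_Integration.integral_add) (simp_all only: integrable_mult_right integral_mult_right_zero)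
    finally show ?thesis .
  qed
  then have "(\<lambda>k. LINT x|lebesgue_Rn 4. weight k * mode k x * (a * \<phi> x + b * \<psi> x)) sums
      (a * solution \<phi> + b * solution \<psi>)"
    unfolding solution_def using s(2,4)
    by (simp only: sums_add sums_mult summable_sums)
  then show "solution (\<lambda>x. a * \<phi> x + b * \<psi> x) = a * solution \<phi> + b * solution \<psi>"
    unfolding solution_def[of "\<lambda>x. a * \<phi> x + b * \<psi> x"] by (rule sums_unique[symmetric])
next
  fix K assume K: "compactin (Rn 4) K \<and> K \<subseteq> topspace (Rn 4)"
  obtain R where R: "R > 0" "K \<subseteq> cube 4 R" using compactin_subset_cube K by metis
  \<comment> \<open>For \<open>K = {}\<close> the supremum over \<open>K\<close> has no specified
    value; the constant 0 works since the only admissible \<phi> is then 0.\<close>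
  define C where "C = (if K = {} then 0 else (\<Sum>k. majorant R k) * (2 * R) ^ 4)"
  have "norm (solution \<phi>) \<le> C * (\<Sum>is\<in>{is. set is \<subseteq> {..<4} \<and> length is \<le> 0}. SUP x\<in>K. norm (pds is \<phi> x))"
    if \<phi>: "\<phi> \<in> test_functions 4 (topspace (Rn 4))" and z: "\<forall>x. x \<notin> K \<longrightarrow> \<phi> x = 0" for \<phi>
  proof -
    have c: "continuous_map (Rn 4) euclidean \<phi>" using test_functionsD(1)[OF \<phi>, of "[]"] by simp
    obtain B where B: "\<And>x. x \<in> cube 4 R \<Longrightarrow> norm (\<phi> x) \<le> B"
      by (rule continuous_map_bounded_on_cube[OF c, of R]) (rule that)
    define S where "S = (SUP x\<in>K. norm (\<phi> x))"
    have leS: "norm (\<phi> x) \<le> S" if "x \<in> K" for x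
      unfolding S_def using that B R(2) by (intro cSUP_upper) (auto simp: bdd_above_def)
    have S: "norm (solution \<phi>) \<le> C * S"
    proof (cases "K = {}")
      case True
      then have "\<phi> x = 0" for x using z by auto
      then show ?thesis using True by (simp add: solution_def C_def)
    next
      case False
      then have "S \<ge> 0" using leS norm_ge_zero order_trans by blast
      then have le: "norm (\<phi> x) \<le> S" for x using leS z by (cases "x \<in> K") auto
      have zero: "\<phi> x = 0" if "x \<in> extensional {..<4}" "x \<notin> cube 4 R" for x
        using z R(2) that by blast
      note mi = mode_integral[OF borel_measurable_continuous_Rn[OF c] less_imp_le[OF R(1)] le zero]
      have "norm (solution \<phi>) \<le> (\<Sum>k. majorant R k * S * (2 * R) ^ 4)"
        unfolding solution_def
        by (intro norm_suminf_le mi(2) summable_mult2 summable_majorant)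
      also have "\<dots> = (\<Sum>k. majorant R k) * S * (2 * R) ^ 4"
        using summable_majorant[of R] by (simp only: suminf_mult2 summable_mult2)
      also have "\<dots> = C * S" using False by (simp add: C_def)
      finally show ?thesis .
    qed
    have "{is. set is \<subseteq> {..<4 :: nat} \<and> length is \<le> 0} = {[]}" by auto
    then show ?thesis using S by (simp add: S_def)
  qed
  then show "\<exists>C k. \<forall>\<phi>\<in>test_functions 4 (topspace (Rn 4)). (\<forall>x. x \<notin> K \<longrightarrow> \<phi> x = 0) \<longrightarrow>
      norm (solution \<phi>) \<le> C * (\<Sum>is\<in>{is. set is \<subseteq> {..<4} \<and> length is \<le> k}. SUP x\<in>K. norm (pds is \<phi> x))"
    by blast
qed

end

section \<open>The null solution is not analytic\<close>

lemma tensor_upd_mult: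
  assumes "m < n"
  shows "tensor n (h(m := \<lambda>t. q t * h m t)) x = q (x m) * tensor n h x"
proof -
  have "(\<Prod>i<n. (h(m := \<lambda>t. q t * h m t)) i (x i)) = q (x m) * h m (x m) * (\<Prod>i\<in>{..<n} - {m}. (h(m := \<lambda>t. q t * h m t)) i (x i))"
    using assms by (subst prod.remove[of _ m]) auto
  also have "(\<Prod>i\<in>{..<n} - {m}. (h(m := \<lambda>t. q t * h m t)) i (x i)) = (\<Prod>i\<in>{..<n} - {m}. h i (x i))"
    by (rule prod.cong) auto
  also have "q (x m) * h m (x m) * (\<Prod>i\<in>{..<n} - {m}. h i (x i)) = q (x m) * (\<Prod>i<n. h i (x i))"
    using assms prod.remove[of "{..<n}" m "\<lambda>i. h i (x i)"] by simp
  finally show ?thesis by (simp add: tensor_def del: fun_upd_apply)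
qed

section \<open>Real analytic functions: continuity and restriction to an axis\<close>

lemma eventually_atin_Rn:
  assumes x: "x \<in> extensional {..<n}" and d: "\<delta> > 0"
  shows "\<forall>\<^sub>F y in atin (Rn n) x. y \<in> extensional {..<n} \<and> (\<forall>i<n. \<bar>y i - x i\<bar> < \<delta>)"
proof -
  have "openin (Rn n) (PiE {..<n} (\<lambda>i. ball (x i) \<delta>))" by (simp add: openin_PiE)
  moreover have "x \<in> PiE {..<n} (\<lambda>i. ball (x i) \<delta>)" using x d by (auto simp: PiE_def)
  ultimately show ?thesis
    unfolding eventually_atin
    by (intro disjI2 exI[of _ "PiE {..<n} (\<lambda>i. ball (x i) \<delta>)"])
       (auto simp: PiE_def Pi_def dist_real_def abs_minus_commute)
qed

text \<open>
  If the power series at \<open>a\<close> converges absolutely at distance \<open>s\<close>, then moving by at most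
  \<open>\<theta> s\<close> in each coordinate changes the sum by at most \<open>\<theta>\<close> times the sum of the absolute values.
\<close>
lemma real_analytic_continuous:
  fixes f :: "point \<Rightarrow> complex"
  assumes f: "real_analytic n (topspace (Rn n)) f"
  shows "continuous_map (Rn n) euclidean f"
  unfolding continuous_map_euclidean_iff
proof
  fix a assume "a \<in> topspace (Rn n)"
  then have a: "a \<in> extensional {..<n}" by simp
  let ?A = "PiE {..<n} (\<lambda>_. UNIV :: nat set)"
  obtain r c where r: "r > 0" and sum: "\<And>x. x \<in> extensional {..<n} \<Longrightarrow> (\<forall>i<n. \<bar>x i - a i\<bar> < r) \<Longrightarrow>
      ((\<lambda>\<alpha>. (\<Prod>i<n. (x i - a i) ^ \<alpha> i) *\<^sub>R c \<alpha>) has_sum f x) ?A"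
    using f a unfolding real_analytic_def topspace_Rn by blast
  define s where "s = r / 2"
  have s: "s > 0" "s < r" using r by (auto simp: s_def)
  define h where "h \<alpha> = (\<Prod>i<n. s ^ \<alpha> i) * norm (c \<alpha>)" for \<alpha>
  have hs: "h summable_on ?A"
  proof -
    \<comment> \<open>Evaluation at the corner \<open>a i + s\<close> makes all powers positive, and
      unconditional summability of complex numbers is absolute.\<close>
    have "((\<lambda>\<alpha>. (\<Prod>i<n. ((\<lambda>i\<in>{..<n}. a i + s) i - a i) ^ \<alpha> i) *\<^sub>R c \<alpha>) has_sum f (\<lambda>i\<in>{..<n}. a i + s)) ?A"
      by (rule sum[OF restrict_extensional]) (use s in auto)
    moreover have "(\<Prod>i<n. ((\<lambda>i\<in>{..<n}. a i + s) i - a i) ^ \<alpha> i) = (\<Prod>i<n. s ^ \<alpha> i)" for \<alpha> :: "nat \<Rightarrow> nat"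
      by (rule prod.cong) auto
    ultimately have "(\<lambda>\<alpha>. (\<Prod>i<n. s ^ \<alpha> i) *\<^sub>R c \<alpha>) summable_on ?A"
      unfolding summable_on_def by (intro exI) (simp only:)
    then have "(\<lambda>\<alpha>. norm ((\<Prod>i<n. s ^ \<alpha> i) *\<^sub>R c \<alpha>)) summable_on ?A"
      by (simp only: summable_on_iff_abs_summable_on_complex)
    moreover have "norm ((\<Prod>i<n. s ^ \<alpha> i) *\<^sub>R c \<alpha>) = h \<alpha>" for \<alpha>
      using s(1) by (simp add: h_def abs_prod prod_nonneg)
    ultimately show ?thesis by simp
  qed
  define S where "S = infsum h ?A"
  have h0: "h \<alpha> \<ge> 0" for \<alpha>
    unfolding h_def using less_imp_le[OF s(1)]
    by (intro mult_nonneg_nonneg prod_nonneg ballI zero_le_power norm_ge_zero)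
  have S: "S \<ge> 0" unfolding S_def by (intro infsum_nonneg h0)
  have fa: "((\<lambda>\<alpha>. (\<Prod>i<n. (a i - a i) ^ \<alpha> i) *\<^sub>R c \<alpha>) has_sum f a) ?A"
    by (rule sum) (use a r in auto)
  have close: "norm (f y - f a) \<le> \<theta> * S"
    if y: "y \<in> extensional {..<n}" "\<forall>i<n. \<bar>y i - a i\<bar> < \<theta> * s" and t: "0 < \<theta>" "\<theta> \<le> 1" for y \<theta>
  proof -
    have ts: "\<theta> * s \<le> s" using s t mult_right_mono[of \<theta> 1 s] by simp
    have "\<forall>i<n. \<bar>y i - a i\<bar> < r"
    proof (intro allI impI)
      show "\<bar>y i - a i\<bar> < r" if "i < n" for i using y(2)[rule_format, OF that] s ts by linarith
    qed
    then have fy: "((\<lambda>\<alpha>. (\<Prod>i<n. (y i - a i) ^ \<alpha> i) *\<^sub>R c \<alpha>) has_sum f y) ?A"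
      by (rule sum[OF y(1)])
    have "((\<lambda>\<alpha>. - ((\<Prod>i<n. (a i - a i) ^ \<alpha> i) *\<^sub>R c \<alpha>)) has_sum - f a) ?A"
      by (rule has_sum_uminusI[OF fa])
    from has_sum_add[OF fy this]
    have d: "((\<lambda>\<alpha>. (\<Prod>i<n. (y i - a i) ^ \<alpha> i) *\<^sub>R c \<alpha> - (\<Prod>i<n. (a i - a i) ^ \<alpha> i) *\<^sub>R c \<alpha>) has_sum f y - f a) ?A"
      (is "(?d has_sum _) _")
      by (simp only: diff_conv_add_uminus)
    have le: "norm (?d \<alpha>) \<le> \<theta> * h \<alpha>" for \<alpha>
    proof (cases "\<forall>i<n. \<alpha> i = 0")
      case True
      then have "?d \<alpha> = 0" by simp
      then show ?thesis using h0[of \<alpha>] t(1) by (simp only: norm_zero) simp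
    next
      case False
      then obtain j where j: "j < n" "\<alpha> j \<noteq> 0" by blast
      then have z: "(\<Prod>i<n. (a i - a i) ^ \<alpha> i) = 0" by (intro prod_zero) (auto intro!: bexI[of _ j])
      have "norm (?d \<alpha>) = (\<Prod>i<n. \<bar>y i - a i\<bar> ^ \<alpha> i) * norm (c \<alpha>)"
        unfolding z by (simp add: abs_prod power_abs)
      also have "\<dots> \<le> (\<Prod>i<n. (\<theta> * s) ^ \<alpha> i) * norm (c \<alpha>)"
        using y(2) by (intro mult_right_mono prod_mono conjI power_mono) (auto intro: less_imp_le)
      also have "(\<Prod>i<n. (\<theta> * s) ^ \<alpha> i) = (\<Prod>i<n. \<theta> ^ \<alpha> i) * (\<Prod>i<n. s ^ \<alpha> i)"
        by (simp add: power_mult_distrib prod.distrib)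
      also have "\<dots> * norm (c \<alpha>) \<le> \<theta> * (\<Prod>i<n. s ^ \<alpha> i) * norm (c \<alpha>)"
      proof (intro mult_right_mono)
        have "(\<Prod>i<n. \<theta> ^ \<alpha> i) = \<theta> ^ \<alpha> j * (\<Prod>i\<in>{..<n} - {j}. \<theta> ^ \<alpha> i)"
          using j by (subst prod.remove[of _ j]) auto
        also have "\<dots> \<le> \<theta> ^ 1 * 1"
          using t j by (intro mult_mono power_decreasing prod_le_1 prod_nonneg) (auto intro: power_le_one)
        finally show "(\<Prod>i<n. \<theta> ^ \<alpha> i) \<le> \<theta>" by simp
      qed (use s(1) in \<open>simp_all add: prod_nonneg\<close>)
      finally show ?thesis by (simp add: h_def mult.assoc)
    qed
    have ths: "(\<lambda>\<alpha>. \<theta> * h \<alpha>) summable_on ?A" by (intro summable_on_cmult_right hs)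
    have abs: "(\<lambda>\<alpha>. norm (?d \<alpha>)) summable_on ?A"
      by (rule Infinite_Sum.abs_summable_on_comparison_test'[OF ths]) (rule le)
    have "norm (f y - f a) \<le> infsum (\<lambda>\<alpha>. norm (?d \<alpha>)) ?A"
      by (rule norm_has_sum_bound[OF has_sum_infsum[OF abs] d])
    also have "\<dots> \<le> infsum (\<lambda>\<alpha>. \<theta> * h \<alpha>) ?A" by (rule infsum_mono[OF abs ths le])
    also have "\<dots> = \<theta> * S" unfolding S_def by (rule infsum_cmult_right) (rule hs)
    finally show ?thesis .
  qed
  show "(f \<longlongrightarrow> f a) (atin (Rn n) a)"
  proof (rule tendstoI)
    fix e :: real assume e: "e > 0"
    define \<theta> where "\<theta> = min 1 (e / 2 / (S + 1))"
    have t: "0 < \<theta>" "\<theta> \<le> 1" using e S by (auto simp: \<theta>_def)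
    have "\<theta> * S \<le> e / 2 / (S + 1) * (S + 1)" using e S t by (intro mult_mono) (auto simp: \<theta>_def)
    also have "\<dots> = e / 2" using S by (intro nonzero_eq_divide_eq[THEN iffD1]) auto
    also have "\<dots> < e" using e by simp
    finally have "\<theta> * S < e" .
    moreover have "\<theta> * s > 0" using t s by simp
    ultimately show "\<forall>\<^sub>F y in atin (Rn n) a. dist (f y) (f a) < e"
      using eventually_atin_Rn[OF a, of "\<theta> * s"] close[OF _ _ t]
      by (auto elim!: eventually_mono simp: dist_norm intro: le_less_trans)
  qed
qed

text \<open>On the axis every monomial containing another variable vanishes. Only the multi-indices
  concentrated at \<open>m\<close>, the range of \<open>\<iota>\<close>, survive and are reindexed
  by the natural numbers.\<close>

lemma real_analytic_on_line:
  fixes f :: "point \<Rightarrow> complex"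
  assumes f: "real_analytic n (topspace (Rn n)) f" and m: "m < n"
  obtains r a where "r > 0"
    "\<And>t. \<bar>t\<bar> < r \<Longrightarrow> (\<lambda>j. a j * of_real t ^ j) sums f (\<lambda>i\<in>{..<n}. if i = m then t else 0)"
proof -
  let ?A = "PiE {..<n} (\<lambda>_. UNIV :: nat set)" and ?x = "\<lambda>t :: real. \<lambda>i\<in>{..<n}. if i = m then t else 0"
  define x0 where "x0 = ?x 0"
  have "x0 \<in> extensional {..<n}" by (simp add: x0_def)
  then obtain r c where r: "r > 0" and sum: "\<And>x. x \<in> extensional {..<n} \<Longrightarrow> (\<forall>i<n. \<bar>x i - x0 i\<bar> < r) \<Longrightarrow>
      ((\<lambda>\<alpha>. (\<Prod>i<n. (x i - x0 i) ^ \<alpha> i) *\<^sub>R c \<alpha>) has_sum f x) ?A"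
    using f unfolding real_analytic_def topspace_Rn by blast
  define \<iota> where "\<iota> j = (\<lambda>i\<in>{..<n}. if i = m then j else 0)" for j :: nat
  have inj: "inj \<iota>"
    using m by (intro injI) (auto simp: \<iota>_def fun_eq_iff restrict_def split: if_splits)
  have "(\<lambda>j. c (\<iota> j) * of_real t ^ j) sums f (?x t)" if t: "\<bar>t\<bar> < r" for t
  proof -
    let ?g = "\<lambda>\<alpha>. (\<Prod>i<n. (?x t i - x0 i) ^ \<alpha> i) *\<^sub>R c \<alpha>"
    have "(?g has_sum f (?x t)) ?A" by (rule sum[OF restrict_extensional]) (use t r in \<open>auto simp: x0_def\<close>)
    also have "(?g has_sum f (?x t)) ?A \<longleftrightarrow> (?g has_sum f (?x t)) (range \<iota>)"
    proof (rule has_sum_cong_neutral)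
      fix \<alpha> assume \<alpha>: "\<alpha> \<in> ?A - range \<iota>"
      have "\<exists>i<n. i \<noteq> m \<and> \<alpha> i \<noteq> 0"
      proof (rule ccontr)
        assume "\<not> ?thesis"
        then have "\<alpha> = \<iota> (\<alpha> m)" using \<alpha> by (auto simp: \<iota>_def fun_eq_iff PiE_def extensional_def)
        with \<alpha> show False by blast
      qed
      then have "(\<Prod>i<n. (?x t i - x0 i) ^ \<alpha> i) = 0" by (auto intro!: prod_zero simp: x0_def)
      then show "?g \<alpha> = 0" by simp
    qed (auto simp: \<iota>_def)
    finally have "((?g \<circ> \<iota>) has_sum f (?x t)) UNIV" by (simp only: has_sum_reindex[OF inj])
    moreover have "?g \<circ> \<iota> = (\<lambda>j. c (\<iota> j) * of_real t ^ j)"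
    proof
      fix j
      have "(\<Prod>i<n. (?x t i - x0 i) ^ \<iota> j i) = (\<Prod>i<n. if i = m then t ^ j else 1)"
        by (rule prod.cong) (auto simp: \<iota>_def x0_def)
      also have "\<dots> = t ^ j" using m by simp
      finally have e: "(\<Prod>i<n. (?x t i - x0 i) ^ \<iota> j i) = t ^ j" .
      show "(?g \<circ> \<iota>) j = c (\<iota> j) * of_real t ^ j" unfolding o_def e by (simp add: scaleR_conv_of_real mult.commute)
    qed
    ultimately show ?thesis by (intro has_sum_imp_sums) (simp only:)
  qed
  with r show ?thesis by (rule that)
qed

lemma power_le_fact_exp: "x \<ge> 0 \<Longrightarrow> x ^ n \<le> fact n * exp (x :: real)"
proof -
  assume x: "x \<ge> 0"
  have "(\<Sum>k\<in>{n}. x ^ k /\<^sub>R fact k) \<le> (\<Sum>k. x ^ k /\<^sub>R fact k)"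
    using x by (intro sum_le_suminf summable_exp_generic) auto
  then show ?thesis by (simp add: exp_def field_simps)
qed

lemma cosh_ge_half_exp: "cosh x \<ge> exp x / (2 :: real)"
  by (simp add: cosh_def)

section \<open>The equation, checked mode by mode\<close>

context mode_family
begin

lemma pot_cont: "continuous_on UNIV (pot k i)"
  unfolding pot_def[abs_def]
  by (cases "i = 0"; cases "i = 1"; cases "i = 2"; simp; intro continuous_intros)

text \<open>The coefficient does not vary in the direction of differentiation, so it can be joined
  to the mode as the factor \<open>w\<close> of \<open>integral_by_parts_twice\<close>.
  Differentiating the mode twice in that direction multiplies it by \<open>pot\<close>.\<close>

lemma mode_integral_by_parts:
  assumes j: "j < 6" and \<phi>: "\<phi> \<in> test_functions 4 U"
  shows "integrable (lebesgue_Rn 4)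
      (\<lambda>x. (of_real (weight k * (x (field_src j) ^ field_exp j)\<^sup>2) * mode k x) * pds [field_dir j, field_dir j] \<phi> x)"
    "integrable (lebesgue_Rn 4)
      (\<lambda>x. (of_real (weight k * (x (field_src j) ^ field_exp j)\<^sup>2) * (of_real (pot k (field_dir j) (x (field_dir j))) * mode k x)) * \<phi> x)"
    "(LINT x|lebesgue_Rn 4. (of_real (weight k * (x (field_src j) ^ field_exp j)\<^sup>2) * mode k x) * pds [field_dir j, field_dir j] \<phi> x) =
     (LINT x|lebesgue_Rn 4. (of_real (weight k * (x (field_src j) ^ field_exp j)\<^sup>2) * (of_real (pot k (field_dir j) (x (field_dir j))) * mode k x)) * \<phi> x)"
proof -
  let ?m = "field_dir j"
  let ?a = "\<lambda>x. of_real (weight k * (x (field_src j) ^ field_exp j)\<^sup>2) :: complex"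
  note m = field_dir_less[OF j]
  obtain R where R: "R > 0" "\<And>is x. set is \<subseteq> {..<4} \<Longrightarrow> x \<in> extensional {..<4} \<Longrightarrow> x \<notin> cube 4 R \<Longrightarrow> pds is \<phi> x = 0"
    by (rule test_function_support[OF \<phi>]) (rule that)
  have ca: "continuous_map (Rn 4) euclidean ?a"
    by (rule continuous_map_component[OF field_src_less, of "\<lambda>t. of_real (weight k * (t ^ field_exp j)\<^sup>2)"])
       (intro continuous_intros)
  have cp: "continuous_map (Rn 4) euclidean (\<lambda>x. complex_of_real (pot k ?m (x ?m)))"
    by (rule continuous_map_component[OF m, of "\<lambda>t. complex_of_real (pot k ?m t)"])
       (intro continuous_intros pot_cont)
  show 1: "integrable (lebesgue_Rn 4) (\<lambda>x. (?a x * mode k x) * pds [?m, ?m] \<phi> x)"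
    using m R(1) R(2)[of "[?m, ?m]"]
    by (intro integrable_continuous_on_cube[where R = R] continuous_map_mult ca mode_cont test_functionsD(1)[OF \<phi>]) auto
  have c0: "continuous_map (Rn 4) euclidean \<phi>" using test_functionsD(1)[OF \<phi>, of "[]"] by simp
  show 2: "integrable (lebesgue_Rn 4) (\<lambda>x. (?a x * (of_real (pot k ?m (x ?m)) * mode k x)) * \<phi> x)"
    using R(1) R(2)[of "[]"]
    by (intro integrable_continuous_on_cube[where R = R] continuous_map_mult ca cp mode_cont c0) auto
  have aupd: "?a (x(?m := t)) = ?a x" for x :: point and t by (simp only: field_coeff_upd)
  show "(LINT x|lebesgue_Rn 4. (?a x * mode k x) * pds [?m, ?m] \<phi> x) =
     (LINT x|lebesgue_Rn 4. (?a x * (of_real (pot k ?m (x ?m)) * mode k x)) * \<phi> x)"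
  proof (rule integral_by_parts_twice[OF m 1 2, where R = R and \<phi>' = "pds [?m] \<phi>"
        and w' = "\<lambda>x. ?a x * tensor 4 ((fac k)(?m := fac' k ?m)) x"])
    fix x :: point and t assume x: "x \<in> extensional {..<4}"
    show "((\<lambda>t. ?a (x(?m := t)) * mode k (x(?m := t))) has_vector_derivative
        ?a (x(?m := t)) * tensor 4 ((fac k)(?m := fac' k ?m)) (x(?m := t))) (at t)"
      unfolding aupd mode_def
      by (intro has_vector_derivative_mult_right tensor_partial m fac_deriv)
    have "((\<lambda>t. tensor 4 ((fac k)(?m := fac' k ?m)) (x(?m := t))) has_vector_derivative
        tensor 4 ((fac k)(?m := fac' k ?m, ?m := \<lambda>t. of_real (pot k ?m t) * fac k ?m t)) (x(?m := t))) (at t)"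
      by (rule tensor_partial[OF m]) (simp add: fac'_deriv)
    then have "((\<lambda>t. tensor 4 ((fac k)(?m := fac' k ?m)) (x(?m := t))) has_vector_derivative
        of_real (pot k ?m ((x(?m := t)) ?m)) * mode k (x(?m := t))) (at t)"
      unfolding fun_upd_upd mode_def tensor_upd_mult[OF m, of "fac k" "\<lambda>t. of_real (pot k ?m t)"] .
    then show "((\<lambda>t. ?a (x(?m := t)) * tensor 4 ((fac k)(?m := fac' k ?m)) (x(?m := t))) has_vector_derivative
        ?a (x(?m := t)) * (of_real (pot k ?m ((x(?m := t)) ?m)) * mode k (x(?m := t)))) (at t)"
      unfolding aupd by (rule has_vector_derivative_mult_right)
    show "((\<lambda>t. \<phi> (x(?m := t))) has_vector_derivative pds [?m] \<phi> (x(?m := t))) (at t)"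
      using test_functionsD(2)[OF \<phi>, of "[]" x ?m t] x m by simp
    show "((\<lambda>t. pds [?m] \<phi> (x(?m := t))) has_vector_derivative pds [?m, ?m] \<phi> (x(?m := t))) (at t)"
      using test_functionsD(2)[OF \<phi>, of "[?m]" x ?m t] x m by simp
  next
    fix x :: point assume x: "x \<in> extensional {..<4}" and "\<bar>x ?m\<bar> > R"
    then have "x \<notin> cube 4 R" using m by (force simp: cube_def)
    then show "\<phi> x = 0 \<and> pds [?m] \<phi> x = 0" using R(2)[of "[]" x] R(2)[of "[?m]" x] x m by simp
  qed
qed

text \<open>This is the equation divided by the mode. The energies \<mu> and -\<mu> of the two
  oscillators cancel, the x_1 coefficients cancel the sextic potential, and what remains is x_0^2
  times the relation \<open>mu_eq\<close>.\<close>

lemma sum_pot_eq_0: "(\<Sum>j<6. (x (field_src j) ^ field_exp j)\<^sup>2 * pot k (field_dir j) (x (field_dir j))) = 0"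
proof -
  have "(\<Sum>j<6. (x (field_src j) ^ field_exp j)\<^sup>2 * pot k (field_dir j) (x (field_dir j))) =
      (x 0)\<^sup>2 * ((\<mu> k)\<^sup>2 + (\<kappa> k)\<^sup>2 - (\<rho> k)\<^sup>2)"
    by (simp add: eval_nat_numeral field_src_def field_exp_def field_dir_def pot_def algebra_simps)
  then show ?thesis by (simp add: mu_eq)
qed

lemma solution_homogeneous:
  assumes \<phi>: "\<phi> \<in> test_functions 4 U"
  shows "sum_of_squares 4 6 treves_field solution \<phi> = 0"
proof -
  have "(LINT x|lebesgue_Rn 4. weight k * mode k x *
      (\<Sum>j<6. field_transpose 4 (treves_field j) (field_transpose 4 (treves_field j) \<phi>) x)) = 0" for k
  proof -
    have "(LINT x|lebesgue_Rn 4. weight k * mode k x *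
      (\<Sum>j<6. field_transpose 4 (treves_field j) (field_transpose 4 (treves_field j) \<phi>) x)) =
      (LINT x|lebesgue_Rn 4. - (\<Sum>j<6. (of_real (weight k * (x (field_src j) ^ field_exp j)\<^sup>2) * mode k x) * pds [field_dir j, field_dir j] \<phi> x))"
    proof (rule Bochner_Integration.integral_cong[OF refl])
      fix x assume "x \<in> space (lebesgue_Rn 4)"
      then have x: "x \<in> extensional {..<4}" by simp
      have "(\<Sum>j<6. field_transpose 4 (treves_field j) (field_transpose 4 (treves_field j) \<phi>) x) =
        (\<Sum>j<6. - of_real ((x (field_src j) ^ field_exp j)\<^sup>2) * pds [field_dir j, field_dir j] \<phi> x)"
        by (rule sum.cong) (use field_transpose_treves_twice[OF _ \<phi> x] in auto)
      then show "weight k * mode k x *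
        (\<Sum>j<6. field_transpose 4 (treves_field j) (field_transpose 4 (treves_field j) \<phi>) x) =
        - (\<Sum>j<6. (of_real (weight k * (x (field_src j) ^ field_exp j)\<^sup>2) * mode k x) * pds [field_dir j, field_dir j] \<phi> x)"
        by (simp add: sum_distrib_left sum_negf mult_ac del: pds.simps)
    qed
    also have "\<dots> = - (\<Sum>j<6. LINT x|lebesgue_Rn 4. (of_real (weight k * (x (field_src j) ^ field_exp j)\<^sup>2) * mode k x) * pds [field_dir j, field_dir j] \<phi> x)"
      by (subst integral_minus, subst Bochner_Integration.integral_sum)
         (rule mode_integral_by_parts(1)[OF _ \<phi>], simp, rule refl)
    also have "\<dots> = - (\<Sum>j<6. LINT x|lebesgue_Rn 4. (of_real (weight k * (x (field_src j) ^ field_exp j)\<^sup>2) * (of_real (pot k (field_dir j) (x (field_dir j))) * mode k x)) * \<phi> x)"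
      by (intro arg_cong[of _ _ uminus] sum.cong refl mode_integral_by_parts(3)[OF _ \<phi>]) simp
    also have "\<dots> = - (LINT x|lebesgue_Rn 4. (\<Sum>j<6. (of_real (weight k * (x (field_src j) ^ field_exp j)\<^sup>2) * (of_real (pot k (field_dir j) (x (field_dir j))) * mode k x)) * \<phi> x))"
      by (subst Bochner_Integration.integral_sum)
         (rule mode_integral_by_parts(2)[OF _ \<phi>], simp, rule refl)
    also have "\<dots> = - (LINT x|lebesgue_Rn 4. 0)"
    proof (intro arg_cong[of _ _ uminus] Bochner_Integration.integral_cong refl)
      fix x :: point
      have "(\<Sum>j<6. (of_real (weight k * (x (field_src j) ^ field_exp j)\<^sup>2) * (of_real (pot k (field_dir j) (x (field_dir j))) * mode k x)) * \<phi> x)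
        = of_real (\<Sum>j<6. (x (field_src j) ^ field_exp j)\<^sup>2 * pot k (field_dir j) (x (field_dir j))) * (of_real (weight k) * mode k x * \<phi> x)"
        by (simp add: sum_distrib_left sum_distrib_right mult_ac)
      then show "(\<Sum>j<6. (of_real (weight k * (x (field_src j) ^ field_exp j)\<^sup>2) * (of_real (pot k (field_dir j) (x (field_dir j))) * mode k x)) * \<phi> x) = 0"
        by (simp only: sum_pot_eq_0 of_real_0 mult_zero_left)
    qed
    finally show ?thesis by simp
  qed
  then show ?thesis by (simp add: sum_of_squares_def solution_def)
qed

section \<open>The continuous density of the solution\<close>

definition total :: "point \<Rightarrow> complex" where
  "total x = (\<Sum>k. weight k * mode k x)"

lemma total_cont: "continuous_map (Rn 4) euclidean total"
  unfolding continuous_map_euclidean_iff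
proof
  fix x assume "x \<in> topspace (Rn 4)"
  then have x: "x \<in> extensional {..<4}" by simp
  \<comment> \<open>Tannery's theorem requires a nontrivial filter, hence the separate case in which
    convergence is vacuous.\<close>
  show "(total \<longlongrightarrow> total x) (atin (Rn 4) x)"
  proof (cases "atin (Rn 4) x = bot")
    case False
    define R where "R = 1 + (\<Sum>i<4. \<bar>x i\<bar>)"
    have "\<forall>\<^sub>F y in atin (Rn 4) x. y \<in> cube 4 R"
    proof (rule eventually_mono[OF eventually_atin_Rn[OF x, of 1]])
      fix y assume y: "y \<in> extensional {..<4} \<and> (\<forall>i<4. \<bar>y i - x i\<bar> < 1)"
      have "\<bar>x i\<bar> \<le> (\<Sum>i<4. \<bar>x i\<bar>)" if "i < 4" for i using that by (intro member_le_sum) auto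
      then have "\<bar>y i\<bar> \<le> R" if "i < 4" for i using y that unfolding R_def by (smt (verit))
      then show "y \<in> cube 4 R" using y by (auto simp: cube_def)
    qed simp
    then have "\<forall>\<^sub>F (k, y) in at_top \<times>\<^sub>F atin (Rn 4) x. norm (weight k * mode k y) \<le> majorant R k"
      unfolding eventually_prod_filter
      by (intro exI[of _ "\<lambda>_ :: nat. True"] exI[of _ "\<lambda>y. y \<in> cube 4 R"]) (auto intro: norm_mode_le)
    moreover have "((\<lambda>y. weight k * mode k y) \<longlongrightarrow> weight k * mode k x) (atin (Rn 4) x)" for k
      using mode_cont[of k] x unfolding continuous_map_euclidean_iff by (intro tendsto_mult tendsto_const) auto
    ultimately have "((\<lambda>y. \<Sum>k. weight k * mode k y) \<longlongrightarrow> (\<Sum>k. weight k * mode k x)) (atin (Rn 4) x)"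
      using tannerys_theorem[of "\<lambda>k y. weight k * mode k y" "\<lambda>k. weight k * mode k x" "atin (Rn 4) x" "majorant R"]
        summable_majorant False by blast
    then show ?thesis by (simp add: total_def[abs_def])
  qed simp
qed

lemma solution_eq_integral:
  assumes \<phi>: "\<phi> \<in> test_functions 4 U"
  shows "solution \<phi> = (LINT x|lebesgue_Rn 4. total x * \<phi> x)"
proof -
  obtain R B where b: "R > 0" "\<phi> \<in> borel_measurable (lebesgue_Rn 4)" "B \<ge> 0"
    "\<And>x. x \<in> cube 4 R \<Longrightarrow> norm (\<phi> x) \<le> B"
    "\<And>x. x \<in> extensional {..<4} \<Longrightarrow> x \<notin> cube 4 R \<Longrightarrow> \<phi> x = 0"
    by (rule test_function_bounds[OF \<phi>]) (rule that)
  note mi = mode_integral[OF b(2) less_imp_le[OF b(1)] b(4,5)]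
  have le: "norm (weight k * mode k x * \<phi> x) \<le> majorant R k * \<bar>B\<bar>" if "x \<in> extensional {..<4}" for k x
    by (rule mi(4)) (use that in auto)
  have nle: "(LINT x|lebesgue_Rn 4. norm (weight k * mode k x * \<phi> x)) \<le> majorant R k * B * (2 * R) ^ 4" for k
    by (rule mi(3)) auto
  have sum: "summable (\<lambda>k. norm (weight k * mode k x * \<phi> x))" if "x \<in> extensional {..<4}" for x
    by (rule summable_comparison_test'[OF summable_mult2[OF summable_majorant[of R], of "\<bar>B\<bar>"]])
       (use le[OF that] in simp)
  have "(LINT x|lebesgue_Rn 4. (\<Sum>k. weight k * mode k x * \<phi> x)) = solution \<phi>"
    unfolding solution_def
  proof (rule integral_suminf)
    show "integrable (lebesgue_Rn 4) (\<lambda>x. weight k * mode k x * \<phi> x)" for k by (rule mi(1))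
    show "AE x in lebesgue_Rn 4. summable (\<lambda>k. norm (weight k * mode k x * \<phi> x))"
      by (rule AE_I2) (simp add: sum)
    show "summable (\<lambda>k. LINT x|lebesgue_Rn 4. norm (weight k * mode k x * \<phi> x))"
      by (rule summable_comparison_test'[OF summable_mult2[OF summable_mult2[OF summable_majorant[of R], of B], of "(2 * R) ^ 4"]])
         (use nle in simp)
  qed
  moreover have "(\<Sum>k. weight k * mode k x * \<phi> x) = total x * \<phi> x" for x
  proof (cases "\<phi> x = 0")
    case False
    show ?thesis
    proof (cases "x \<in> extensional {..<4}")
      case True
      have "summable (\<lambda>k. weight k * mode k x * \<phi> x)" using sum[OF True] by (rule summable_norm_cancel)
      then have "summable (\<lambda>k. weight k * mode k x * \<phi> x * inverse (\<phi> x))" by (rule summable_mult2)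
      then have "summable (\<lambda>k. weight k * mode k x)" using \<open>\<phi> x \<noteq> 0\<close> by (simp add: mult.assoc)
      then show ?thesis unfolding total_def by (rule suminf_mult2[symmetric])
    next
      case False
      then show ?thesis by (simp add: total_def mode_def tensor_def)
    qed
  qed simp
  ultimately show ?thesis by simp
qed

section \<open>Derivatives along the last axis\<close>

lemma summable_weight_power: "summable (\<lambda>k. weight k * \<rho> k ^ n)"
proof (rule summable_comparison_test')
  show "summable (\<lambda>k. fact (2 * n) * majorant (1 / 2) k)" by (intro summable_mult summable_majorant)
  fix k
  \<comment> \<open>A power of \<rho> is at most twice that power of \<kappa>, hence at most a
    constant times exp \<kappa>, which turns the weight into
    \<open>majorant (1 / 2)\<close>.\<close>
  have "\<rho> k \<le> (\<kappa> k)\<^sup>2" using power_mono[OF sqrt_rho_le[of k], of 2] rho_pos[of k] by simp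
  then have "\<rho> k ^ n \<le> \<kappa> k ^ (2 * n)" using rho_pos[of k] by (simp add: power_mult power_mono)
  also have "\<dots> \<le> fact (2 * n) * exp (\<kappa> k)" using kappa_pos[of k] by (intro power_le_fact_exp) simp
  finally have "weight k * \<rho> k ^ n \<le> weight k * (fact (2 * n) * exp (\<kappa> k))"
    using weight_pos[of k] by (intro mult_left_mono) auto
  also have "\<dots> = fact (2 * n) * majorant (1 / 2) k"
    by (simp add: weight_def majorant_def algebra_simps flip: exp_add)
  finally show "norm (weight k * \<rho> k ^ n) \<le> fact (2 * n) * majorant (1 / 2) k"
    using weight_pos[of k] rho_pos[of k] by simp
qed

text \<open>The n-th derivative of the real part of the density along the last axis: each
  differentiation multiplies a term by its frequency and advances its phase by a quarter
  period.\<close>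

definition trace_deriv :: "nat \<Rightarrow> real \<Rightarrow> real" where
  "trace_deriv n t = (\<Sum>k. weight k * \<rho> k ^ n * cos (\<rho> k * t + n * pi / 2))"

lemma trace_deriv_summable: "summable (\<lambda>k. weight k * \<rho> k ^ n * cos (\<rho> k * t + n * pi / 2))"
proof (rule summable_comparison_test'[OF summable_weight_power[of n]])
  show "norm (weight k * \<rho> k ^ n * cos (\<rho> k * t + n * pi / 2)) \<le> weight k * \<rho> k ^ n" for k
    using weight_pos[of k] rho_pos[of k] abs_cos_le_one[of "\<rho> k * t + n * pi / 2"]
    by (simp add: abs_mult mult_left_le)
qed

lemma trace_deriv_DERIV: "(trace_deriv n has_real_derivative trace_deriv (Suc n) t) (at t)"
proof -
  have "((\<lambda>t. \<Sum>k. weight k * \<rho> k ^ n * cos (\<rho> k * t + n * pi / 2)) has_field_derivative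
      (\<Sum>k. weight k * \<rho> k ^ Suc n * cos (\<rho> k * t + Suc n * pi / 2))) (at t)"
  proof (rule has_field_derivative_series'(2)[where S = UNIV and ?x0.0 = 0
        and f = "\<lambda>k t. weight k * \<rho> k ^ n * cos (\<rho> k * t + n * pi / 2)"
        and f' = "\<lambda>k t. weight k * \<rho> k ^ Suc n * cos (\<rho> k * t + Suc n * pi / 2)"])
    fix k and t :: real
    have "cos (\<rho> k * t + Suc n * pi / 2) = - sin (\<rho> k * t + n * pi / 2)"
      using cos_add[of "\<rho> k * t + n * pi / 2" "pi / 2"] by (simp add: field_simps)
    moreover have "((\<lambda>t. weight k * \<rho> k ^ n * cos (\<rho> k * t + n * pi / 2)) has_field_derivative
       weight k * \<rho> k ^ n * (- sin (\<rho> k * t + n * pi / 2) * \<rho> k)) (at t)"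
      by (auto intro!: derivative_eq_intros)
    ultimately show "((\<lambda>t. weight k * \<rho> k ^ n * cos (\<rho> k * t + n * pi / 2)) has_field_derivative
       weight k * \<rho> k ^ Suc n * cos (\<rho> k * t + Suc n * pi / 2)) (at t within UNIV)"
      by (simp add: mult_ac)
  next
    show "uniformly_convergent_on UNIV (\<lambda>N t. \<Sum>k<N. weight k * \<rho> k ^ Suc n * cos (\<rho> k * t + Suc n * pi / 2))"
    proof (rule Weierstrass_m_test'[OF _ summable_weight_power[of "Suc n"]])
      show "norm (weight k * \<rho> k ^ Suc n * cos (\<rho> k * t + Suc n * pi / 2)) \<le> weight k * \<rho> k ^ Suc n" for k t
        using weight_pos[of k] rho_pos[of k] abs_cos_le_one[of "\<rho> k * t + Suc n * pi / 2"]
        by (simp add: abs_mult mult_left_le)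
    qed
  qed (use trace_deriv_summable[of n 0] in auto)
  then show ?thesis by (simp add: trace_deriv_def[abs_def])
qed

text \<open>\<open>kappa_small\<close> divided by k + 1 bounds the exponent k \<kappa>. This is the
  sense in which the weights are exp (- o(\<rho>)): no fixed exponential rate in \<rho> is lost,
  which both the proof of non-analyticity and the one for the wave front set exploit.\<close>

lemma weight_ge: "weight k \<ge> exp (- \<rho> k / (real k + 1))"
proof -
  have "real k * \<kappa> k \<le> (real k + 1) * \<kappa> k" using kappa_pos[of k] by (intro mult_right_mono) auto
  also have "\<dots> \<le> \<rho> k / (real k + 1)"
    using kappa_small[of k] by (simp add: pos_le_divide_eq power2_eq_square mult_ac)
  finally show ?thesis by (simp add: weight_def)
qed

lemma rho_ge: "\<rho> k \<ge> real k + 1"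
proof -
  have "1 * \<kappa> k \<le> (real k + 1)\<^sup>2 * \<kappa> k" using kappa_pos[of k] by (intro mult_right_mono) auto
  then show ?thesis using kappa_small[of k] kappa_ge[of k] by linarith
qed

text \<open>
  All terms of an even derivative at 0 have the same sign, so each of them is bounded by the
  Taylor coefficient.  Summation over the even orders bounds \<open>weight k * cosh (s * \<rho> k)\<close> uniformly in \<open>k\<close>.
\<close>

lemma trace_not_analytic:
  fixes a :: "nat \<Rightarrow> real"
  assumes r: "r > 0" and a: "\<And>t. \<bar>t\<bar> < r \<Longrightarrow> (\<lambda>j. a j * t ^ j) sums trace_deriv 0 t"
  shows False
proof -
  \<comment> \<open>The termwise n-th derivative of the power series; its value at 0 identifies
    \<open>trace_deriv n 0\<close> with \<open>fact n * a n\<close>.\<close>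
  let ?P = "\<lambda>n t. \<Sum>j. (diffs ^^ n) a j * t ^ j"
  have P: "summable (\<lambda>j. (diffs ^^ n) a j * t ^ j)" if "\<bar>t\<bar> < r" for n t
    using that
  proof (induction n arbitrary: t)
    case 0
    then show ?case using a by (auto simp: sums_iff)
  next
    case (Suc n)
    show ?case using termdiff_converges[of t r "(diffs ^^ n) a"] Suc by simp
  qed
  have eq: "trace_deriv n t = ?P n t" if "\<bar>t\<bar> < r" for n t
    using that
  proof (induction n arbitrary: t)
    case 0
    then show ?case using a by (simp add: sums_iff)
  next
    case (Suc n)
    have "(?P n has_real_derivative (\<Sum>j. diffs ((diffs ^^ n) a) j * t ^ j)) (at t)"
      by (rule termdiffs_strong'[where K = r]) (use P Suc.prems in auto)
    moreover have "(?P n has_real_derivative trace_deriv (Suc n) t) (at t)"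
    proof (rule has_field_derivative_transform_within_open[OF trace_deriv_DERIV])
      show "open {-r<..<r}" "t \<in> {-r<..<r}" using Suc.prems by auto
      show "trace_deriv n s = ?P n s" if "s \<in> {-r<..<r}" for s using that Suc.IH[of s] by auto
    qed
    ultimately show ?case by (simp add: DERIV_unique)
  qed
  have df: "(diffs ^^ n) a j = (fact (n + j) / fact j) * a (n + j)" for n j
  proof (induction n arbitrary: j)
    case (Suc n)
    have "(diffs ^^ Suc n) a j = real (Suc j) * (diffs ^^ n) a (Suc j)" by (simp add: diffs_def)
    also have "\<dots> = real (Suc j) * (fact (n + Suc j) / fact (Suc j) * a (n + Suc j))" by (simp only: Suc.IH)
    also have "\<dots> = fact (Suc n + j) / fact j * a (Suc n + j)"
      by (simp only: fact_Suc[of j] of_nat_mult add_Suc_right add_Suc) simp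
    finally show ?case .
  qed simp
  have D0: "trace_deriv n 0 = fact n * a n" for n
  proof -
    have "trace_deriv n 0 = (diffs ^^ n) a 0"
      using eq[of 0 n] r by (simp only: powser_zero abs_zero)
    then show ?thesis by (simp add: df)
  qed
  have low: "weight k * \<rho> k ^ n \<le> fact n * \<bar>a n\<bar>" if "even n" for k n
  proof -
    obtain m where m: "n = 2 * m" using \<open>even n\<close> by (auto elim: evenE)
    have "weight k * \<rho> k ^ n = (\<Sum>k\<in>{k}. weight k * \<rho> k ^ n)" by simp
    also have "\<dots> \<le> (\<Sum>k. weight k * \<rho> k ^ n)"
      using weight_pos rho_pos by (intro sum_le_suminf summable_weight_power) (auto intro: less_imp_le)
    also have "\<dots> = \<bar>trace_deriv n 0\<bar>"
    proof -
      have "trace_deriv n 0 = (\<Sum>k. weight k * \<rho> k ^ n * (-1) ^ m)"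
        by (simp add: trace_deriv_def m)
      also have "\<dots> = (\<Sum>k. weight k * \<rho> k ^ n) * (-1) ^ m"
        by (rule suminf_mult2[symmetric, OF summable_weight_power])
      finally have "\<bar>trace_deriv n 0\<bar> = \<bar>\<Sum>k. weight k * \<rho> k ^ n\<bar>" by (simp add: abs_mult power_abs)
      moreover have "(\<Sum>k. weight k * \<rho> k ^ n) \<ge> 0"
        using weight_pos rho_pos by (intro suminf_nonneg summable_weight_power) (auto intro: less_imp_le)
      ultimately show ?thesis by simp
    qed
    finally show ?thesis by (simp add: D0 abs_mult)
  qed
  define s where "s = r / 2"
  have s: "s > 0" "\<bar>s\<bar> < r" using r by (auto simp: s_def)
  have sabs: "summable (\<lambda>n. \<bar>a n\<bar> * s ^ n)"
  proof -
    have "summable (\<lambda>n. norm (a n * s ^ n))"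
    proof (rule powser_insidea[where x = "3 * r / 4"])
      show "summable (\<lambda>n. a n * (3 * r / 4) ^ n)" using P[of "3 * r / 4" 0] r by simp
    qed (use r in \<open>simp add: s_def\<close>)
    then show ?thesis using s by (simp add: abs_mult power_abs)
  qed
  define C where "C = (\<Sum>n. \<bar>a n\<bar> * s ^ n)"
  have bound: "weight k * cosh (s * \<rho> k) \<le> C" for k
  proof -
    have c: "(\<lambda>n. weight k * (if even n then (s * \<rho> k) ^ n /\<^sub>R fact n else 0)) sums (weight k * cosh (s * \<rho> k))"
      by (intro sums_mult cosh_converges)
    have "weight k * (if even n then (s * \<rho> k) ^ n /\<^sub>R fact n else 0) \<le> \<bar>a n\<bar> * s ^ n" for n
    proof (cases "even n")
      case True
      have "weight k * ((s * \<rho> k) ^ n / fact n) = (weight k * \<rho> k ^ n) * (s ^ n / fact n)"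
        by (simp add: power_mult_distrib)
      also have "\<dots> \<le> (fact n * \<bar>a n\<bar>) * (s ^ n / fact n)"
        using low[OF True, of k] s by (intro mult_right_mono) auto
      also have "\<dots> = \<bar>a n\<bar> * s ^ n" by simp
      finally show ?thesis using True by (simp add: divide_inverse mult.commute)
    next
      case False
      then show ?thesis using s by simp
    qed
    then show ?thesis
      using suminf_le[OF _ sums_summable[OF c] sabs] sums_unique[OF c] by (simp add: C_def)
  qed
  \<comment> \<open>With 1 / (N + 1) at most s / 2, the loss from \<open>weight_ge\<close> is at
    most half of the exponent \<open>s * \<rho> N\<close>, and the other half exceeds the logarithm
    of the supposed bound.\<close>
  obtain N :: nat where N: "real N > max (2 / s) (ln (2 * (\<bar>C\<bar> + 1)) * 2 / s)" using reals_Archimedean2 by blast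
  have N1: "1 / (real N + 1) \<le> s / 2"
  proof -
    have "2 / s < real N + 1" using N by simp
    then show ?thesis using s by (simp add: field_simps)
  qed
  define q where "q = \<rho> N / (real N + 1)"
  have "q \<le> s / 2 * \<rho> N"
    using mult_right_mono[OF N1, of "\<rho> N"] rho_pos[of N] by (simp add: q_def)
  moreover have "s * \<rho> N = 2 * (s / 2 * \<rho> N)" by simp
  ultimately have "s / 2 * \<rho> N \<le> s * \<rho> N - \<rho> N / (real N + 1)" unfolding q_def[symmetric] by linarith
  moreover have "ln (2 * (\<bar>C\<bar> + 1)) < s / 2 * \<rho> N"
  proof -
    have "ln (2 * (\<bar>C\<bar> + 1)) * 2 / s < \<rho> N" using N rho_ge[of N] by simp
    then show ?thesis using s by (simp add: field_simps)
  qed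
  ultimately have "ln (2 * (\<bar>C\<bar> + 1)) < s * \<rho> N - \<rho> N / (real N + 1)" by (rule less_le_trans[rotated])
  then have "exp (ln (2 * (\<bar>C\<bar> + 1))) < exp (s * \<rho> N - \<rho> N / (real N + 1))"
    by (simp only: exp_less_cancel_iff)
  also have "exp (s * \<rho> N - \<rho> N / (real N + 1)) = exp (- \<rho> N / (real N + 1)) * exp (s * \<rho> N)"
    by (simp flip: exp_add)
  finally have "2 * (\<bar>C\<bar> + 1) < exp (- \<rho> N / (real N + 1)) * exp (s * \<rho> N)" by simp
  also have "\<dots> \<le> weight N * exp (s * \<rho> N)" using weight_ge[of N] by (intro mult_right_mono) auto
  also have "\<dots> \<le> weight N * (2 * cosh (s * \<rho> N))"
    using weight_pos[of N] cosh_ge_half_exp[of "s * \<rho> N"] by (intro mult_left_mono) auto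
  also have "\<dots> \<le> 2 * C" using bound[of N] by simp
  finally show False by simp
qed

lemma g_0: "g k 0 = 1"
  using g_lower[of k 0] g_upper[of k 0] by simp

text \<open>By continuity an analytic density would agree with \<open>total\<close> at every point,
  so the restriction of \<open>total\<close> to the last axis would be a convergent power series
  near 0, with real part \<open>trace_deriv 0\<close>.\<close>

lemma solution_not_analytic: "\<not> analytic_distribution 4 (topspace (Rn 4)) solution"
proof
  assume "analytic_distribution 4 (topspace (Rn 4)) solution"
  then obtain f where f: "real_analytic 4 (topspace (Rn 4)) f"
    and eq: "\<And>\<phi>. \<phi> \<in> test_functions 4 (topspace (Rn 4)) \<Longrightarrow> solution \<phi> = (LINT x|lebesgue_Rn 4. f x * \<phi> x)"
    unfolding analytic_distribution_def by blast
  have fc: "continuous_map (Rn 4) euclidean f" by (rule real_analytic_continuous[OF f])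
  have feq: "f x = total x" if x: "x \<in> extensional {..<4}" for x
  proof -
    have "(\<lambda>x. f x + (-1) * total x) x = 0"
    proof (rule continuous_eq_0_if_orthogonal[OF _ x])
      show "continuous_map (Rn 4) euclidean (\<lambda>x. f x + (-1) * total x)"
        using fc total_cont unfolding continuous_map_euclidean_iff by (auto intro!: tendsto_intros)
      fix \<phi> assume \<phi>: "\<phi> \<in> test_functions 4 (topspace (Rn 4))"
      obtain R where R: "R > 0" "\<And>is x. set is \<subseteq> {..<4} \<Longrightarrow> x \<in> extensional {..<4} \<Longrightarrow> x \<notin> cube 4 R \<Longrightarrow> pds is \<phi> x = 0"
        by (rule test_function_support[OF \<phi>]) (rule that)
      have c: "continuous_map (Rn 4) euclidean \<phi>" using test_functionsD(1)[OF \<phi>, of "[]"] by simp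
      have "integrable (lebesgue_Rn 4) (\<lambda>x. f x * \<phi> x)" "integrable (lebesgue_Rn 4) (\<lambda>x. total x * \<phi> x)"
        using R(1) R(2)[of "[]"]
        by (auto intro!: integrable_continuous_on_cube[where R = R] continuous_map_mult fc total_cont c)
      then show "(LINT x|lebesgue_Rn 4. (f x + (-1) * total x) * \<phi> x) = 0"
        using eq[OF \<phi>] solution_eq_integral[OF \<phi>] by (simp add: ring_distribs)
    qed
    then show ?thesis by simp
  qed
  obtain r a where r: "r > 0"
    and a: "\<And>t. \<bar>t\<bar> < r \<Longrightarrow> (\<lambda>j. a j * of_real t ^ j) sums f (\<lambda>i\<in>{..<4}. if i = 3 then t else 0)"
    by (rule real_analytic_on_line[OF f, of 3]) (simp, rule that)
  \<comment> \<open>On this axis the other three factors are 1, for x_1 by \<open>g_0\<close>, so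
    each mode is a pure oscillation.\<close>
  have Re_total: "Re (total (\<lambda>i\<in>{..<4}. if i = 3 then t else 0)) = trace_deriv 0 t" for t
  proof -
    let ?x = "\<lambda>i\<in>{..<4 :: nat}. if i = 3 then t else 0"
    have "mode k ?x = cis (\<rho> k * t)" for k
      by (simp add: mode_def tensor_def eval_nat_numeral fac_def g_0)
    then have "total ?x = (\<Sum>k. of_real (weight k) * cis (\<rho> k * t))" by (simp add: total_def)
    moreover have "summable (\<lambda>k. of_real (weight k) * cis (\<rho> k * t))"
      by (rule summable_comparison_test'[OF summable_weight_power[of 0]])
         (use weight_pos in \<open>simp add: norm_mult less_imp_le\<close>)
    ultimately show ?thesis by (simp add: Re_suminf trace_deriv_def)
  qed
  show False
  proof (rule trace_not_analytic[OF r])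
    fix t :: real assume t: "\<bar>t\<bar> < r"
    have "(\<lambda>j. Re (a j * of_real t ^ j)) sums Re (f (\<lambda>i\<in>{..<4}. if i = 3 then t else 0))"
      by (rule sums_Re[OF a[OF t]])
    then show "(\<lambda>j. Re (a j) * t ^ j) sums trace_deriv 0 t"
      using feq by (simp add: Re_total flip: of_real_power)
  qed
qed

end

section \<open>The analytic wave front set of the null solution\<close>

lemma gaussian_integral:
  assumes r: "r > 0"
  shows "integrable lborel (\<lambda>t. exp (- r * t\<^sup>2 / 2))"
    "(LINT t|lborel. exp (- r * t\<^sup>2 / 2)) = sqrt (2 * pi / r)"
proof -
  have d: "normal_density 0 (1 / sqrt r) t = sqrt (r / (2 * pi)) * exp (- r * t\<^sup>2 / 2)" for t
    using r by (simp add: normal_density_def power_divide real_sqrt_divide mult.commute)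
  have pos: "sqrt (r / (2 * pi)) > 0" using r by simp
  have eq: "normal_density 0 (1 / sqrt r) = (\<lambda>t. sqrt (r / (2 * pi)) * exp (- r * t\<^sup>2 / 2))"
    by (rule ext) (rule d)
  have "integrable lborel (normal_density 0 (1 / sqrt r))"
    by (rule integrable_normal_density) (use r in simp)
  then have "integrable lborel (\<lambda>t. sqrt (r / (2 * pi)) * exp (- r * t\<^sup>2 / 2))"
    by (simp only: eq)
  then have "integrable lborel (\<lambda>t. (1 / sqrt (r / (2 * pi))) * (sqrt (r / (2 * pi)) * exp (- r * t\<^sup>2 / 2)))"
    by (rule integrable_mult_right)
  moreover have "(1 / c) * (c * e) = e" if "c > 0" for c e :: real using that by simp
  ultimately show "integrable lborel (\<lambda>t. exp (- r * t\<^sup>2 / 2))"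
    using pos by (simp only:)
  have "sqrt (r / (2 * pi)) * (LINT t|lborel. exp (- r * t\<^sup>2 / 2)) = 1"
    using integral_normal_density[of "1 / sqrt r" 0] r by (simp add: d)
  moreover have "sqrt (r / (2 * pi)) * sqrt (2 * pi / r) = 1"
    using r by (simp flip: real_sqrt_mult)
  ultimately show "(LINT t|lborel. exp (- r * t\<^sup>2 / 2)) = sqrt (2 * pi / r)"
    using pos by (metis mult_cancel_left less_irrefl)
qed

text \<open>This is the characteristic function of the standard normal distribution after the
  substitution of sqrt r t for the variable.\<close>

lemma gaussian_fourier:
  assumes r: "r > 0"
  shows "(LINT t|lborel. of_real (exp (- r * t\<^sup>2 / 2)) * cis (a * t)) = of_real (sqrt (2 * pi / r) * exp (- a\<^sup>2 / (2 * r)))"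
proof -
  define s where "s = a / sqrt r"
  have "of_real (exp (- s\<^sup>2 / 2)) = (LINT t|std_normal_distribution. iexp (s * t))"
    using fun_cong[OF char_std_normal_distribution, of s] by (simp add: char_def)
  also have "\<dots> = (LINT t|lborel. std_normal_density t *\<^sub>R iexp (s * t))"
    by (subst integral_density) (auto simp: normal_density_nonneg)
  also have "\<dots> = \<bar>sqrt r\<bar> *\<^sub>R (LINT t|lborel. std_normal_density (0 + sqrt r * t) *\<^sub>R iexp (s * (0 + sqrt r * t)))"
    using r by (intro lborel_integral_real_affine) simp
  also have "(\<lambda>t. std_normal_density (0 + sqrt r * t) *\<^sub>R iexp (s * (0 + sqrt r * t))) =
      (\<lambda>t. of_real (1 / sqrt (2 * pi)) * (of_real (exp (- r * t\<^sup>2 / 2)) * cis (a * t)))"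
  proof
    fix t
    have "s * (0 + sqrt r * t) = a * t" using r by (simp add: s_def)
    moreover have "std_normal_density (0 + sqrt r * t) = 1 / sqrt (2 * pi) * exp (- r * t\<^sup>2 / 2)"
      using r by (simp add: std_normal_density_def power_mult_distrib)
    ultimately show "std_normal_density (0 + sqrt r * t) *\<^sub>R iexp (s * (0 + sqrt r * t)) =
      of_real (1 / sqrt (2 * pi)) * (of_real (exp (- r * t\<^sup>2 / 2)) * cis (a * t))"
      by (simp only: scaleR_conv_of_real of_real_mult cis_conv_exp mult.assoc)
  qed
  finally have e: "of_real (exp (- s\<^sup>2 / 2)) =
      of_real (sqrt r / sqrt (2 * pi)) * (LINT t|lborel. of_real (exp (- r * t\<^sup>2 / 2)) * cis (a * t))"
    using r by (simp add: scaleR_conv_of_real)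
  have "sqrt (2 * pi / r) * (sqrt r / sqrt (2 * pi)) = 1" using r by (simp add: real_sqrt_divide)
  then have "(LINT t|lborel. of_real (exp (- r * t\<^sup>2 / 2)) * cis (a * t)) =
      of_real (sqrt (2 * pi / r)) * (of_real (sqrt r / sqrt (2 * pi)) * (LINT t|lborel. of_real (exp (- r * t\<^sup>2 / 2)) * cis (a * t)))"
    by (simp only: mult.assoc[symmetric] of_real_mult[symmetric] of_real_1 mult_1_left)
  also have "\<dots> = of_real (sqrt (2 * pi / r) * exp (- s\<^sup>2 / 2))" unfolding e[symmetric] by simp
  also have "s\<^sup>2 = a\<^sup>2 / r" using r by (simp add: s_def power_divide)
  finally show ?thesis by (simp add: divide_divide_eq_left mult.commute)
qed

text \<open>The truncated integral is the full Fourier integral minus the tail. In the tail, half of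
  the Gaussian exponent is replaced by its value at \<open>\<delta>\<close> and the other half is
  integrated.\<close>

lemma truncated_gaussian_fourier_le:
  assumes r: "r \<ge> 1" and d: "\<delta> > 0"
  shows "norm (LINT t|lborel. indicator {-\<delta>..\<delta>} t *\<^sub>R (of_real (exp (- r * t\<^sup>2 / 2)) * cis (a * t)))
    \<le> 4 * exp (- a\<^sup>2 / (2 * r)) + 4 * exp (- r * \<delta>\<^sup>2 / 4)"
proof -
  let ?f = "\<lambda>t. complex_of_real (exp (- r * t\<^sup>2 / 2)) * cis (a * t)"
  have r0: "r > 0" using r by simp
  have meas: "?f \<in> borel_measurable lborel"
    by (simp add: cis_conv_exp)
  have int: "integrable lborel ?f"
    by (rule Bochner_Integration.integrable_bound[OF gaussian_integral(1)[OF r0] meas]) (simp add: norm_mult)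
  have int1: "integrable lborel (\<lambda>t. indicator {-\<delta>..\<delta>} t *\<^sub>R ?f t)"
    by (intro integrable_mult_indicator int) simp
  have int2: "integrable lborel (\<lambda>t. indicator (- {-\<delta>..\<delta>}) t *\<^sub>R ?f t)"
    by (intro integrable_mult_indicator int) simp
  have "(LINT t|lborel. ?f t) = (LINT t|lborel. indicator {-\<delta>..\<delta>} t *\<^sub>R ?f t + indicator (- {-\<delta>..\<delta>}) t *\<^sub>R ?f t)"
    by (intro Bochner_Integration.integral_cong) (auto simp: indicator_def)
  also have "\<dots> = (LINT t|lborel. indicator {-\<delta>..\<delta>} t *\<^sub>R ?f t) + (LINT t|lborel. indicator (- {-\<delta>..\<delta>}) t *\<^sub>R ?f t)"
    by (rule Bochner_Integration.integral_add[OF int1 int2])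
  finally have split: "(LINT t|lborel. indicator {-\<delta>..\<delta>} t *\<^sub>R ?f t) =
      (LINT t|lborel. ?f t) - (LINT t|lborel. indicator (- {-\<delta>..\<delta>}) t *\<^sub>R ?f t)"
    by (simp only: eq_diff_eq)
  \<comment> \<open>Covers the Gaussian of parameter \<open>r\<close> and the one of parameter
    \<open>r / 2\<close> left over in the tail; the constant works because 4 pi < 16.\<close>
  have sq: "sqrt (2 * pi / s) \<le> 4" if "s \<ge> 1 / 2" for s
  proof -
    have "2 * pi / s \<le> 2 * pi / (1 / 2)" using that by (intro divide_left_mono) auto
    also have "\<dots> \<le> 4\<^sup>2" using pi_less_4 by simp
    finally show ?thesis by (rule real_le_lsqrt[rotated -1]) auto
  qed
  have "norm (LINT t|lborel. ?f t) \<le> 4 * exp (- a\<^sup>2 / (2 * r))"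
    unfolding gaussian_fourier[OF r0] using sq[of r] r
    by (simp add: abs_mult norm_mult)
  moreover have "norm (LINT t|lborel. indicator (- {-\<delta>..\<delta>}) t *\<^sub>R ?f t) \<le> 4 * exp (- r * \<delta>\<^sup>2 / 4)"
  proof -
    have r2: "r / 2 > 0" using r by simp
    have "norm (LINT t|lborel. indicator (- {-\<delta>..\<delta>}) t *\<^sub>R ?f t) \<le>
        (LINT t|lborel. norm (indicator (- {-\<delta>..\<delta>}) t *\<^sub>R ?f t))" by (rule integral_norm_bound)
    also have "\<dots> \<le> (LINT t|lborel. exp (- r * \<delta>\<^sup>2 / 4) * exp (- (r / 2) * t\<^sup>2 / 2))"
    proof (rule integral_mono)
      show "integrable lborel (\<lambda>t. norm (indicator (- {-\<delta>..\<delta>}) t *\<^sub>R ?f t))" by (intro integrable_norm int2)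
      show "integrable lborel (\<lambda>t. exp (- r * \<delta>\<^sup>2 / 4) * exp (- (r / 2) * t\<^sup>2 / 2))"
        by (intro integrable_mult_right gaussian_integral(1)[OF r2])
      fix t
      show "norm (indicator (- {-\<delta>..\<delta>}) t *\<^sub>R ?f t) \<le> exp (- r * \<delta>\<^sup>2 / 4) * exp (- (r / 2) * t\<^sup>2 / 2)"
      proof (cases "t \<in> {-\<delta>..\<delta>}")
        case False
        then have "\<delta> \<le> \<bar>t\<bar>" by auto
        then have "\<delta>\<^sup>2 \<le> t\<^sup>2" using d abs_le_square_iff[of \<delta> t] by simp
        then have "r * \<delta>\<^sup>2 \<le> r * t\<^sup>2" using r by (intro mult_left_mono) auto
        then have "exp (- r * t\<^sup>2 / 2) \<le> exp (- r * \<delta>\<^sup>2 / 4 + - (r / 2) * t\<^sup>2 / 2)" by simp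
        moreover have "norm (indicator (- {-\<delta>..\<delta>}) t *\<^sub>R ?f t) = exp (- r * t\<^sup>2 / 2)"
          using False by (simp add: norm_mult)
        ultimately show ?thesis by (simp only: exp_add)
      qed simp
    qed
    also have "\<dots> = exp (- r * \<delta>\<^sup>2 / 4) * sqrt (2 * pi / (r / 2))"
      using gaussian_integral(2)[OF r2] by simp
    also have "\<dots> \<le> exp (- r * \<delta>\<^sup>2 / 4) * 4" using sq[of "r / 2"] r by (intro mult_left_mono) auto
    finally show ?thesis by simp
  qed
  ultimately show ?thesis unfolding split by (intro order_trans[OF norm_triangle_ineq4] add_mono)
qed

section \<open>The FBI kernel at the singular codirection\<close>

definition codirection :: point where
  "codirection = (\<lambda>i\<in>{..<8}. if i = 7 then 1 else 0)"

text \<open>The one-variable factors of the FBI kernel at \<open>codirection\<close>. Since the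
  kernel contains p - y, the phase has a negative sign: at \<open>r = \<rho> N\<close> it cancels
  the oscillation of \<open>fac N 3\<close> and leaves a positive Gaussian.\<close>

definition kern :: "real \<Rightarrow> nat \<Rightarrow> real \<Rightarrow> complex" where
  "kern r i t = of_real (exp (- r * t\<^sup>2 / 2)) * (if i = 3 then cis (- (r * t)) else 1)"

lemma fbi_kernel_codirection: "fbi_kernel 4 codirection r y = (\<Prod>i<4. kern r i (y i))"
proof -
  have 1: "(\<Sum>k<4. (codirection k - y k)\<^sup>2) = (y 0)\<^sup>2 + (y 1)\<^sup>2 + (y 2)\<^sup>2 + (y 3)\<^sup>2"
    by (simp add: codirection_def eval_nat_numeral)
  have 2: "(\<Sum>k<4. (codirection k - y k) * codirection (4 + k)) = - y 3"
    by (simp add: codirection_def eval_nat_numeral)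
  have "(\<Prod>i<4. kern r i (y i)) = of_real (exp (- r * (y 0)\<^sup>2 / 2) * exp (- r * (y 1)\<^sup>2 / 2) * exp (- r * (y 2)\<^sup>2 / 2) * exp (- r * (y 3)\<^sup>2 / 2)) * cis (- (r * y 3))"
    by (simp add: kern_def eval_nat_numeral)
  also have "exp (- r * (y 0)\<^sup>2 / 2) * exp (- r * (y 1)\<^sup>2 / 2) * exp (- r * (y 2)\<^sup>2 / 2) * exp (- r * (y 3)\<^sup>2 / 2)
     = exp (- (r / 2) * ((y 0)\<^sup>2 + (y 1)\<^sup>2 + (y 2)\<^sup>2 + (y 3)\<^sup>2))"
    by (simp add: field_simps flip: exp_add)
  finally show ?thesis
    unfolding fbi_kernel_def 1 2 exp_add cis_conv_exp exp_of_real by simp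
qed

lemma norm_kern: "norm (kern r i t) = exp (- r * t\<^sup>2 / 2)"
  by (simp add: kern_def norm_mult)

lemma kern_cont: "continuous_on UNIV (kern r i)"
  unfolding kern_def[abs_def] by (cases "i = 3") (auto intro!: continuous_intros simp: cis_conv_exp)

text \<open>At every phase space point the kernel is a product of exponentials of quadratic
  polynomials \<open>Q i\<close> in single coordinates, so a cutoff of product form times the kernel
  is again a tensor. This makes \<open>solution_homogeneous\<close> applicable to the
  transform.\<close>

lemma fbi_kernel_cutoff_test_function:
  assumes h: "tensor n (\<lambda>i t. of_real (h i t)) \<in> test_functions n (topspace (Rn n))"
    and sm: "\<And>i. smooth_fun (h i)" and supp: "\<And>i t. \<bar>t\<bar> \<ge> R \<Longrightarrow> h i t = (0 :: real)"
  shows "(\<lambda>y. tensor n (\<lambda>i t. of_real (h i t)) y * fbi_kernel n q \<tau> y) \<in> test_functions n (topspace (Rn n))"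
proof -
  define Q where "Q i = [: of_real (- (\<tau> / 2) * (q i)\<^sup>2) + \<i> * of_real (\<tau> * q i * q (n + i)),
      of_real (\<tau> * q i) - \<i> * of_real (\<tau> * q (n + i)), of_real (- (\<tau> / 2)) :]" for i
  have Q: "poly (Q i) (of_real t) = of_real (- (\<tau> / 2) * (q i - t)\<^sup>2) + \<i> * of_real (\<tau> * ((q i - t) * q (n + i)))" for i t
    by (simp add: Q_def algebra_simps power2_eq_square)
  have "tensor n (\<lambda>i t. of_real (h i t) * exp (poly (Q i) (of_real t))) \<in> test_functions n (topspace (Rn n))"
  proof (rule tensor_test_function[where R = R])
    show "smooth_fun (\<lambda>t. complex_of_real (h i t) * exp (poly (Q i) (of_real t)))" for i
      by (rule smooth_fun_mult[OF smooth_fun_of_real[OF sm] smooth_fun_exp_poly])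
  qed (auto simp: supp cube_def)
  moreover have "tensor n (\<lambda>i t. of_real (h i t) * exp (poly (Q i) (of_real t))) =
      (\<lambda>y. tensor n (\<lambda>i t. of_real (h i t)) y * fbi_kernel n q \<tau> y)"
  proof
    fix y
    have "fbi_kernel n q \<tau> y = exp (\<Sum>i<n. poly (Q i) (of_real (y i)))"
      unfolding fbi_kernel_def Q by (simp only: sum.distrib sum_distrib_left of_real_sum)
    also have "\<dots> = (\<Prod>i<n. exp (poly (Q i) (of_real (y i))))" by (simp add: exp_sum)
    finally show "tensor n (\<lambda>i t. of_real (h i t) * exp (poly (Q i) (of_real t))) y =
      tensor n (\<lambda>i t. of_real (h i t)) y * fbi_kernel n q \<tau> y" by (simp add: tensor_def prod.distrib)
  qed
  ultimately show ?thesis by (simp only:)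
qed

lemma base_codirection: "base 4 codirection = (\<lambda>i\<in>{..<4}. 0)"
  by (auto simp: base_def codirection_def)

lemma codirection_in_cotangent: "codirection \<in> cotangent 4 (topspace (Rn 4))"
proof -
  have "codirection \<in> topspace (Rn (2 * 4))" "codirection (4 + 3) \<noteq> 0" by (simp_all add: codirection_def)
  moreover have "base 4 codirection \<in> topspace (Rn 4)" by (simp add: base_codirection)
  moreover have "(3 :: nat) < 4" by simp
  ultimately show ?thesis unfolding cotangent_def by blast
qed

section \<open>The transforms of the solution and of its image\<close>

context mode_family
begin

lemma codirection_notin_WF_image:
  "codirection \<notin> WF_a 4 (topspace (Rn 4)) (sum_of_squares 4 6 treves_field solution)"
proof -
  let ?a = "\<lambda>i\<in>{..<4 :: nat}. 0 :: real"
  obtain h :: "nat \<Rightarrow> real \<Rightarrow> real" where h: "tensor 4 (\<lambda>i t. of_real (h i t)) \<in> test_functions 4 (topspace (Rn 4))"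
    "\<And>i t. h i t \<ge> 0" "\<And>i t. \<bar>t - ?a i\<bar> \<le> 1 \<Longrightarrow> h i t = 1" "\<And>i t. \<bar>t - ?a i\<bar> \<ge> 3 * 1 \<Longrightarrow> h i t = 0"
    "\<And>i. continuous_on UNIV (h i)" "\<And>i. smooth_fun (h i)"
    by (rule test_function_box[of 1 ?a 4]) (simp, simp, rule that)
  \<comment> \<open>For \<open>i \<ge> 4\<close> the centre \<open>?a i\<close> is
    \<open>undefined\<close>, so the support of \<open>h i\<close> is unknown; replacing these
    factors by 0 leaves the tensor unchanged.\<close>
  let ?\<eta> = "tensor 4 (\<lambda>i t. of_real (if i < 4 then h i t else 0))"
  have eta: "?\<eta> = tensor 4 (\<lambda>i t. of_real (h i t))" by (auto simp: tensor_def fun_eq_iff)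
  let ?V = "PiE {..<4 :: nat} (\<lambda>_. {-1<..<1 :: real})"
  have zero: "sum_of_squares 4 6 treves_field solution (\<lambda>y. ?\<eta> y * fbi_kernel 4 q \<tau> y) = 0" for q \<tau>
  proof (rule solution_homogeneous, rule fbi_kernel_cutoff_test_function[where R = 3])
    show "?\<eta> \<in> test_functions 4 (topspace (Rn 4))" unfolding eta by (rule h(1))
    show "smooth_fun (\<lambda>t. if i < 4 then h i t else 0)" for i
      using h(6)[of i] smooth_fun_affine[OF h(6), of 0 i 0 0] by (cases "i < 4") auto
    show "(if i < 4 then h i t else 0) = 0" if "\<bar>t\<bar> \<ge> 3" for i t using h(4)[where i = i and t = t] that by auto
  qed
  have one: "?\<eta> y = 1" if y: "y \<in> ?V" for y
  proof -
    have "y \<in> extensional {..<4}" using y by (auto simp: PiE_def)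
    moreover have "h i (y i) = 1" if "i < 4" for i using y that by (intro h(3)) (auto simp: PiE_def Pi_def)
    ultimately show "?\<eta> y = 1" by (simp add: tensor_def)
  qed
  have "\<exists>\<eta>\<in>test_functions 4 (topspace (Rn 4)). \<exists>V W C \<epsilon>.
      openin (Rn 4) V \<and> base 4 codirection \<in> V \<and> (\<forall>y\<in>V. \<eta> y = 1) \<and>
      openin (Rn (2 * 4)) W \<and> codirection \<in> W \<and> \<epsilon> > 0 \<and>
      (\<forall>q\<in>W. \<forall>\<tau>\<ge>1. norm (sum_of_squares 4 6 treves_field solution (\<lambda>y. \<eta> y * fbi_kernel 4 q \<tau> y)) \<le> C * exp (- \<epsilon> * \<tau>))"
  proof (rule bexI[of _ ?\<eta>], rule exI[of _ ?V], rule exI[of _ "topspace (Rn (2 * 4))"],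
      rule exI[of _ 0], rule exI[of _ 1], intro conjI ballI allI impI)
    show "openin (Rn 4) ?V" by (simp add: openin_PiE)
    show "base 4 codirection \<in> ?V" by (auto simp: base_codirection)
    show "openin (Rn (2 * 4)) (topspace (Rn (2 * 4)))" by (rule openin_topspace)
    show "codirection \<in> topspace (Rn (2 * 4))" by (simp add: codirection_def)
    show "?\<eta> \<in> test_functions 4 (topspace (Rn 4))" unfolding eta by (rule h(1))
    show "norm (sum_of_squares 4 6 treves_field solution (\<lambda>y. ?\<eta> y * fbi_kernel 4 q \<tau> y)) \<le> 0 * exp (- 1 * \<tau>)" for q \<tau>
      by (simp only: zero norm_zero mult_zero_left order_refl)
  qed (auto simp: one)
  then show ?thesis unfolding WF_a_def by blast
qed

text \<open>The cube restricts each coordinate to the same interval, so the pairing of mode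
  \<open>k\<close> with the kernel over the cube is a product of four such integrals, see
  \<open>box_integral\<close>.\<close>

definition box_factor :: "real \<Rightarrow> nat \<Rightarrow> nat \<Rightarrow> nat \<Rightarrow> complex" where
  "box_factor \<delta> N k i = (LINT t|lborel. indicator {-\<delta>..\<delta>} t *\<^sub>R (fac k i t * kern (\<rho> N) i t))"

lemma box_factor_integrable: "integrable lborel (\<lambda>t. indicator {-\<delta>..\<delta>} t *\<^sub>R (fac k i t * kern r i t))"
proof (rule borel_integrable_compact)
  show "continuous_on {-\<delta>..\<delta>} (\<lambda>t. fac k i t * kern r i t)"
    by (intro continuous_on_mult continuous_on_subset[OF fac_cont] continuous_on_subset[OF kern_cont]) auto
qed simp

lemma box_integral:
  "(LINT y|lebesgue_Rn 4. weight k * mode k y * (indicator (cube 4 \<delta>) y * fbi_kernel 4 codirection (\<rho> N) y)) =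
     weight k * (\<Prod>i<4. box_factor \<delta> N k i)"
proof -
  have "(LINT y|lebesgue_Rn 4. weight k * mode k y * (indicator (cube 4 \<delta>) y * fbi_kernel 4 codirection (\<rho> N) y)) =
      (LINT y|lebesgue_Rn 4. weight k * (\<Prod>i<4. indicator {-\<delta>..\<delta>} (y i) *\<^sub>R (fac k i (y i) * kern (\<rho> N) i (y i))))"
  proof (rule Bochner_Integration.integral_cong[OF refl])
    fix y assume "y \<in> space (lebesgue_Rn 4)"
    then have y: "y \<in> extensional {..<4}" by simp
    have "(indicator (cube 4 \<delta>) y :: complex) = (\<Prod>i<4. of_real (indicator {-\<delta>..\<delta>} (y i)))"
    proof (cases "y \<in> cube 4 \<delta>")
      case True
      then have "(\<Prod>i<4. complex_of_real (indicator {-\<delta>..\<delta>} (y i))) = 1"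
        by (intro prod.neutral) (auto simp: cube_def abs_le_iff)
      then show ?thesis using True by (simp only: indicator_simps)
    next
      case False
      then obtain i where "i < 4" "y i \<notin> {-\<delta>..\<delta>}" using y by (auto simp: cube_def abs_le_iff)
      then have "(\<Prod>i<4. complex_of_real (indicator {-\<delta>..\<delta>} (y i))) = 0"
        by (intro prod_zero bexI[of _ i]) (simp_all add: indicator_def)
      then show ?thesis using False by simp
    qed
    then show "weight k * mode k y * (indicator (cube 4 \<delta>) y * fbi_kernel 4 codirection (\<rho> N) y) =
      weight k * (\<Prod>i<4. indicator {-\<delta>..\<delta>} (y i) *\<^sub>R (fac k i (y i) * kern (\<rho> N) i (y i)))"
      using y by (simp add: mode_def tensor_def fbi_kernel_codirection scaleR_conv_of_real prod.distrib mult_ac)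
  qed
  also have "\<dots> = weight k * (LINT y|lebesgue_Rn 4. (\<Prod>i<4. indicator {-\<delta>..\<delta>} (y i) *\<^sub>R (fac k i (y i) * kern (\<rho> N) i (y i))))"
    by (rule integral_mult_right_zero)
  also have "(LINT y|lebesgue_Rn 4. (\<Prod>i<4. indicator {-\<delta>..\<delta>} (y i) *\<^sub>R (fac k i (y i) * kern (\<rho> N) i (y i)))) =
      (\<Prod>i<4. box_factor \<delta> N k i)"
    unfolding box_factor_def
    by (rule lborel_Rn.product_integral_prod) (auto intro: box_factor_integrable)
  finally show ?thesis .
qed

lemma norm_box_factor_le:
  assumes d: "\<delta> > 0" and B: "\<And>t. \<bar>t\<bar> \<le> \<delta> \<Longrightarrow> norm (fac k i t) \<le> B"
  shows "norm (box_factor \<delta> N k i) \<le> 2 * \<delta> * B"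
proof -
  have "norm (box_factor \<delta> N k i) \<le> (LINT t|lborel. norm (indicator {-\<delta>..\<delta>} t *\<^sub>R (fac k i t * kern (\<rho> N) i t)))"
    unfolding box_factor_def by (rule integral_norm_bound)
  also have "\<dots> \<le> (LINT t|lborel. B * indicator {-\<delta>..\<delta>} t)"
  proof (rule integral_mono)
    show "integrable lborel (\<lambda>t. norm (indicator {-\<delta>..\<delta>} t *\<^sub>R (fac k i t * kern (\<rho> N) i t)))"
      by (intro integrable_norm box_factor_integrable)
    show "integrable lborel (\<lambda>t. B * indicator {-\<delta>..\<delta>} t)"
      by (intro integrable_mult_right integrable_real_indicator) (auto simp: emeasure_lborel_Icc_eq)
    fix t
    show "norm (indicator {-\<delta>..\<delta>} t *\<^sub>R (fac k i t * kern (\<rho> N) i t)) \<le> B * indicator {-\<delta>..\<delta>} t"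
    proof (cases "t \<in> {-\<delta>..\<delta>}")
      case True
      then have "norm (fac k i t) \<le> B" by (intro B) auto
      moreover have "norm (kern (\<rho> N) i t) \<le> 1" using rho_pos[of N] by (simp add: norm_kern)
      ultimately have "norm (fac k i t) * norm (kern (\<rho> N) i t) \<le> B * 1"
        by (intro mult_mono) (auto intro: order_trans[OF norm_ge_zero])
      then show ?thesis using True by (simp add: norm_mult)
    qed simp
  qed
  also have "\<dots> = 2 * \<delta> * B" using d by simp
  finally show ?thesis .
qed

text \<open>Only the factor in x_3 oscillates. The other three are bounded by absolute values, and
  their growth exp (2 \<delta> \<kappa>) is absorbed by the weight, so a summable bound in
  \<open>k\<close> is left for any gain in the last factor.\<close>

lemma norm_box_integral_le:
  assumes d: "\<delta> > 0"
  shows "norm (weight k * (\<Prod>i<4. box_factor \<delta> N k i)) \<le>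
    majorant \<delta> k * (2 * \<delta>) ^ 3 * norm (box_factor \<delta> N k 3)"
proof -
  have 0: "norm (box_factor \<delta> N k 0) \<le> 2 * \<delta> * 1"
    using mu_nonneg[of k] by (intro norm_box_factor_le[OF d]) (simp add: fac_def)
  have 1: "norm (box_factor \<delta> N k 1) \<le> 2 * \<delta> * exp (\<kappa> k * \<delta>)"
  proof (rule norm_box_factor_le[OF d])
    fix t assume t: "\<bar>t\<bar> \<le> \<delta>"
    have "g k t \<le> exp (sqrt (\<rho> k) * \<bar>t\<bar>)" by (rule g_upper)
    also have "sqrt (\<rho> k) * \<bar>t\<bar> \<le> \<kappa> k * \<delta>"
      using t sqrt_rho_le[of k] kappa_pos[of k] by (intro mult_mono) auto
    finally show "norm (fac k 1 t) \<le> exp (\<kappa> k * \<delta>)" using g_pos[of k t] by (simp add: fac_def)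
  qed
  have 2: "norm (box_factor \<delta> N k 2) \<le> 2 * \<delta> * exp (\<kappa> k * \<delta>)"
  proof (rule norm_box_factor_le[OF d])
    fix t assume t: "\<bar>t\<bar> \<le> \<delta>"
    have "\<kappa> k * (- t) \<le> \<kappa> k * \<delta>" using t kappa_pos[of k] by (intro mult_left_mono) auto
    then show "norm (fac k 2 t) \<le> exp (\<kappa> k * \<delta>)" by (simp add: fac_def)
  qed
  have "norm (\<Prod>i<4. box_factor \<delta> N k i) =
      norm (box_factor \<delta> N k 0) * norm (box_factor \<delta> N k 1) * norm (box_factor \<delta> N k 2) * norm (box_factor \<delta> N k 3)"
    by (simp add: eval_nat_numeral norm_mult)
  also have "\<dots> \<le> (2 * \<delta> * 1) * (2 * \<delta> * exp (\<kappa> k * \<delta>)) * (2 * \<delta> * exp (\<kappa> k * \<delta>)) * norm (box_factor \<delta> N k 3)"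
    using 0 1 2 d by (intro mult_mono) auto
  also have "\<dots> = exp (2 * \<delta> * \<kappa> k) * (2 * \<delta>) ^ 3 * norm (box_factor \<delta> N k 3)"
    by (simp add: power3_eq_cube mult_ac flip: exp_add)
  finally have "weight k * norm (\<Prod>i<4. box_factor \<delta> N k i) \<le> weight k * (exp (2 * \<delta> * \<kappa> k) * (2 * \<delta>) ^ 3 * norm (box_factor \<delta> N k 3))"
    using weight_pos[of k] by (intro mult_left_mono) auto
  also have "\<dots> = (weight k * exp (2 * \<delta> * \<kappa> k)) * (2 * \<delta>) ^ 3 * norm (box_factor \<delta> N k 3)" by simp
  also have "weight k * exp (2 * \<delta> * \<kappa> k) = majorant \<delta> k"
    by (simp add: weight_def majorant_def algebra_simps flip: exp_add)
  finally show ?thesis using weight_pos[of k] by (simp add: norm_mult)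
qed

text \<open>By \<open>double\<close> every other frequency is at most \<open>\<rho> N / 2\<close> or
  at least \<open>2 * \<rho> N\<close>. The gap is proportional to \<rho> N, which is what an
  exponential gain in the transform at \<tau> = \<rho> N requires.\<close>

lemma rho_lacunary: "k \<noteq> N \<Longrightarrow> \<bar>\<rho> k - \<rho> N\<bar> \<ge> \<rho> N / 2"
proof -
  assume "k \<noteq> N"
  have "\<rho> i \<le> \<rho> (Suc i)" for i using double[of i] rho_pos[of i] by linarith
  then have mono: "\<rho> i \<le> \<rho> j" if "i \<le> j" for i j
    using that by (rule lift_Suc_mono_le)
  show ?thesis
  proof (cases "k < N")
    case True
    then obtain M where M: "N = Suc M" by (cases N) auto
    then have "\<rho> k \<le> \<rho> M" using True by (intro mono) simp
    then have "\<rho> N / 2 \<le> - (\<rho> k - \<rho> N)" using double[of M] M by simp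
    then show ?thesis by (rule order_trans[OF _ abs_ge_minus_self])
  next
    case False
    then have "\<rho> (Suc N) \<le> \<rho> k" using \<open>k \<noteq> N\<close> by (intro mono) simp
    then have "\<rho> N / 2 \<le> \<rho> k - \<rho> N" using double[of N] rho_pos[of N] by simp
    then show ?thesis by (rule order_trans[OF _ abs_ge_self])
  qed
qed

text \<open>Against the kernel, mode \<open>k\<close> has phase \<rho> k - \<rho> N, at least \<rho>
  N / 2 in absolute value. A Gaussian of variance 1 / \<rho> N damps it by exp (- (\<rho> N / 2)^2 /
  (2 \<rho> N)), whence the rate 1 / 8; the rate \<open>\<delta>\<^sup>2 / 4\<close> comes from the
  truncation.\<close>

lemma norm_box_factor_3_le:
  assumes d: "\<delta> > 0" and k: "k \<noteq> N"
  shows "norm (box_factor \<delta> N k 3) \<le> 8 * exp (- min (1 / 8) (\<delta>\<^sup>2 / 4) * \<rho> N)"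
proof -
  let ?m = "min (1 / 8) (\<delta>\<^sup>2 / 4)"
  have "fac k 3 t * kern (\<rho> N) 3 t = of_real (exp (- \<rho> N * t\<^sup>2 / 2)) * cis ((\<rho> k - \<rho> N) * t)" for t
    by (simp add: fac_def kern_def mult.left_commute cis_mult left_diff_distrib)
  then have "box_factor \<delta> N k 3 = (LINT t|lborel. indicator {-\<delta>..\<delta>} t *\<^sub>R (of_real (exp (- \<rho> N * t\<^sup>2 / 2)) * cis ((\<rho> k - \<rho> N) * t)))"
    unfolding box_factor_def by (simp only:)
  also have "norm \<dots> \<le> 4 * exp (- (\<rho> k - \<rho> N)\<^sup>2 / (2 * \<rho> N)) + 4 * exp (- \<rho> N * \<delta>\<^sup>2 / 4)"
    by (rule truncated_gaussian_fourier_le[OF rho_ge_1 d])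
  also have "\<dots> \<le> 4 * exp (- ?m * \<rho> N) + 4 * exp (- ?m * \<rho> N)"
  proof (intro add_mono mult_left_mono)
    have "(\<rho> N / 2)\<^sup>2 \<le> (\<rho> k - \<rho> N)\<^sup>2"
      using rho_lacunary[OF k] rho_pos[of N] abs_le_square_iff[of "\<rho> N / 2" "\<rho> k - \<rho> N"] by simp
    then have "(\<rho> N / 2)\<^sup>2 / (2 * \<rho> N) \<le> (\<rho> k - \<rho> N)\<^sup>2 / (2 * \<rho> N)"
      using rho_pos[of N] by (intro divide_right_mono) auto
    moreover have "(\<rho> N / 2)\<^sup>2 / (2 * \<rho> N) = 1 / 8 * \<rho> N" using rho_pos[of N] by (simp add: power2_eq_square)
    moreover have "?m * \<rho> N \<le> 1 / 8 * \<rho> N" using rho_pos[of N] by (intro mult_right_mono) auto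
    ultimately show "exp (- (\<rho> k - \<rho> N)\<^sup>2 / (2 * \<rho> N)) \<le> exp (- ?m * \<rho> N)" by simp
    have "?m * \<rho> N \<le> \<delta>\<^sup>2 / 4 * \<rho> N" using rho_pos[of N] by (intro mult_right_mono) auto
    then show "exp (- \<rho> N * \<delta>\<^sup>2 / 4) \<le> exp (- ?m * \<rho> N)" by (simp add: mult.commute)
  qed auto
  finally show ?thesis by simp
qed

text \<open>For k = N the oscillation cancels and the integrand is nonnegative. The interval of
  length 2 / \<rho> N around 0 suffices, because there the mode factor and the Gaussian are each at
  least exp (-1). The loss is polynomial in \<rho> N, which is harmless against exponential
  decay.\<close>

lemma box_factor_diagonal:
  assumes i: "i < 4" and d: "1 / \<rho> N \<le> \<delta>"
  obtains v where "box_factor \<delta> N N i = of_real v" "v \<ge> 2 * exp (-2) / \<rho> N"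
proof -
  define f where "f t = (if i = 0 then exp (- \<mu> N * t\<^sup>2 / 2) else if i = 1 then g N t
    else if i = 2 then exp (- \<kappa> N * t) else 1) * exp (- \<rho> N * t\<^sup>2 / 2)" for t
  have f: "fac N i t * kern (\<rho> N) i t = of_real (f t)" for t
    using i by (auto simp: fac_def kern_def f_def cis_mult)
  have f0: "f t \<ge> 0" for t using g_pos[of N t] by (simp add: f_def)
  have low: "exp (-2) \<le> f t" if "\<bar>t\<bar> \<le> 1 / \<rho> N" for t
  proof -
    have rt: "\<rho> N * \<bar>t\<bar> \<le> 1" using that rho_pos[of N] by (simp add: field_simps)
    have t1: "\<bar>t\<bar> \<le> 1" using that rho_ge_1[of N] order_trans[of "\<bar>t\<bar>" "1 / \<rho> N" 1] by simp
    have rt2: "\<rho> N * t\<^sup>2 \<le> 1"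
    proof -
      have "\<rho> N * \<bar>t\<bar> * \<bar>t\<bar> \<le> 1 * 1" using rt t1 rho_pos[of N] by (intro mult_mono) auto
      then show ?thesis by (simp add: power2_eq_square mult.assoc)
    qed
    have rt4: "\<rho> N * t ^ 4 \<le> 1"
    proof -
      have "t\<^sup>2 \<le> 1" using t1 by (simp add: abs_square_le_1)
      then have "\<rho> N * t\<^sup>2 * t\<^sup>2 \<le> 1 * 1" using rt2 rho_pos[of N] by (intro mult_mono) auto
      then show ?thesis by (simp add: mult.assoc flip: power_add)
    qed
    have mt: "\<mu> N * t\<^sup>2 \<le> 1" using order_trans[OF mult_right_mono[OF mu_le_rho[of N]] rt2] by simp
    have kt: "\<kappa> N * t \<le> 1"
    proof -
      have "1 * \<kappa> N \<le> (real N + 1)\<^sup>2 * \<kappa> N" using kappa_pos[of N] by (intro mult_right_mono) auto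
      then have "\<kappa> N \<le> \<rho> N" using kappa_small[of N] by linarith
      then have "\<kappa> N * \<bar>t\<bar> \<le> \<rho> N * \<bar>t\<bar>" by (intro mult_right_mono) auto
      moreover have "\<kappa> N * t \<le> \<kappa> N * \<bar>t\<bar>" using kappa_pos[of N] by (intro mult_left_mono) auto
      ultimately show ?thesis using rt by linarith
    qed
    have "exp (-1) \<le> (if i = 0 then exp (- \<mu> N * t\<^sup>2 / 2) else if i = 1 then g N t
      else if i = 2 then exp (- \<kappa> N * t) else 1)"
      using mt kt rt4 order_trans[OF _ g_lower[of N t], of "exp (-1)"] by auto
    moreover have "exp (-1) \<le> exp (- \<rho> N * t\<^sup>2 / 2)" using rt2 by simp
    ultimately have "exp (-1) * exp (-1) \<le> f t" unfolding f_def using g_pos[of N t] by (intro mult_mono) auto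
    then show ?thesis by (simp flip: exp_add)
  qed
  have rint: "integrable lborel (\<lambda>t. indicator {-\<delta>..\<delta>} t * f t)"
  proof -
    have "integrable lborel (\<lambda>t. Re (indicator {-\<delta>..\<delta>} t *\<^sub>R (fac N i t * kern (\<rho> N) i t)))"
      by (intro integrable_Re box_factor_integrable)
    then show ?thesis by (simp add: f)
  qed
  have "2 * exp (-2) / \<rho> N = (LINT t|lborel. exp (-2) * indicator {-(1 / \<rho> N)..1 / \<rho> N} t)"
    using rho_pos[of N] by simp
  also have "\<dots> \<le> (LINT t|lborel. indicator {-\<delta>..\<delta>} t * f t)"
  proof (rule integral_mono[OF _ rint])
    show "integrable lborel (\<lambda>t. exp (-2 :: real) * indicator {-(1 / \<rho> N)..1 / \<rho> N} t)"
      by (intro integrable_mult_right, rule integrable_real_indicator) (simp_all add: emeasure_lborel_Icc_eq)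
    show "exp (-2) * indicator {-(1 / \<rho> N)..1 / \<rho> N} t \<le> indicator {-\<delta>..\<delta>} t * f t" for t
      using low[of t] f0[of t] d by (auto simp: indicator_def abs_le_iff)
  qed
  finally have "(LINT t|lborel. indicator {-\<delta>..\<delta>} t * f t) \<ge> 2 * exp (-2) / \<rho> N" .
  moreover have "box_factor \<delta> N N i = of_real (LINT t|lborel. indicator {-\<delta>..\<delta>} t * f t)"
    unfolding box_factor_def f by (simp add: scaleR_conv_of_real flip: of_real_mult)
  ultimately show ?thesis using that by blast
qed

lemma box_product_diagonal:
  assumes "1 / \<rho> N \<le> \<delta>"
  shows "norm (\<Prod>i<4. box_factor \<delta> N N i) \<ge> (2 * exp (-2) / \<rho> N) ^ 4"
proof -
  have "2 * exp (-2) / \<rho> N \<le> norm (box_factor \<delta> N N i)" if "i < 4" for i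
  proof -
    obtain v where "box_factor \<delta> N N i = of_real v" "v \<ge> 2 * exp (-2) / \<rho> N"
      by (rule box_factor_diagonal[OF \<open>i < 4\<close> assms])
    then show ?thesis by simp
  qed
  then have "(\<Prod>i<4 :: nat. 2 * exp (-2) / \<rho> N) \<le> (\<Prod>i<4. norm (box_factor \<delta> N N i))"
    using rho_pos[of N] by (intro prod_mono) auto
  then show ?thesis by (simp add: prod_norm)
qed

text \<open>
  On the cube, where the cutoff is 1, the integrals of the modes factorize, and the Gaussian
  in the last variable makes all but the \<open>N\<close>-th exponentially small.  Off the cube the kernel is
  exponentially small.
\<close>

lemma fbi_lower_bound:
  assumes eta: "\<eta> \<in> test_functions 4 U" and d: "\<delta> > 0"
    and one: "\<And>y. y \<in> cube 4 \<delta> \<Longrightarrow> \<eta> y = 1"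
  obtains C c where "C \<ge> 0" "c > 0"
    "\<And>N. 1 / \<rho> N \<le> \<delta> \<Longrightarrow> weight N * (2 * exp (-2) / \<rho> N) ^ 4 \<le>
      norm (solution (\<lambda>y. \<eta> y * fbi_kernel 4 codirection (\<rho> N) y)) + C * exp (- c * \<rho> N)"
proof -
  obtain R B where b: "R > 0" "\<eta> \<in> borel_measurable (lebesgue_Rn 4)" "B \<ge> 0"
    "\<And>x. x \<in> cube 4 R \<Longrightarrow> norm (\<eta> x) \<le> B"
    "\<And>x. x \<in> extensional {..<4} \<Longrightarrow> x \<notin> cube 4 R \<Longrightarrow> \<eta> x = 0"
    by (rule test_function_bounds[OF eta]) (rule that)
  define R' where "R' = max R \<delta>"
  \<comment> \<open>The rate of \<open>norm_box_factor_3_le\<close>; off the cube the kernel decays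
    at least at the larger rate \<open>\<delta>\<^sup>2 / 2\<close>.\<close>
  define c where "c = min (1 / 8) (\<delta>\<^sup>2 / 4)"
  define S where "S = (\<Sum>k. majorant R' k)"
  define S' where "S' = (\<Sum>k. majorant \<delta> k)"
  define C where "C = S * (B + 1) * (2 * R') ^ 4 + S' * (2 * \<delta>) ^ 3 * 8"
  have c: "c > 0" using d by (simp add: c_def)
  have S0: "S \<ge> 0" "S' \<ge> 0"
    unfolding S_def S'_def by (intro suminf_nonneg summable_majorant; simp add: majorant_def)+
  have C: "C \<ge> 0" unfolding C_def using S0 b d by (intro add_nonneg_nonneg mult_nonneg_nonneg) (auto simp: R'_def)
  have cube_mono: "cube 4 r \<subseteq> cube 4 s" if "r \<le> s" for r s using that by (force simp: cube_def)
  have main: "weight N * (2 * exp (-2) / \<rho> N) ^ 4 \<le>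
      norm (solution (\<lambda>y. \<eta> y * fbi_kernel 4 codirection (\<rho> N) y)) + C * exp (- c * \<rho> N)"
    if N: "1 / \<rho> N \<le> \<delta>" for N
  proof -
    let ?K = "fbi_kernel 4 codirection (\<rho> N)"
    let ?I = "\<lambda>y. indicator (cube 4 \<delta>) y :: complex"
    have Kmeas: "?K \<in> borel_measurable (lebesgue_Rn 4)"
      unfolding fbi_kernel_codirection
      by (intro borel_measurable_continuous_Rn continuous_map_tensor kern_cont)
    have Imeas: "?I \<in> borel_measurable (lebesgue_Rn 4)" by measurable
    define e where "e = exp (- c * \<rho> N)"
    have e: "e > 0" by (simp add: e_def)
    have normK: "norm (?K y) = exp (- \<rho> N * (\<Sum>i<4. (y i)\<^sup>2) / 2)" for y
      unfolding fbi_kernel_codirection prod_norm[symmetric] norm_kern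
      by (simp add: sum_distrib_left sum_divide_distrib sum_negf flip: exp_sum)
    have outside: "norm (?K y) \<le> e" if y: "y \<in> extensional {..<4}" "y \<notin> cube 4 \<delta>" for y
    proof -
      obtain i where i: "i < 4" "\<bar>y i\<bar> > \<delta>" using y by (auto simp: cube_def not_le)
      have "\<delta>\<^sup>2 \<le> (y i)\<^sup>2" using i(2) d abs_le_square_iff[of \<delta> "y i"] by simp
      also have "\<dots> \<le> (\<Sum>i<4. (y i)\<^sup>2)" using i(1) by (intro member_le_sum) auto
      finally have "2 * c \<le> (\<Sum>i<4. (y i)\<^sup>2)" using zero_le_power2[of \<delta>] unfolding c_def by linarith
      then have "\<rho> N * (2 * c) \<le> \<rho> N * (\<Sum>i<4. (y i)\<^sup>2)" using rho_pos[of N] by (intro mult_left_mono) auto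
      then show ?thesis unfolding normK e_def by (simp add: mult_ac)
    qed
    define E where "E k = (LINT y|lebesgue_Rn 4. weight k * mode k y * ((\<eta> y - ?I y) * ?K y))" for k
    define J where "J k = weight k * (\<Prod>i<4. box_factor \<delta> N k i)" for k
    have Ebound: "integrable (lebesgue_Rn 4) (\<lambda>y. weight k * mode k y * ((\<eta> y - ?I y) * ?K y))"
      "norm (E k) \<le> majorant R' k * ((B + 1) * e) * (2 * R') ^ 4" for k
    proof -
      have meas: "(\<lambda>y. (\<eta> y - ?I y) * ?K y) \<in> borel_measurable (lebesgue_Rn 4)"
        using b(2) Imeas Kmeas by (intro borel_measurable_times borel_measurable_diff)
      have R'0: "R' \<ge> 0" using b(1) by (simp add: R'_def)
      have bd: "norm ((\<eta> y - ?I y) * ?K y) \<le> (B + 1) * e" if "y \<in> cube 4 R'" for y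
      proof (cases "y \<in> cube 4 \<delta>")
        case True
        then show ?thesis using one[OF True] b(3) e by simp
      next
        case False
        have y: "y \<in> extensional {..<4}" using that by (simp add: cube_def)
        have "norm (\<eta> y) \<le> B" using b(3,4) b(5)[OF y] by (cases "y \<in> cube 4 R") auto
        then have "norm (\<eta> y - ?I y) \<le> B + 1" using False by simp
        then show ?thesis unfolding norm_mult using outside[OF y False] b(3) by (intro mult_mono) auto
      qed
      have zero: "(\<eta> y - ?I y) * ?K y = 0" if "y \<in> extensional {..<4}" "y \<notin> cube 4 R'" for y
      proof -
        have "y \<notin> cube 4 R" "y \<notin> cube 4 \<delta>" using that(2) cube_mono[of R R'] cube_mono[of \<delta> R'] by (auto simp: R'_def)
        then show ?thesis using b(5)[OF that(1)] by simp
      qed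
      show "integrable (lebesgue_Rn 4) (\<lambda>y. weight k * mode k y * ((\<eta> y - ?I y) * ?K y))"
        by (rule mode_integral(1)[OF meas R'0 bd zero]) auto
      show "norm (E k) \<le> majorant R' k * ((B + 1) * e) * (2 * R') ^ 4"
        unfolding E_def by (rule mode_integral(2)[OF meas R'0 bd zero]) auto
    qed
    have Jint: "integrable (lebesgue_Rn 4) (\<lambda>y. weight k * mode k y * (?I y * ?K y))" for k
    proof -
      have meas: "(\<lambda>y. ?I y * ?K y) \<in> borel_measurable (lebesgue_Rn 4)"
        using Imeas Kmeas by (rule borel_measurable_times)
      have n1: "norm (?I y * ?K y) \<le> 1" for y
        using rho_pos[of N] by (auto simp: norm_mult normK indicator_def intro!: mult_nonneg_nonneg sum_nonneg)
      show ?thesis by (rule mode_integral(1)[OF meas less_imp_le[OF d] n1]) simp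
    qed
    have split: "(LINT y|lebesgue_Rn 4. weight k * mode k y * (\<eta> y * ?K y)) = J k + E k" for k
    proof -
      have "(LINT y|lebesgue_Rn 4. weight k * mode k y * (\<eta> y * ?K y)) =
        (LINT y|lebesgue_Rn 4. weight k * mode k y * (?I y * ?K y) + weight k * mode k y * ((\<eta> y - ?I y) * ?K y))"
        by (intro Bochner_Integration.integral_cong) (auto simp: algebra_simps)
      also have "\<dots> = J k + E k"
        unfolding J_def E_def box_integral[symmetric] by (rule Bochner_Integration.integral_add[OF Jint Ebound(1)])
      finally show ?thesis .
    qed
    have Esum: "summable E" "norm (suminf E) \<le> S * (B + 1) * (2 * R') ^ 4 * e"
    proof -
      have sm: "summable (\<lambda>k. majorant R' k * ((B + 1) * e) * (2 * R') ^ 4)"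
        by (intro summable_mult2 summable_majorant)
      show "summable E" by (rule summable_comparison_test'[OF sm Ebound(2)])
      have "norm (suminf E) \<le> (\<Sum>k. majorant R' k * ((B + 1) * e) * (2 * R') ^ 4)"
        by (rule norm_suminf_le[OF Ebound(2) sm])
      also have "\<dots> = S * ((B + 1) * e) * (2 * R') ^ 4"
        unfolding S_def using summable_majorant[of R'] by (simp only: suminf_mult2 summable_mult2)
      finally show "norm (suminf E) \<le> S * (B + 1) * (2 * R') ^ 4 * e" by (simp add: mult_ac)
    qed
    \<comment> \<open>Without the diagonal term only modes separated in frequency remain, so the
      bounds for the last factor apply to the whole series.\<close>
    define J' where "J' k = (if k = N then 0 else J k)" for k
    have J'bound: "norm (J' k) \<le> majorant \<delta> k * ((2 * \<delta>) ^ 3 * (8 * e))" for k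
    proof (cases "k = N")
      case False
      have "norm (J k) \<le> majorant \<delta> k * (2 * \<delta>) ^ 3 * norm (box_factor \<delta> N k 3)"
        unfolding J_def by (rule norm_box_integral_le[OF d])
      also have "\<dots> \<le> majorant \<delta> k * (2 * \<delta>) ^ 3 * (8 * e)"
        using norm_box_factor_3_le[OF d False] d
        by (intro mult_left_mono) (auto simp: e_def c_def majorant_def)
      finally show ?thesis using False by (simp add: J'_def mult.assoc)
    qed (use e d in \<open>simp add: J'_def majorant_def\<close>)
    have J'sum: "summable J'" "norm (suminf J') \<le> S' * (2 * \<delta>) ^ 3 * 8 * e"
    proof -
      have sm: "summable (\<lambda>k. majorant \<delta> k * ((2 * \<delta>) ^ 3 * (8 * e)))"
        by (intro summable_mult2 summable_majorant)
      show "summable J'" by (rule summable_comparison_test'[OF sm J'bound])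
      have "norm (suminf J') \<le> (\<Sum>k. majorant \<delta> k * ((2 * \<delta>) ^ 3 * (8 * e)))"
        by (rule norm_suminf_le[OF J'bound sm])
      also have "\<dots> = S' * ((2 * \<delta>) ^ 3 * (8 * e))"
        unfolding S'_def by (rule suminf_mult2[symmetric, OF summable_majorant])
      finally show "norm (suminf J') \<le> S' * (2 * \<delta>) ^ 3 * 8 * e" by (simp add: mult_ac)
    qed
    have "J = (\<lambda>k. J' k + (if k = N then J N else 0))" by (auto simp: J'_def fun_eq_iff)
    moreover have "(\<lambda>k. if k = N then J N else 0) sums J N" by (rule sums_single)
    ultimately have "J sums (suminf J' + J N)"
      using sums_add[OF summable_sums[OF J'sum(1)]] by metis
    then have "(\<lambda>k. J k + E k) sums (suminf J' + J N + suminf E)"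
      by (rule sums_add[OF _ summable_sums[OF Esum(1)]])
    then have sol: "solution (\<lambda>y. \<eta> y * ?K y) = suminf J' + J N + suminf E"
      unfolding solution_def split by (rule sums_unique[symmetric])
    have "weight N * (2 * exp (-2) / \<rho> N) ^ 4 \<le> norm (J N)"
      unfolding J_def norm_mult using weight_pos[of N] box_product_diagonal[OF N]
      by (simp del: prod_norm add: mult_left_mono)
    also have "J N = solution (\<lambda>y. \<eta> y * ?K y) - (suminf J' + suminf E)" unfolding sol by simp
    also have "norm \<dots> \<le> norm (solution (\<lambda>y. \<eta> y * ?K y)) + (norm (suminf J') + norm (suminf E))"
      by (rule order_trans[OF norm_triangle_ineq4 add_left_mono[OF norm_triangle_ineq]])
    also have "norm (suminf J') + norm (suminf E) \<le> C * e"
      using J'sum(2) Esum(2) unfolding C_def by (simp add: ring_distribs)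
    finally show ?thesis by (simp add: e_def)
  qed
  show ?thesis by (rule that[OF C c main])
qed

text \<open>At \<tau> = \<rho> N the supposed decay and the error of \<open>fbi_lower_bound\<close>
  both have at least the rate \<open>a\<close>, while by \<open>weight_ge\<close> the weight of mode
  \<open>N\<close> costs at most the rate \<open>a / 2\<close> once N + 1 \<ge> 2 / a. The
  comparison would keep \<open>\<rho> N ^ 4 * exp (- (a / 2) * \<rho> N)\<close> away from
  0.\<close>

lemma codirection_in_WF: "codirection \<in> WF_a 4 (topspace (Rn 4)) solution"
proof (rule ccontr)
  assume "\<not> ?thesis"
  moreover have "codirection \<in> cotangent 4 (topspace (Rn 4))" by (rule codirection_in_cotangent)
  ultimately obtain \<eta> V W C \<epsilon> where eta: "\<eta> \<in> test_functions 4 (topspace (Rn 4))"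
    and V: "openin (Rn 4) V" "base 4 codirection \<in> V" "\<forall>y\<in>V. \<eta> y = 1"
    and W: "codirection \<in> W" and eps: "\<epsilon> > 0"
    and decay: "\<forall>q\<in>W. \<forall>\<tau>\<ge>1. norm (solution (\<lambda>y. \<eta> y * fbi_kernel 4 q \<tau> y)) \<le> C * exp (- \<epsilon> * \<tau>)"
    unfolding WF_a_def by blast
  obtain \<delta> where d: "\<delta> > 0" "\<And>x. x \<in> extensional {..<4} \<Longrightarrow> (\<And>i. i < 4 \<Longrightarrow> \<bar>x i - base 4 codirection i\<bar> \<le> \<delta>) \<Longrightarrow> x \<in> V"
    by (rule openin_Rn_box[OF V(1,2)]) (rule that, assumption, blast)
  have one: "\<eta> y = 1" if "y \<in> cube 4 \<delta>" for y
    using that V(3) by (intro V(3)[rule_format] d(2)) (auto simp: cube_def base_codirection)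
  obtain C' c where C': "C' \<ge> 0" and c: "c > 0"
    and low: "\<And>N. 1 / \<rho> N \<le> \<delta> \<Longrightarrow> weight N * (2 * exp (-2) / \<rho> N) ^ 4 \<le>
      norm (solution (\<lambda>y. \<eta> y * fbi_kernel 4 codirection (\<rho> N) y)) + C' * exp (- c * \<rho> N)"
    by (rule fbi_lower_bound[OF eta d(1) one]) (auto intro: that)
  define a where "a = min c \<epsilon>"
  have a: "a > 0" using c eps by (simp add: a_def)
  have rho_lim: "filterlim \<rho> at_top sequentially"
  proof (rule filterlim_at_top_mono[OF filterlim_real_sequentially])
    show "\<forall>\<^sub>F k in sequentially. real k \<le> \<rho> k"
    proof (intro always_eventually allI)
      show "real k \<le> \<rho> k" for k using rho_ge[of k] by linarith
    qed
  qed
  have "((\<lambda>x. (\<bar>C\<bar> + C') * (x ^ 4 * exp (- (a / 2) * x))) \<longlongrightarrow> (\<bar>C\<bar> + C') * 0) at_top"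
    by (intro tendsto_mult tendsto_const) (use a in real_asymp)
  from filterlim_compose[OF this rho_lim]
  have lim: "(\<lambda>N. (\<bar>C\<bar> + C') * (\<rho> N ^ 4 * exp (- (a / 2) * \<rho> N))) \<longlonglongrightarrow> 0" by simp
  have "\<forall>\<^sub>F N in sequentially. (\<bar>C\<bar> + C') * (\<rho> N ^ 4 * exp (- (a / 2) * \<rho> N)) < (2 * exp (-2)) ^ 4"
    by (rule order_tendstoD(2)[OF lim]) simp
  moreover have "\<forall>\<^sub>F N in sequentially. real N \<ge> 2 / a + 1 / \<delta>"
    by (rule filterlim_real_sequentially[unfolded filterlim_at_top, rule_format])
  ultimately obtain N where N: "(\<bar>C\<bar> + C') * (\<rho> N ^ 4 * exp (- (a / 2) * \<rho> N)) < (2 * exp (-2)) ^ 4"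
    "real N \<ge> 2 / a + 1 / \<delta>"
    by (metis (mono_tags, lifting) eventually_conj eventually_happens sequentially_bot)
  have N1: "1 / (real N + 1) \<le> a / 2"
  proof -
    have "2 / a \<le> real N + 1" using N(2) d(1) by (smt (verit) divide_nonneg_pos)
    then show ?thesis using a by (simp add: field_simps)
  qed
  have "1 / \<delta> \<le> \<rho> N" using N(2) a rho_ge[of N] by (smt (verit) divide_nonneg_pos)
  then have Nd: "1 / \<rho> N \<le> \<delta>" using d(1) rho_pos[of N] by (simp add: field_simps)
  have ea: "exp (- c * \<rho> N) \<le> exp (- a * \<rho> N)" "exp (- \<epsilon> * \<rho> N) \<le> exp (- a * \<rho> N)"
    using rho_pos[of N] by (simp_all add: a_def)
  have "norm (solution (\<lambda>y. \<eta> y * fbi_kernel 4 codirection (\<rho> N) y)) \<le> C * exp (- \<epsilon> * \<rho> N)"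
    using decay W rho_ge_1[of N] by blast
  also have "\<dots> \<le> \<bar>C\<bar> * exp (- a * \<rho> N)" using ea(2) by (intro mult_mono) auto
  finally have "weight N * (2 * exp (-2) / \<rho> N) ^ 4 \<le> \<bar>C\<bar> * exp (- a * \<rho> N) + C' * exp (- c * \<rho> N)"
    using low[OF Nd] by linarith
  also have "\<dots> \<le> (\<bar>C\<bar> + C') * exp (- a * \<rho> N)"
    using mult_left_mono[OF ea(1) C'] by (simp add: ring_distribs)
  finally have up: "weight N * (2 * exp (-2) / \<rho> N) ^ 4 \<le> (\<bar>C\<bar> + C') * exp (- a * \<rho> N)" .
  have "exp (- (a / 2) * \<rho> N) \<le> weight N"
  proof -
    have "1 / (real N + 1) * \<rho> N \<le> a / 2 * \<rho> N" using N1 rho_pos[of N] by (intro mult_right_mono) auto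
    then have "exp (- (a / 2) * \<rho> N) \<le> exp (- \<rho> N / (real N + 1))" by simp
    then show ?thesis using weight_ge[of N] by (rule order_trans)
  qed
  then have "exp (- (a / 2) * \<rho> N) * (2 * exp (-2) / \<rho> N) ^ 4 \<le> (\<bar>C\<bar> + C') * exp (- a * \<rho> N)"
    using up rho_pos[of N] by (intro order_trans[OF mult_right_mono up]) auto
  also have "exp (- a * \<rho> N) = exp (- (a / 2) * \<rho> N) * exp (- (a / 2) * \<rho> N)" by (simp flip: exp_add)
  finally have "exp (- (a / 2) * \<rho> N) * (2 * exp (-2) / \<rho> N) ^ 4 \<le>
      exp (- (a / 2) * \<rho> N) * ((\<bar>C\<bar> + C') * exp (- (a / 2) * \<rho> N))" by (simp only: mult_ac)
  then have "(2 * exp (-2) / \<rho> N) ^ 4 \<le> (\<bar>C\<bar> + C') * exp (- (a / 2) * \<rho> N)"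
    by (rule mult_left_le_imp_le) simp
  then have "(2 * exp (-2)) ^ 4 \<le> (\<bar>C\<bar> + C') * exp (- (a / 2) * \<rho> N) * \<rho> N ^ 4"
    using rho_pos[of N] by (simp add: power_divide pos_divide_le_eq)
  with N(1) show False by (simp only: mult_ac)
qed

end

section \<open>The Poisson-Treves stratification\<close>

lemma pd_coordinate: "pd k (\<lambda>x. x i :: real) p = of_bool (k = i)"
proof (cases "k = i")
  case True
  have "((\<lambda>t :: real. t) has_vector_derivative 1) (at (p k))"
    by (rule has_vector_derivative_id)
  then show ?thesis using True by (simp add: pd_def vector_derivative_at)
qed (simp add: pd_def)

text \<open>The expansion at \<open>a\<close> is the finite binomial sum, carried by the
  multi-indices \<open>\<iota> j\<close>, so every radius is admissible. The binomial coefficient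
  vanishes for \<open>j > m\<close>, which cuts the series off.\<close>

lemma real_analytic_coordinate_power:
  assumes i: "i < n"
  shows "real_analytic n U (\<lambda>x. x i ^ m :: real)"
  unfolding real_analytic_def
proof
  fix a assume "a \<in> U"
  let ?A = "PiE {..<n} (\<lambda>_. UNIV :: nat set)"
  define \<iota> where "\<iota> j = (\<lambda>l\<in>{..<n}. if l = i then j else 0)" for j :: nat
  have inj: "inj \<iota>"
    using i by (intro injI) (auto simp: \<iota>_def fun_eq_iff restrict_def split: if_splits)
  define b where "b j = real (m choose j) * a i ^ (m - j)" for j
  define c where "c \<alpha> = (if \<alpha> \<in> range \<iota> then b (\<alpha> i) else 0)" for \<alpha>
  have "((\<lambda>\<alpha>. (\<Prod>l<n. (x l - a l) ^ \<alpha> l) *\<^sub>R c \<alpha>) has_sum x i ^ m) ?A" for x :: point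
  proof -
    let ?g = "\<lambda>\<alpha>. (\<Prod>l<n. (x l - a l) ^ \<alpha> l) *\<^sub>R c \<alpha>"
    have gi: "?g (\<iota> j) = (x i - a i) ^ j * b j" for j
    proof -
      have "(\<Prod>l<n. (x l - a l) ^ \<iota> j l) = (\<Prod>l<n. if l = i then (x i - a i) ^ j else 1)"
        by (rule prod.cong) (auto simp: \<iota>_def)
      also have "\<dots> = (x i - a i) ^ j" using i by simp
      finally have e: "(\<Prod>l<n. (x l - a l) ^ \<iota> j l) = (x i - a i) ^ j" .
      have "c (\<iota> j) = b j" using i by (simp add: c_def) (simp add: \<iota>_def)
      then show ?thesis unfolding e by simp
    qed
    have "x i ^ m = ((x i - a i) + a i) ^ m" by simp
    also have "\<dots> = (\<Sum>j\<le>m. real (m choose j) * (x i - a i) ^ j * a i ^ (m - j))" by (rule binomial_ring)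
    also have "\<dots> = (\<Sum>j\<le>m. ?g (\<iota> j))" unfolding gi by (rule sum.cong) (auto simp: b_def)
    also have "\<dots> = (\<Sum>\<alpha>\<in>\<iota> ` {..m}. ?g \<alpha>)"
      using inj by (subst sum.reindex) (auto simp: inj_on_def inj_def)
    finally have e: "x i ^ m = (\<Sum>\<alpha>\<in>\<iota> ` {..m}. ?g \<alpha>)" .
    have "(?g has_sum x i ^ m) (\<iota> ` {..m})" unfolding e by (rule has_sum_finite) simp
    also have "(?g has_sum x i ^ m) (\<iota> ` {..m}) \<longleftrightarrow> (?g has_sum x i ^ m) ?A"
    proof (rule has_sum_cong_neutral)
      fix \<alpha> assume \<alpha>: "\<alpha> \<in> ?A - \<iota> ` {..m}"
      have "c \<alpha> = 0"
      proof (cases "\<alpha> \<in> range \<iota>")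
        case True
        then obtain j where j: "\<alpha> = \<iota> j" by blast
        then have "j > m" using \<alpha> by force
        moreover have "\<alpha> i = j" using i by (simp add: j \<iota>_def)
        ultimately show ?thesis using True by (simp add: c_def b_def)
      qed (simp add: c_def)
      then show "?g \<alpha> = 0" by simp
    next
      fix \<alpha> assume "\<alpha> \<in> \<iota> ` {..m} - ?A"
      then show "?g \<alpha> = 0" by (auto simp: \<iota>_def)
    qed simp
    finally show ?thesis .
  qed
  then show "\<exists>r>0. \<exists>c. \<forall>x\<in>U. (\<forall>i<n. \<bar>x i - a i\<bar> < r) \<longrightarrow>
      ((\<lambda>\<alpha>. (\<Prod>i<n. (x i - a i) ^ \<alpha> i) *\<^sub>R c \<alpha>) has_sum x i ^ m) ?A"
    by (intro exI[of _ "1 :: real"] exI[of _ c] conjI ballI impI) simp_all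
qed

lemma real_analytic_0: "real_analytic n U (\<lambda>x. 0)"
  unfolding real_analytic_def by (intro ballI exI[of _ "1 :: real"] conjI exI[of _ "\<lambda>_. 0"]) auto

lemma real_analytic_treves_field:
  "j < 6 \<Longrightarrow> k < 4 \<Longrightarrow> real_analytic 4 U (treves_field j k)"
  unfolding treves_field_def[abs_def]
  by (cases "k = field_dir j") (simp_all add: real_analytic_coordinate_power real_analytic_0 field_src_less)

text \<open>The bracket differentiates the coefficient x_0 and leaves the constant field in
  direction \<open>j\<close>. Together with the first two generators these fields span at every
  point, also where x_0 and x_1 vanish.\<close>

lemma commutator_treves_field:
  assumes j: "j = 2 \<or> j = 3"
  shows "commutator 4 (treves_field 0) (treves_field j) k x = of_bool (k = j)"
proof -
  have d0: "pd l (treves_field 0 k) x = 0" for l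
  proof -
    have "treves_field 0 k = (\<lambda>x. of_bool (k = 0))"
      by (auto simp: treves_field_def[abs_def] field_dir_def field_exp_def)
    then show ?thesis by (simp add: pd_def)
  qed
  have "treves_field j k = (\<lambda>x. of_bool (k = j) * x 0)"
    using j by (auto simp: treves_field_def[abs_def] field_dir_def field_src_def field_exp_def fun_eq_iff)
  then have "pd 0 (treves_field j k) x = of_bool (k = j)"
    using pd_coordinate[of 0 0 x] by (cases "k = j") (simp_all add: pd_def)
  moreover have "treves_field 0 l x = of_bool (l = 0)" for l
    by (simp add: treves_field_def field_dir_def field_exp_def)
  ultimately show ?thesis
    unfolding commutator_def d0 by (simp add: eval_nat_numeral)
qed

lemma hormander_condition_treves: "hormander_condition 4 \<Omega> 6 treves_field"
  unfolding hormander_condition_def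
proof (intro ballI allI)
  fix x w :: point
  let ?L = "lie_algebra 4 6 treves_field"
  let ?V2 = "commutator 4 (treves_field 0) (treves_field 2)"
  let ?V3 = "commutator 4 (treves_field 0) (treves_field 3)"
  have gen: "treves_field j \<in> ?L" if "j < 6" for j using that by (rule lie_algebra.generator)
  define A where "A = (\<lambda>k x. w 0 * treves_field 0 k x + w 1 * treves_field 1 k x)"
  define B where "B = (\<lambda>k x. w 2 * ?V2 k x + w 3 * ?V3 k x)"
  have "A \<in> ?L" "B \<in> ?L"
    unfolding A_def B_def by (intro lie_algebra.lincomb lie_algebra.commutator gen; simp)+
  then have mem: "(\<lambda>k x. 1 * A k x + 1 * B k x) \<in> ?L" by (rule lie_algebra.lincomb)
  show "\<exists>V\<in>?L. \<forall>k<4. V k x = w k"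
  proof (rule bexI[OF _ mem], intro allI impI)
    fix k :: nat assume "k < 4"
    then consider "k = 0" | "k = 1" | "k = 2" | "k = 3" by linarith
    then show "1 * A k x + 1 * B k x = w k"
      by cases (simp_all add: A_def B_def commutator_treves_field treves_field_def[of 0] treves_field_def[of "Suc 0"] field_dir_def field_exp_def)
  qed
qed

lemma hormander_fields_treves: "hormander_fields 4 (topspace (Rn 4)) 6 treves_field"
  unfolding hormander_fields_def
  by (intro conjI allI impI openin_topspace real_analytic_treves_field hormander_condition_treves)

section \<open>The characteristic variety and its symplectic geometry\<close>

definition treves_char :: "point set" where
  "treves_char = {p \<in> extensional {..<8}. p 0 = 0 \<and> p 1 = 0 \<and> p 4 = 0 \<and> p 5 = 0 \<and> (p 6 \<noteq> 0 \<or> p 7 \<noteq> 0)}"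

lemma field_symbol_treves:
  "j < 6 \<Longrightarrow> field_symbol 4 (treves_field j) p = base 4 p (field_src j) ^ field_exp j * p (4 + field_dir j)"
  using field_dir_less[of j] by (simp add: field_symbol_def treves_field_def if_distrib[of "\<lambda>c. c * _"] cong: if_cong)

lemma less_6_cases: "(j :: nat) < 6 \<longleftrightarrow> j = 0 \<or> j = 1 \<or> j = 2 \<or> j = 3 \<or> j = 4 \<or> j = 5"
  by linarith

lemma all_less_6: "(\<forall>j<6. P j) \<longleftrightarrow> P 0 \<and> P 1 \<and> P 2 \<and> P 3 \<and> P 4 \<and> P (5 :: nat)"
  unfolding less_6_cases by blast

lemma less_4_cases: "(j :: nat) < 4 \<longleftrightarrow> j = 0 \<or> j = 1 \<or> j = 2 \<or> j = 3"
  by linarith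

lemma ex_less_4: "(\<exists>j<4. P j) \<longleftrightarrow> P 0 \<or> P 1 \<or> P 2 \<or> P (3 :: nat)"
  unfolding less_4_cases by blast

lemma all_less_4: "(\<forall>j<4. P j) \<longleftrightarrow> P 0 \<and> P 1 \<and> P 2 \<and> P (3 :: nat)"
  unfolding less_4_cases by blast

lemma field_symbol_treves_simps:
  "field_symbol 4 (treves_field 0) p = p 4" "field_symbol 4 (treves_field (Suc 0)) p = p 5"
  "field_symbol 4 (treves_field 2) p = p 0 * p 6" "field_symbol 4 (treves_field 3) p = p 0 * p 7"
  "field_symbol 4 (treves_field 4) p = p 1 * p 6" "field_symbol 4 (treves_field 5) p = p 1 ^ 3 * p 7"
  by (simp_all add: field_symbol_treves field_src_def field_exp_def field_dir_def base_def)

text \<open>For a nonzero covector with \<xi>_0 = \<xi>_1 = 0, one of \<xi>_2 and \<xi>_3 is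
  nonzero. Then x_0 \<xi>_2 = x_0 \<xi>_3 = 0 forces x_0 = 0, and x_1 \<xi>_2 = x_1^3 \<xi>_3 = 0
  forces x_1 = 0.\<close>

lemma characteristic_variety_treves:
  "characteristic_variety 4 (topspace (Rn 4)) 6 treves_field = treves_char"
proof -
  have ex: "(\<exists>k<4. p (4 + k) \<noteq> 0) \<longleftrightarrow> p 4 \<noteq> 0 \<or> p 5 \<noteq> 0 \<or> p 6 \<noteq> 0 \<or> p 7 \<noteq> 0" for p :: point
    by (simp add: ex_less_4)
  have all: "(\<forall>j<6. field_symbol 4 (treves_field j) p = 0) \<longleftrightarrow>
      p 4 = 0 \<and> p 5 = 0 \<and> p 0 * p 6 = 0 \<and> p 0 * p 7 = 0 \<and> p 1 * p 6 = 0 \<and> p 1 ^ 3 * p 7 = 0" for p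
    by (simp only: all_less_6 One_nat_def field_symbol_treves_simps)
  show ?thesis
    unfolding characteristic_variety_def treves_char_def cotangent_def ex all
    by (auto simp: base_def)
qed

lemma treves_char_open_section:
  "openin (Rn 8) {p \<in> extensional {..<8}. p 6 \<noteq> 0 \<or> p 7 \<noteq> 0}"
proof -
  have o: "openin (Rn 8) {p \<in> topspace (Rn 8). p i \<in> - {0}}" if "i < 8" for i
    using that by (intro openin_continuous_map_preimage[of _ euclideanreal] continuous_map_product_projection) auto
  have "{p \<in> extensional {..<8}. p 6 \<noteq> 0 \<or> p 7 \<noteq> 0} =
      {p \<in> topspace (Rn 8). p 6 \<in> - {0}} \<union> {p \<in> topspace (Rn 8). p 7 \<in> - {0 :: real}}" by auto
  then show ?thesis using o[of 6] o[of 7] by (simp only: openin_Un)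
qed

lemma analytic_submanifold_treves: "analytic_submanifold 8 treves_char"
proof -
  \<comment> \<open>Enumerates the coordinates that vanish on the variety; their gradients are
    distinct basis vectors, whence the rank condition.\<close>
  define e where "e i = (if i = 0 then 0 else if i = 1 then 1 else if i = 2 then 4 else 5 :: nat)" for i :: nat
  let ?U = "{p \<in> extensional {..<8}. p 6 \<noteq> 0 \<or> p 7 \<noteq> (0 :: real)}"
  have e8: "e i < 8" for i by (simp add: e_def)
  have "\<exists>U (f :: nat \<Rightarrow> point \<Rightarrow> real). openin (Rn 8) U \<and> p \<in> U \<and> (\<forall>i<4. real_analytic 8 U (f i)) \<and>
      treves_char \<inter> U = {x \<in> U. \<forall>i<4. f i x = (0::real)} \<and>
      (\<forall>c. (\<forall>k<8. (\<Sum>i<4. c i * pd k (f i) p) = 0) \<longrightarrow> (\<forall>i<4. c i = 0))"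
    if p: "p \<in> treves_char" for p
  proof (rule exI[of _ ?U], rule exI[of _ "\<lambda>i p. p (e i)"], intro conjI allI impI)
    show "openin (Rn 8) ?U" by (rule treves_char_open_section)
    show "p \<in> ?U" using p by (auto simp: treves_char_def)
    show "real_analytic 8 ?U (\<lambda>p. p (e i))" for i
      using real_analytic_coordinate_power[OF e8[of i], of ?U 1] by simp
    show "treves_char \<inter> ?U = {x \<in> ?U. \<forall>i<4. x (e i) = 0}"
      unfolding all_less_4 by (auto simp: treves_char_def e_def)
    fix c :: "nat \<Rightarrow> real" and i :: nat
    assume c: "\<forall>k<8. (\<Sum>i<4. c i * pd k (\<lambda>p. p (e i)) p) = 0" and i: "i < 4"
    have inj: "e i = e j \<longleftrightarrow> i = j" if "j < 4" for j
    proof -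
      have "\<forall>i<4. \<forall>j<4. e i = e j \<longleftrightarrow> i = j" unfolding all_less_4 by (simp add: e_def)
      then show ?thesis using i that by blast
    qed
    have "0 = (\<Sum>j<4. c j * of_bool (e i = e j))" using c e8[of i] by (simp add: pd_coordinate)
    also have "\<dots> = (\<Sum>j<4. if j = i then c j else 0)"
      by (rule sum.cong) (auto simp: inj)
    also have "\<dots> = c i" using i by simp
    finally show "c i = 0" by simp
  qed
  then show ?thesis unfolding analytic_submanifold_def by (intro exI[of _ 4]) blast
qed

definition treves_tangent :: "point set" where
  "treves_tangent = {v \<in> extensional {..<8}. v 0 = 0 \<and> v 1 = 0 \<and> v 4 = 0 \<and> v 5 = 0}"

lemma tangent_treves:
  assumes p: "p \<in> treves_char"
  shows "tangent 8 treves_char p = treves_tangent"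
proof (intro equalityI subsetI)
  fix v assume "v \<in> tangent 8 treves_char p"
  then obtain \<gamma> \<epsilon> where v: "v \<in> extensional {..<8}" and \<epsilon>: "\<epsilon> > 0" "\<And>t. \<bar>t\<bar> < \<epsilon> \<Longrightarrow> \<gamma> t \<in> treves_char"
    and d: "\<And>i. i < 8 \<Longrightarrow> ((\<lambda>t. \<gamma> t i) has_real_derivative v i) (at 0)"
    unfolding tangent_def by auto
  have "v i = 0" if i: "i < 8" and z: "\<And>p. p \<in> treves_char \<Longrightarrow> p i = 0" for i
  proof -
    have "((\<lambda>t. \<gamma> t i) has_real_derivative 0) (at 0)"
    proof (rule has_field_derivative_transform_within_open[OF DERIV_const])
      show "open {-\<epsilon><..<\<epsilon>}" "0 \<in> {-\<epsilon><..<\<epsilon>}" using \<epsilon>(1) by auto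
      show "0 = \<gamma> t i" if "t \<in> {-\<epsilon><..<\<epsilon>}" for t using z[OF \<epsilon>(2)[of t]] that by auto
    qed
    with d[OF i] show ?thesis by (rule DERIV_unique)
  qed
  then show "v \<in> treves_tangent" using v by (auto simp: treves_tangent_def treves_char_def)
next
  fix v assume v: "v \<in> treves_tangent"
  define \<gamma> where "\<gamma> t = (\<lambda>i\<in>{..<8}. p i + t * v i)" for t
  obtain j where j: "j = 6 \<or> j = 7" "p j \<noteq> 0" using p by (auto simp: treves_char_def)
  \<comment> \<open>Small enough that the nonzero covariable \<open>p j\<close> stays nonzero along
    the line \<open>\<gamma>\<close>; the other conditions of the variety are linear.\<close>
  define \<epsilon> where "\<epsilon> = \<bar>p j\<bar> / (\<bar>v j\<bar> + 1)"
  have \<epsilon>: "\<epsilon> > 0" using j(2) by (simp add: \<epsilon>_def)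
  have "\<gamma> t \<in> treves_char" if t: "\<bar>t\<bar> < \<epsilon>" for t
  proof -
    have "\<bar>t\<bar> * \<bar>v j\<bar> \<le> \<bar>t\<bar> * (\<bar>v j\<bar> + 1)" by (intro mult_left_mono) auto
    also have "\<dots> < \<bar>p j\<bar>" using t by (simp add: \<epsilon>_def pos_less_divide_eq)
    finally have "p j + t * v j \<noteq> 0" unfolding abs_mult[symmetric] by linarith
    then show ?thesis using j(1) p v by (auto simp: \<gamma>_def treves_char_def treves_tangent_def)
  qed
  moreover have "\<gamma> 0 = p" using p by (auto simp: \<gamma>_def treves_char_def extensional_def)
  moreover have "((\<lambda>t. \<gamma> t i) has_real_derivative v i) (at 0)" if "i < 8" for i
    using that by (auto simp: \<gamma>_def intro!: derivative_eq_intros)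
  moreover have "v \<in> topspace (Rn 8)" using v by (simp add: treves_tangent_def)
  ultimately show "v \<in> tangent 8 treves_char p"
    unfolding tangent_def using \<epsilon> by blast
qed

lemma symplectic_treves: "symplectic 4 treves_char"
proof -
  have "\<forall>i<8. v i = 0" if v: "v \<in> treves_tangent" and ortho: "\<forall>w\<in>treves_tangent. symplectic_form 4 v w = 0" for v
  proof -
    have "v 6 = 0" "v 7 = 0" "v 2 = 0" "v 3 = 0"
    proof -
      \<comment> \<open>Testing against a basis vector reads off the conjugate coordinate of
        \<open>v\<close>: 2 is paired with 6, and 3 with 7.\<close>
      define u where "u i = (\<lambda>l\<in>{..<8}. if l = i then 1 else 0 :: real)" for i :: nat
      have "u i \<in> treves_tangent" if "i \<in> {2, 3, 6, 7}" for i
        using that by (auto simp: u_def treves_tangent_def)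
      then have o: "symplectic_form 4 v (u i) = 0" if "i \<in> {2, 3, 6, 7}" for i using ortho that by blast
      show "v 6 = 0" using o[of 2] by (simp add: symplectic_form_def u_def eval_nat_numeral)
      show "v 7 = 0" using o[of 3] by (simp add: symplectic_form_def u_def eval_nat_numeral)
      show "v 2 = 0" using o[of 6] by (simp add: symplectic_form_def u_def eval_nat_numeral)
      show "v 3 = 0" using o[of 7] by (simp add: symplectic_form_def u_def eval_nat_numeral)
    qed
    moreover have "i \<in> {0, 1, 2, 3, 4, 5, 6, 7}" if "i < 8" for i :: nat using that by (simp, linarith)
    ultimately show ?thesis using v by (auto simp: treves_tangent_def)
  qed
  then show ?thesis unfolding symplectic_def by (simp add: tangent_treves)
qed

text \<open>The tangent space is the same at all points by \<open>tangent_treves\<close>, so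
  \<open>symplectic_rank\<close> takes a single value, whatever it is.\<close>

lemma constant_rank_treves: "constant_rank 4 treves_char"
  unfolding constant_rank_def symplectic_rank_def by (auto simp: tangent_treves)

text \<open>Bracketing with \<xi>_0 differentiates in x_0 and frees the covariable. On the variety
  \<xi>_2 and \<xi>_3 do not vanish together, so the depth is 2 everywhere, including the points
  with \<xi>_2 = 0 where the x_1 part degenerates.\<close>

lemma bracket_treves:
  "bracket 4 treves_field [0, 2] p = p 6" "bracket 4 treves_field [0, 3] p = p 7"
proof -
  have s0: "field_symbol 4 (treves_field 0) = (\<lambda>p. p 4)" by (simp add: fun_eq_iff field_symbol_treves_simps)
  have p0: "poisson 4 (\<lambda>p. p 4) f p = pd 0 f p" for f
    unfolding poisson_def pd_coordinate by (simp add: eval_nat_numeral)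
  have d: "pd 0 (\<lambda>p. p 0 * p i :: real) p = p i" if "i \<noteq> 0" for i
  proof -
    have "((\<lambda>t. t * p i) has_vector_derivative 1 * p i) (at (p 0))"
      by (intro has_vector_derivative_mult_left has_vector_derivative_id)
    then show ?thesis using that by (simp add: pd_def vector_derivative_at)
  qed
  have s: "field_symbol 4 (treves_field 2) = (\<lambda>p. p 0 * p 6)" "field_symbol 4 (treves_field 3) = (\<lambda>p. p 0 * p 7)"
    by (simp_all add: fun_eq_iff field_symbol_treves_simps)
  show "bracket 4 treves_field [0, 2] p = p 6" "bracket 4 treves_field [0, 3] p = p 7"
    by (simp_all add: s0 s p0 d)
qed

lemma constant_depth_treves: "constant_depth 4 6 treves_field treves_char"
  unfolding constant_depth_def
proof (intro exI[of _ 2] conjI allI ballI impI)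
  fix I :: "nat list" and p assume I: "set I \<subseteq> {..<6} \<and> length I < 2" and p: "p \<in> treves_char"
  show "bracket 4 treves_field I p = 0"
  proof (cases I)
    case (Cons j J)
    then have "I = [j]" "j < 6" using I by auto
    moreover have "\<forall>j<6. field_symbol 4 (treves_field j) p = 0"
      using p characteristic_variety_treves by (auto simp: characteristic_variety_def)
    ultimately show ?thesis by simp
  qed simp
next
  fix p assume "p \<in> treves_char"
  then have "bracket 4 treves_field [0, 2] p \<noteq> 0 \<or> bracket 4 treves_field [0, 3] p \<noteq> 0"
    unfolding bracket_treves by (auto simp: treves_char_def)
  moreover have "set [0, 2] \<subseteq> {..<6 :: nat} \<and> length [0, 2 :: nat] = 2" "set [0, 3] \<subseteq> {..<6 :: nat} \<and> length [0, 3 :: nat] = 2"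
    by auto
  ultimately show "\<exists>I. set I \<subseteq> {..<6} \<and> length I = 2 \<and> bracket 4 treves_field I p \<noteq> 0"
    by blast
qed

text \<open>The free covariables (\<xi>_2, \<xi>_3) range over a punctured plane, which unlike a
  punctured line is connected. Reading pairs of real coordinates as complex numbers presents the
  variety as the image of a connected product.\<close>

lemma connectedin_treves: "connectedin (Rn 8) treves_char"
proof -
  define P :: "complex \<times> complex \<Rightarrow> point" where
    "P z = (\<lambda>i\<in>{..<8}. if i = 2 then Re (fst z) else if i = 3 then Im (fst z)
      else if i = 6 then Re (snd z) else if i = 7 then Im (snd z) else 0)" for z
  have "continuous_map euclidean (Rn 8) P"
    unfolding continuous_map_componentwise
  proof (intro conjI ballI)
    show "P ` topspace euclidean \<subseteq> extensional {..<8}" by (auto simp: P_def)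
    fix i :: nat assume i: "i \<in> {..<8}"
    have "continuous_on UNIV (\<lambda>z. P z i)"
      using i by (cases "i = 2"; cases "i = 3"; cases "i = 6"; cases "i = 7")
        (auto simp: P_def intro!: continuous_intros)
    then show "continuous_map euclidean euclideanreal (\<lambda>z. P z i)" by simp
  qed
  moreover have "connectedin euclidean (UNIV \<times> (- {0 :: complex}) :: (complex \<times> complex) set)"
    by (simp add: connected_Times connected_punctured_universe convex_connected)
  ultimately have "connectedin (Rn 8) (P ` (UNIV \<times> (- {0})))" by (rule connectedin_continuous_map_image)
  also have "P ` (UNIV \<times> (- {0})) = treves_char"
  proof (intro equalityI subsetI)
    fix p assume "p \<in> P ` (UNIV \<times> (- {0}))"
    then show "p \<in> treves_char" by (auto simp: P_def treves_char_def complex_eq_iff)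
  next
    fix p assume p: "p \<in> treves_char"
    have "i \<in> {0, 1, 2, 3, 4, 5, 6, 7}" if "i < 8" for i :: nat using that by (simp, linarith)
    then have "p = P (Complex (p 2) (p 3), Complex (p 6) (p 7))"
      using p by (intro ext) (auto simp: P_def treves_char_def extensional_def restrict_def)
    moreover have "(Complex (p 2) (p 3), Complex (p 6) (p 7)) \<in> UNIV \<times> (- {0})"
      using p by (auto simp: treves_char_def complex_eq_iff)
    ultimately show "p \<in> P ` (UNIV \<times> (- {0}))" by blast
  qed
  finally show ?thesis .
qed

section \<open>The stratification with a single stratum\<close>

text \<open>If the whole set is regular, then the recursion stops after the first round.\<close>
lemma strata_of_connected_manifold:
  assumes M: "analytic_submanifold m M" "Q M" "connectedin (Rn m) M" "M \<noteq> {}"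
    and C: "\<And>A. A \<in> \<C> \<Longrightarrow> M \<subseteq> A \<or> M \<inter> A = {}"
  shows "strata m Q \<C> M = {M}"
proof -
  have sub: "M \<subseteq> topspace (Rn m)" using M(3) by (rule connectedin_subset_topspace)
  have reg: "regular_part m Q \<C> M = M"
  proof -
    have "M \<inter> topspace (Rn m) = M" using sub by blast
    then show ?thesis unfolding regular_part_def
      using M C sub openin_topspace[of "Rn m"] by (auto intro!: exI[of _ "topspace (Rn m)"])
  qed
  have comp: "connected_components_of (subtopology (Rn m) M) = {M}"
    unfolding connected_components_of_eq_singleton
  proof (intro conjI notI)
    show "connected_space (subtopology (Rn m) M)" using M(3) by (simp add: connectedin_def)
    show t: "M = topspace (subtopology (Rn m) M)"
      using sub by (simp only: topspace_subtopology Int_absorb1)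
    assume e: "subtopology (Rn m) M = trivial_topology"
    have "topspace (subtopology (Rn m) M) = {}" unfolding e by simp
    with t M(4) show False by blast
  qed
  have empty: "regular_part m Q \<D> {} = {}" for \<D> by (simp add: regular_part_def)
  have "strata_upto m Q \<C> M (Suc k) = ({}, {M})" for k
  proof (induction k)
    case 0
    show ?case by (simp add: reg comp)
  next
    case (Suc k)
    have "connected_components_of (subtopology (Rn m) {}) = {}"
      by (simp add: connected_components_of_eq_empty)
    then show ?case by (subst strata_upto.simps(2)) (simp only: Suc Let_def case_prod_conv empty Diff_empty Un_empty_right)
  qed
  then have s: "snd (strata_upto m Q \<C> M k) = (if k = 0 then {} else {M})" for k
    by (cases k) (simp, simp only: snd_conv nat.distinct if_False)
  show ?thesis unfolding strata_def s by auto
qed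

lemma treves_char_nonempty: "treves_char \<noteq> {}"
proof -
  have "(\<lambda>i\<in>{..<8}. if i = 7 then 1 else 0) \<in> treves_char" by (simp add: treves_char_def)
  then show ?thesis by blast
qed

text \<open>In each of the three steps the variety itself is a connected manifold with the required
  property, and the only set to be refined, if any, is the variety.\<close>

lemma poisson_treves_strata_treves:
  "poisson_treves_strata 4 (topspace (Rn 4)) 6 treves_field = {treves_char}"
proof -
  have "strata 8 (\<lambda>_. True) {} treves_char = {treves_char}"
    by (rule strata_of_connected_manifold[where Q = "\<lambda>_. True", OF analytic_submanifold_treves _ connectedin_treves treves_char_nonempty]) auto
  moreover have "strata 8 (constant_rank 4) {treves_char} treves_char = {treves_char}"
    by (rule strata_of_connected_manifold[where Q = "constant_rank 4", OF analytic_submanifold_treves constant_rank_treves connectedin_treves treves_char_nonempty]) auto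
  moreover have "strata 8 (\<lambda>M. constant_rank 4 M \<and> constant_depth 4 6 treves_field M) {treves_char} treves_char = {treves_char}"
    by (rule strata_of_connected_manifold[where Q = "\<lambda>M. constant_rank 4 M \<and> constant_depth 4 6 treves_field M", OF analytic_submanifold_treves _ connectedin_treves treves_char_nonempty])
       (auto simp: constant_rank_treves constant_depth_treves)
  ultimately show ?thesis
    by (simp add: poisson_treves_strata_def characteristic_variety_treves del: topspace_Rn)
qed

section \<open>Failure of the local and of the microlocal assertion\<close>

lemma conic_neighborhood_treves:
  assumes p: "p \<in> treves_char"
  shows "conic_neighborhood 4 (topspace (Rn 4)) p {p \<in> extensional {..<8}. p 6 \<noteq> 0 \<or> p 7 \<noteq> 0}"
  unfolding conic_neighborhood_def
proof (intro conjI ballI allI impI)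
  show "openin (Rn (2 * 4)) {p \<in> extensional {..<8}. p 6 \<noteq> 0 \<or> p 7 \<noteq> 0}"
    using treves_char_open_section by simp
  show "p \<in> {p \<in> extensional {..<8}. p 6 \<noteq> 0 \<or> p 7 \<noteq> 0}" using p by (auto simp: treves_char_def)
  show "{p \<in> extensional {..<8}. p 6 \<noteq> 0 \<or> p 7 \<noteq> 0} \<subseteq> cotangent 4 (topspace (Rn 4))"
  proof
    fix p :: point assume p: "p \<in> {p \<in> extensional {..<8}. p 6 \<noteq> 0 \<or> p 7 \<noteq> 0}"
    then have "p (4 + 2) \<noteq> 0 \<or> p (4 + 3) \<noteq> 0" by simp
    then have "\<exists>k<4. p (4 + k) \<noteq> 0" unfolding ex_less_4 by blast
    then show "p \<in> cotangent 4 (topspace (Rn 4))" using p by (simp add: cotangent_def base_def)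
  qed
  fix q :: point and t :: real assume "q \<in> {p \<in> extensional {..<8}. p 6 \<noteq> 0 \<or> p 7 \<noteq> 0}" "t > 0"
  then show "(\<lambda>i. if 4 \<le> i \<and> i < 2 * 4 then t * q i else q i) \<in> {p \<in> extensional {..<8}. p 6 \<noteq> 0 \<or> p 7 \<noteq> 0}"
    by (auto simp: extensional_def)
qed

theorem corollary2p1:
  shows
    "\<not> (\<forall>n \<Omega> N X.
          hormander_fields n \<Omega> N X \<and>
          (\<forall>\<Sigma>\<in>poisson_treves_strata n \<Omega> N X. symplectic n \<Sigma>) \<longrightarrow>
            analytic_hypoelliptic n \<Omega> N X) \<and>
     \<not> (\<forall>n \<Omega> N X. \<forall>p\<in>characteristic_variety n \<Omega> N X.
          hormander_fields n \<Omega> N X \<and>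
          (\<exists>\<Gamma>. conic_neighborhood n \<Omega> p \<Gamma> \<and>
             (\<forall>\<Sigma>\<in>poisson_treves_strata n \<Omega> N X. symplectic n (\<Sigma> \<inter> \<Gamma>))) \<longrightarrow>
            microlocally_analytic_hypoelliptic_at n \<Omega> N X p)"
proof -
  obtain \<rho> \<kappa> \<mu> g g' where "mode_family \<rho> \<kappa> \<mu> g g'"
    using mode_family_exists by blast
  then interpret mode_family \<rho> \<kappa> \<mu> g g' .
  have "analytic_distribution 4 (topspace (Rn 4)) (sum_of_squares 4 6 treves_field solution)"
    unfolding analytic_distribution_def
    by (intro exI[of _ "\<lambda>_. 0"] conjI real_analytic_0 ballI) (simp add: solution_homogeneous)
  then have "\<not> analytic_hypoelliptic 4 (topspace (Rn 4)) 6 treves_field"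
    unfolding analytic_hypoelliptic_def using solution_distribution solution_not_analytic by blast
  moreover have "\<forall>\<Sigma>\<in>poisson_treves_strata 4 (topspace (Rn 4)) 6 treves_field. symplectic 4 \<Sigma>"
    unfolding poisson_treves_strata_treves using symplectic_treves by blast
  ultimately have local: "\<not> (\<forall>n \<Omega> N X. hormander_fields n \<Omega> N X \<and>
      (\<forall>\<Sigma>\<in>poisson_treves_strata n \<Omega> N X. symplectic n \<Sigma>) \<longrightarrow> analytic_hypoelliptic n \<Omega> N X)"
    using hormander_fields_treves by blast
  have char: "codirection \<in> treves_char" by (simp add: treves_char_def codirection_def)
  let ?\<Gamma> = "{p \<in> extensional {..<8}. p 6 \<noteq> 0 \<or> p 7 \<noteq> (0 :: real)}"
  have "treves_char \<inter> ?\<Gamma> = treves_char" by (auto simp: treves_char_def)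
  then have "\<forall>\<Sigma>\<in>poisson_treves_strata 4 (topspace (Rn 4)) 6 treves_field. symplectic 4 (\<Sigma> \<inter> ?\<Gamma>)"
    unfolding poisson_treves_strata_treves using symplectic_treves by simp
  with conic_neighborhood_treves[OF char]
  have conic: "\<exists>\<Gamma>. conic_neighborhood 4 (topspace (Rn 4)) codirection \<Gamma> \<and>
      (\<forall>\<Sigma>\<in>poisson_treves_strata 4 (topspace (Rn 4)) 6 treves_field. symplectic 4 (\<Sigma> \<inter> \<Gamma>))"
    by blast
  have "base 4 codirection \<in> topspace (Rn 4)" by (simp add: base_codirection)
  \<comment> \<open>The solution is defined on all of R^4, which serves as the neighborhood
    \<open>U\<close> of the definition.\<close>
  then have micro: "\<not> microlocally_analytic_hypoelliptic_at 4 (topspace (Rn 4)) 6 treves_field codirection"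
    unfolding microlocally_analytic_hypoelliptic_at_def
    using solution_distribution codirection_notin_WF_image codirection_in_WF openin_topspace[of "Rn 4"] by blast
  have "codirection \<in> characteristic_variety 4 (topspace (Rn 4)) 6 treves_field"
    unfolding characteristic_variety_treves by (rule char)
  with conic micro hormander_fields_treves
  have "\<not> (\<forall>n \<Omega> N X. \<forall>p\<in>characteristic_variety n \<Omega> N X.
      hormander_fields n \<Omega> N X \<and> (\<exists>\<Gamma>. conic_neighborhood n \<Omega> p \<Gamma> \<and>
         (\<forall>\<Sigma>\<in>poisson_treves_strata n \<Omega> N X. symplectic n (\<Sigma> \<inter> \<Gamma>))) \<longrightarrow>
      microlocally_analytic_hypoelliptic_at n \<Omega> N X p)"
    by blast
  with local show ?thesis by (rule conjI)
qed

end
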